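(* Let $\mathcal{L}$ be a countable language and $\mathcal{T}$ a countable $\mathcal{L}_{\omega_1\omega}$-theory. Then every fiberwise countable Borel $\mathsf{Mod}(\mathcal{L},\mathcal{T})$-space is isomorphic (via a Borel equivariant isomorphism) to $[\![A]\!]$ for some $(\mathcal{L}_{\omega_1\omega},\mathcal{T})$-imaginary sort $A$.
   Context: **Logic.** Languages are relational (functions are coded by their graphs). $\mathcal{L}_{\omega_1\omega}$ extends finitary first-order logic with equality by countable conjunctions and disjunctions; formulas have finitely many free variables and are always considered together with a finite tuple of distinct variables containing the free ones (up to renaming variables). $\mathcal{T}\vdash\phi$ means provability in the standard Gentzen-type proof system for $\mathcal{L}_{\omega_1\omega}$ (empty structures are allowed); for countable $\mathcal{T}$ this is equivalent, by the completeness theorem, to truth of $\phi$ in all countable models of $\mathcal{T}$. **Imaginary sorts.** An $(\mathcal{L}_{\omega_1\omega},\mathcal{T})$-imaginary sort $A=(\bigsqcup_i\alpha_i)/(\bigsqcup_{i,j}\epsilon_{ij})$ consists of countable families of $\mathcal{L}_{\omega_1\omega}$-formulas $\alpha_i(\vec x_i)$ (with $n_i=|\vec x_i|$ possibly varying) and $\epsilon_{ij}(\vec x_i,\vec x_j)$ such that $\mathcal{T}$ proves that $\bigsqcup_{i,j}\epsilon_{ij}$ is an equivalence relation on $\bigsqcup_i\alpha_i$: $\epsilon_{ij}(\vec x,\vec y)\Rightarrow\alpha_i(\vec x)\wedge\alpha_j(\vec y)$; $\alpha_i(\vec x)\Rightarrow\epsilon_{ii}(\vec x,\vec x)$; $\epsilon_{ij}(\vec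 x,\vec y)\Rightarrow\epsilon_{ji}(\vec y,\vec x)$; $\epsilon_{ij}(\vec x,\vec y)\wedge\epsilon_{jk}(\vec y,\vec z)\Rightarrow\epsilon_{ik}(\vec x,\vec z)$ (universally quantified). For a model $\mathcal{M}$ of $\mathcal{T}$ with underlying set $M$, $A^{\mathcal M}:=(\bigsqcup_i\alpha_i^{\mathcal M})/(\bigsqcup_{i,j}\epsilon_{ij}^{\mathcal M})$, where $\alpha_i^{\mathcal M}\subseteq M^{n_i}$. **Groupoid of models.** $\mathrm{Mod}(\mathcal{L},\mathcal{T})$ is the set of models of $\mathcal{T}$ whose underlying set is an initial segment of $\mathbb{N}$ (one of $0,1,2,\dots,\mathbb{N}$, with $n=\{0,\dots,n-1\}$), with the standard Borel structure generated by the sets $\{\mathcal{M}: |M|\ge n\}$ and $\{\mathcal{M}:\vec a\in M^n,\ R^{\mathcal M}(\vec a)\}$ for $n$-ary $R\in\mathcal{L}$, $\vec a\in\mathbb{N}^n$. $\mathsf{Mod}(\mathcal{L},\mathcal{T})$ is the standard Borel groupoid with object space $\mathrm{Mod}(\mathcal{L},\mathcal{T})$ and morphisms all isomorphisms $g:\mathcal{M}\cong\mathcal{N}$ between such models; the Borel structure on morphisms is generated by $\{g:\mathcal M\cong\mathcal N\mid\mathcal{M}\in B\}$ for $B$ Borel and $\{g:\mathcal M\cong\mathcal N\mid a,b\in M,\ g(a)=b\}$ for $a,b\in\mathbb{N}$. **Fiberwise countable Borel $\mathsf{G}$-spaces.** For a standard Borel groupoid $\mathsf{G}=(G^0,G^1)$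 (objects $G^0$, morphisms $G^1$, source $\partial_1$, target $\partial_0$), a fiberwise countable Borel $\mathsf{G}$-space is a standard Borel space $X$ with a Borel map $p:X\to G^0$ with countable fibers and a Borel action $(g,x)\mapsto g\cdot x$, defined for $\partial_1(g)=p(x)$, with $p(g\cdot x)=\partial_0(g)$, $1_{p(x)}\cdot x=x$, $(h\cdot g)\cdot x=h\cdot(g\cdot x)$. Isomorphisms are Borel bijections commuting with the projections to $G^0$ and the actions. **The space $[\![A]\!]$.** $[\![A]\!]:=\{(\mathcal{M},a):\mathcal{M}\in\mathrm{Mod}(\mathcal{L},\mathcal{T}),\ a\in A^{\mathcal M}\}$, with projection to $\mathrm{Mod}(\mathcal{L},\mathcal{T})$ and the action in which an isomorphism $g:\mathcal{M}\cong\mathcal{N}$ acts by the induced bijection $A^{\mathcal M}\cong A^{\mathcal N}$. Its standard Borel structure: for a formula $\alpha$ with $n$ variables, $[\![\alpha]\!]$ is the disjoint union over $\vec a\in\mathbb{N}^n$ of copies of the Borel sets $\{\mathcal{M}:\vec a\in M^n,\ \alpha^{\mathcal M}(\vec a)\}$; $[\![\bigsqcup_i\alpha_i]\!]=\bigsqcup_i[\![\alpha_i]\!]$; and for $A=(\bigsqcup_i\alpha_i)/(\bigsqcup\epsilon_{ij})$ a subset of $[\![A]\!]$ is Borel iff its preimage in $[\![\bigsqcup_i\alpha_i]\!]$ is. *)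

theory Defs
  imports "HOL-Analysis.Analysis" "HOL-Library.Countable_Set_Type"
begin

section \<open>The logic\<close>

record 'r lang =
  syms :: "'r set"
  arity :: "'r \<Rightarrow> nat"

text \<open>Variables are de Bruijn indices: a quantifier binds index 0. A formula together with a tuple
  of n distinct variables containing its free ones is, up to renaming, a formula all of whose free
  indices are below n; index k stands for the k-th member of the tuple. In particular a formula
  has only finitely many free variables.\<close>

datatype 'r fm =
    Eq nat nat
  | Rel 'r "nat list"
  | Neg "'r fm"
  | Conj "'r fm cset"
  | Disj "'r fm cset"
  | All "'r fm"
  | Ex "'r fm"

inductive fml :: "'r lang \<Rightarrow> nat \<Rightarrow> 'r fm \<Rightarrow> bool" for L where
  "i < n \<Longrightarrow> j < n \<Longrightarrow> fml L n (Eq i j)"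
| "R \<in> syms L \<Longrightarrow> length ks = arity L R \<Longrightarrow> set ks \<subseteq> {..<n} \<Longrightarrow> fml L n (Rel R ks)"
| "fml L n \<phi> \<Longrightarrow> fml L n (Neg \<phi>)"
| "\<forall>\<phi>\<in>rcset F. fml L n \<phi> \<Longrightarrow> fml L n (Conj F)"
| "\<forall>\<phi>\<in>rcset F. fml L n \<phi> \<Longrightarrow> fml L n (Disj F)"
| "fml L (Suc n) \<phi> \<Longrightarrow> fml L n (All \<phi>)"
| "fml L (Suc n) \<phi> \<Longrightarrow> fml L n (Ex \<phi>)"

abbreviation And :: "'r fm \<Rightarrow> 'r fm \<Rightarrow> 'r fm" where
  "And \<phi> \<psi> \<equiv> Conj (cinsert \<phi> (csingle \<psi>))"

abbreviation Imp :: "'r fm \<Rightarrow> 'r fm \<Rightarrow> 'r fm" where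
  "Imp \<phi> \<psi> \<equiv> Disj (cinsert (Neg \<phi>) (csingle \<psi>))"

text \<open>Universal closure of a formula in n variables.\<close>

abbreviation Alls :: "nat \<Rightarrow> 'r fm \<Rightarrow> 'r fm" where
  "Alls n \<phi> \<equiv> (All ^^ n) \<phi>"

text \<open>Renaming of the free variables; capture is avoided by lifting under a quantifier.\<close>

primrec ren :: "(nat \<Rightarrow> nat) \<Rightarrow> 'r fm \<Rightarrow> 'r fm" where
  "ren \<rho> (Eq i j) = Eq (\<rho> i) (\<rho> j)"
| "ren \<rho> (Rel R ks) = Rel R (map \<rho> ks)"
| "ren \<rho> (Neg \<phi>) = Neg (ren \<rho> \<phi>)"
| "ren \<rho> (Conj F) = Conj (cimage (ren \<rho>) F)"
| "ren \<rho> (Disj F) = Disj (cimage (ren \<rho>) F)"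
| "ren \<rho> (All \<phi>) = All (ren (case_nat 0 (\<lambda>k. Suc (\<rho> k))) \<phi>)"
| "ren \<rho> (Ex \<phi>) = Ex (ren (case_nat 0 (\<lambda>k. Suc (\<rho> k))) \<phi>)"

text \<open>The formula \<open>\<phi>(v\<^sub>0, \<dots>, v\<^sub>n\<^sub>-\<^sub>1)\<close>, for a \<open>\<phi>\<close> in n variables and a list of n variables.\<close>

abbreviation app :: "'r fm \<Rightarrow> nat list \<Rightarrow> 'r fm" where
  "app \<phi> vs \<equiv> ren (\<lambda>k. vs ! k) \<phi>"

text \<open>Instantiation of the outermost quantified variable by variable i.\<close>

abbreviation inst :: "nat \<Rightarrow> 'r fm \<Rightarrow> 'r fm" where
  "inst i \<phi> \<equiv> ren (case_nat i (\<lambda>k. k)) \<phi>"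

definition is_theory :: "'r lang \<Rightarrow> 'r fm set \<Rightarrow> bool" where
  "is_theory L T \<longleftrightarrow> (\<forall>\<tau>\<in>T. fml L 0 \<tau>)"

text \<open>Gentzen-type calculus with cut, with the sentences of T as additional initial sequents.
  \<open>prov L T n \<Gamma> \<Delta>\<close> is derivability of the sequent \<open>\<Gamma> \<Rightarrow> \<Delta>\<close> in the context of the variables
  \<open>0, \<dots>, n - 1\<close>. The context has to be recorded because structures may be empty: a sequent derived in
  context 1 need not be derivable in context 0, even if no variable occurs in it.\<close>

definition cedent :: "'r lang \<Rightarrow> nat \<Rightarrow> 'r fm set \<Rightarrow> bool" where
  "cedent L n \<Gamma> \<longleftrightarrow> finite \<Gamma> \<and> (\<forall>\<phi>\<in>\<Gamma>. fml L n \<phi>)"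

inductive prov :: "'r lang \<Rightarrow> 'r fm set \<Rightarrow> nat \<Rightarrow> 'r fm set \<Rightarrow> 'r fm set \<Rightarrow> bool" for L T where
  Init: "fml L n \<phi> \<Longrightarrow> prov L T n {\<phi>} {\<phi>}"
| Axiom: "\<tau> \<in> T \<Longrightarrow> prov L T n {} {\<tau>}"
| Weak: "prov L T n \<Gamma> \<Delta> \<Longrightarrow> \<Gamma> \<subseteq> \<Gamma>' \<Longrightarrow> \<Delta> \<subseteq> \<Delta>' \<Longrightarrow> cedent L n \<Gamma>' \<Longrightarrow> cedent L n \<Delta>'
    \<Longrightarrow> prov L T n \<Gamma>' \<Delta>'"
| Cut: "prov L T n \<Gamma> (insert \<phi> \<Delta>) \<Longrightarrow> prov L T n (insert \<phi> \<Gamma>) \<Delta> \<Longrightarrow> prov L T n \<Gamma> \<Delta>"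
| EqRefl: "i < n \<Longrightarrow> prov L T n {} {Eq i i}"
| EqSubst: "i < n \<Longrightarrow> j < n \<Longrightarrow> fml L (Suc n) \<phi> \<Longrightarrow> prov L T n {Eq i j, inst i \<phi>} {inst j \<phi>}"
| NegL: "prov L T n \<Gamma> (insert \<phi> \<Delta>) \<Longrightarrow> prov L T n (insert (Neg \<phi>) \<Gamma>) \<Delta>"
| NegR: "prov L T n (insert \<phi> \<Gamma>) \<Delta> \<Longrightarrow> prov L T n \<Gamma> (insert (Neg \<phi>) \<Delta>)"
| ConjL: "\<phi> \<in> rcset F \<Longrightarrow> fml L n (Conj F) \<Longrightarrow> prov L T n (insert \<phi> \<Gamma>) \<Delta>
    \<Longrightarrow> prov L T n (insert (Conj F) \<Gamma>) \<Delta>"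
| ConjR: "cedent L n \<Gamma> \<Longrightarrow> cedent L n \<Delta> \<Longrightarrow> fml L n (Conj F)
    \<Longrightarrow> \<forall>\<phi>\<in>rcset F. prov L T n \<Gamma> (insert \<phi> \<Delta>)
    \<Longrightarrow> prov L T n \<Gamma> (insert (Conj F) \<Delta>)"
| DisjL: "cedent L n \<Gamma> \<Longrightarrow> cedent L n \<Delta> \<Longrightarrow> fml L n (Disj F)
    \<Longrightarrow> \<forall>\<phi>\<in>rcset F. prov L T n (insert \<phi> \<Gamma>) \<Delta>
    \<Longrightarrow> prov L T n (insert (Disj F) \<Gamma>) \<Delta>"
| DisjR: "\<phi> \<in> rcset F \<Longrightarrow> fml L n (Disj F) \<Longrightarrow> prov L T n \<Gamma> (insert \<phi> \<Delta>)
    \<Longrightarrow> prov L T n \<Gamma> (insert (Disj F) \<Delta>)"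
| AllL: "i < n \<Longrightarrow> fml L n (All \<phi>) \<Longrightarrow> prov L T n (insert (inst i \<phi>) \<Gamma>) \<Delta>
    \<Longrightarrow> prov L T n (insert (All \<phi>) \<Gamma>) \<Delta>"
| AllR: "cedent L n \<Gamma> \<Longrightarrow> cedent L n \<Delta> \<Longrightarrow> prov L T (Suc n) (ren Suc ` \<Gamma>) (insert \<phi> (ren Suc ` \<Delta>))
    \<Longrightarrow> prov L T n \<Gamma> (insert (All \<phi>) \<Delta>)"
| ExL: "cedent L n \<Gamma> \<Longrightarrow> cedent L n \<Delta> \<Longrightarrow> prov L T (Suc n) (insert \<phi> (ren Suc ` \<Gamma>)) (ren Suc ` \<Delta>)
    \<Longrightarrow> prov L T n (insert (Ex \<phi>) \<Gamma>) \<Delta>"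
| ExR: "i < n \<Longrightarrow> fml L n (Ex \<phi>) \<Longrightarrow> prov L T n \<Gamma> (insert (inst i \<phi>) \<Delta>)
    \<Longrightarrow> prov L T n \<Gamma> (insert (Ex \<phi>) \<Delta>)"

definition proves :: "'r lang \<Rightarrow> 'r fm set \<Rightarrow> 'r fm \<Rightarrow> bool" where
  "proves L T \<phi> \<longleftrightarrow> prov L T 0 {} {\<phi>}"


section \<open>Structures and models\<close>

record ('r, 'a) struct =
  univ :: "'a set"
  intp :: "'r \<Rightarrow> 'a list set"

text \<open>Symbols outside the language are interpreted by the empty set, so that a structure is
  determined by its universe and the interpretation of the symbols of the language.\<close>

definition is_struct :: "'r lang \<Rightarrow> ('r, 'a) struct \<Rightarrow> bool" where
  "is_struct L M \<longleftrightarrow>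
    (\<forall>R. intp M R \<subseteq> {as. R \<in> syms L \<and> length as = arity L R \<and> set as \<subseteq> univ M})"

primrec sat :: "('r, 'a) struct \<Rightarrow> 'a list \<Rightarrow> 'r fm \<Rightarrow> bool" where
  "sat M as (Eq i j) \<longleftrightarrow> as ! i = as ! j"
| "sat M as (Rel R ks) \<longleftrightarrow> map (\<lambda>k. as ! k) ks \<in> intp M R"
| "sat M as (Neg \<phi>) \<longleftrightarrow> \<not> sat M as \<phi>"
| "sat M as (Conj F) \<longleftrightarrow> (\<forall>P \<in> rcset (cimage (sat M as) F). P)"
| "sat M as (Disj F) \<longleftrightarrow> (\<exists>P \<in> rcset (cimage (sat M as) F). P)"
| "sat M as (All \<phi>) \<longleftrightarrow> (\<forall>a \<in> univ M. sat M (a # as) \<phi>)"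
| "sat M as (Ex \<phi>) \<longleftrightarrow> (\<exists>a \<in> univ M. sat M (a # as) \<phi>)"

definition is_iso :: "'r lang \<Rightarrow> ('r, 'a) struct \<Rightarrow> ('a \<Rightarrow> 'b) \<Rightarrow> ('r, 'b) struct \<Rightarrow> bool" where
  "is_iso L M g N \<longleftrightarrow> bij_betw g (univ M) (univ N) \<and>
    (\<forall>R\<in>syms L. \<forall>as. length as = arity L R \<longrightarrow> set as \<subseteq> univ M \<longrightarrow>
      (as \<in> intp M R \<longleftrightarrow> map g as \<in> intp N R))"


section \<open>Groupoids and fiberwise countable Borel spaces over them\<close>

text \<open>As usual in HOL-Analysis, a Borel space is a \<open>measure\<close> of which only \<open>space\<close> and \<open>sets\<close>
  matter.\<close>

definition standard_borel :: "'a measure \<Rightarrow> bool" where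
  "standard_borel X \<longleftrightarrow>
    (\<exists>\<tau>. topspace \<tau> = space X \<and> completely_metrizable_space \<tau> \<and> second_countable \<tau> \<and>
         sets X = sigma_sets (space X) {U. openin \<tau> U})"

text \<open>Inverses are not part of the data, being determined by the composition.\<close>

record ('o, 'm) gpd =
  objs :: "'o measure"
  mors :: "'m measure"
  src :: "'m \<Rightarrow> 'o"
  tgt :: "'m \<Rightarrow> 'o"
  ident :: "'o \<Rightarrow> 'm"
  comps :: "'m \<Rightarrow> 'm \<Rightarrow> 'm"  \<comment> \<open>\<open>comps G h g\<close> is \<open>h \<cdot> g\<close>, meaningful for \<open>src G h = tgt G g\<close>\<close>

record ('x, 'o, 'm) gspace =
  pts :: "'x measure"
  proj :: "'x \<Rightarrow> 'o"
  act :: "'m \<Rightarrow> 'x \<Rightarrow> 'x"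

definition action_dom :: "('o, 'm) gpd \<Rightarrow> ('x, 'o, 'm) gspace \<Rightarrow> ('m \<times> 'x) set" where
  "action_dom G X = {(g, x). g \<in> space (mors G) \<and> x \<in> space (pts X) \<and> src G g = proj X x}"

definition fc_borel_gspace :: "('o, 'm) gpd \<Rightarrow> ('x, 'o, 'm) gspace \<Rightarrow> bool" where
  "fc_borel_gspace G X \<longleftrightarrow>
    standard_borel (pts X) \<and>
    proj X \<in> pts X \<rightarrow>\<^sub>M objs G \<and>
    (\<forall>m \<in> space (objs G). countable {x \<in> space (pts X). proj X x = m}) \<and>
    (\<lambda>(g, x). act X g x) \<in> restrict_space (mors G \<Otimes>\<^sub>M pts X) (action_dom G X) \<rightarrow>\<^sub>M pts X \<and>
    (\<forall>(g, x) \<in> action_dom G X. proj X (act X g x) = tgt G g) \<and>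
    (\<forall>x \<in> space (pts X). act X (ident G (proj X x)) x = x) \<and>
    (\<forall>(g, x) \<in> action_dom G X. \<forall>h \<in> space (mors G). src G h = tgt G g \<longrightarrow>
       act X (comps G h g) x = act X h (act X g x))"

definition gspace_iso ::
    "('o, 'm) gpd \<Rightarrow> ('x, 'o, 'm) gspace \<Rightarrow> ('y, 'o, 'm) gspace \<Rightarrow> ('x \<Rightarrow> 'y) \<Rightarrow> bool" where
  "gspace_iso G X Y f \<longleftrightarrow>
    f \<in> pts X \<rightarrow>\<^sub>M pts Y \<and>
    bij_betw f (space (pts X)) (space (pts Y)) \<and>
    (\<forall>x \<in> space (pts X). proj Y (f x) = proj X x) \<and>
    (\<forall>(g, x) \<in> action_dom G X. f (act X g x) = act Y g (f x))"


section \<open>The groupoid of models\<close>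

definition Mod :: "'r lang \<Rightarrow> 'r fm set \<Rightarrow> ('r, nat) struct set" where
  "Mod L T = {M. univ M \<in> insert UNIV (range (\<lambda>n. {..<n})) \<and> is_struct L M \<and> (\<forall>\<tau>\<in>T. sat M [] \<tau>)}"

definition ModB :: "'r lang \<Rightarrow> 'r fm set \<Rightarrow> ('r, nat) struct measure" where
  "ModB L T = sigma (Mod L T)
    ({{M \<in> Mod L T. infinite (univ M) \<or> n \<le> card (univ M)} | n. True} \<union>
     {{M \<in> Mod L T. set as \<subseteq> univ M \<and> as \<in> intp M R} | R as. R \<in> syms L \<and> length as = arity L R})"

text \<open>Morphisms carry their source and target; the underlying map is \<open>undefined\<close> outside the
  universe of the source, so that a morphism is determined by its values there.\<close>

type_synonym 'r miso = "('r, nat) struct \<times> (nat \<Rightarrow> nat) \<times> ('r, nat) struct"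

definition Isos :: "'r lang \<Rightarrow> 'r fm set \<Rightarrow> 'r miso set" where
  "Isos L T = {(M, g, N). M \<in> Mod L T \<and> N \<in> Mod L T \<and> g \<in> extensional (univ M) \<and> is_iso L M g N}"

definition IsosB :: "'r lang \<Rightarrow> 'r fm set \<Rightarrow> 'r miso measure" where
  "IsosB L T = sigma (Isos L T)
    ({{(M, g, N) \<in> Isos L T. M \<in> B} | B. B \<in> sets (ModB L T)} \<union>
     {{(M, g, N) \<in> Isos L T. a \<in> univ M \<and> b \<in> univ M \<and> g a = b} | a b. True})"

definition ModG :: "'r lang \<Rightarrow> 'r fm set \<Rightarrow> (('r, nat) struct, 'r miso) gpd" where
  "ModG L T = \<lparr>
    objs = ModB L T,
    mors = IsosB L T,
    src = (\<lambda>(M, g, N). M),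
    tgt = (\<lambda>(M, g, N). N),
    ident = (\<lambda>M. (M, restrict id (univ M), M)),
    comps = (\<lambda>(N', h, P) (M, g, N). (M, compose (univ M) h g, P))\<rparr>"


section \<open>Imaginary sorts\<close>

text \<open>The countable index set of the family is taken to be a set of natural numbers.
  \<open>eps A i j\<close> is a formula in \<open>vars A i + vars A j\<close> variables.\<close>

record 'r sort_data =
  idx :: "nat set"
  vars :: "nat \<Rightarrow> nat"
  alpha :: "nat \<Rightarrow> 'r fm"
  eps :: "nat \<Rightarrow> nat \<Rightarrow> 'r fm"

definition imaginary_sort :: "'r lang \<Rightarrow> 'r fm set \<Rightarrow> 'r sort_data \<Rightarrow> bool" where
  "imaginary_sort L T A \<longleftrightarrow>
    (\<forall>i\<in>idx A. fml L (vars A i) (alpha A i)) \<and>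
    (\<forall>i\<in>idx A. \<forall>j\<in>idx A. fml L (vars A i + vars A j) (eps A i j)) \<and>
    (\<forall>i\<in>idx A. \<forall>j\<in>idx A.
      let n = vars A i + vars A j; x = [0..<vars A i]; y = [vars A i..<n] in
      proves L T (Alls n (Imp (app (eps A i j) (x @ y)) (And (app (alpha A i) x) (app (alpha A j) y))))) \<and>
    (\<forall>i\<in>idx A.
      let n = vars A i; x = [0..<n] in
      proves L T (Alls n (Imp (app (alpha A i) x) (app (eps A i i) (x @ x))))) \<and>
    (\<forall>i\<in>idx A. \<forall>j\<in>idx A.
      let n = vars A i + vars A j; x = [0..<vars A i]; y = [vars A i..<n] in
      proves L T (Alls n (Imp (app (eps A i j) (x @ y)) (app (eps A j i) (y @ x))))) \<and>
    (\<forall>i\<in>idx A. \<forall>j\<in>idx A. \<forall>k\<in>idx A.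
      let m = vars A i + vars A j; n = m + vars A k;
          x = [0..<vars A i]; y = [vars A i..<m]; z = [m..<n] in
      proves L T (Alls n (Imp (And (app (eps A i j) (x @ y)) (app (eps A j k) (y @ z)))
                              (app (eps A i k) (x @ z)))))"

text \<open>\<open>\<Squnion>\<^sub>i \<alpha>\<^sub>i\<close> and \<open>\<Squnion>\<^sub>i\<^sub>j \<epsilon>\<^sub>i\<^sub>j\<close> evaluated in a structure; elements of the disjoint union are tagged
  by their index.\<close>

definition alphas :: "'r sort_data \<Rightarrow> ('r, 'a) struct \<Rightarrow> (nat \<times> 'a list) set" where
  "alphas A M = {(i, as). i \<in> idx A \<and> length as = vars A i \<and> set as \<subseteq> univ M \<and> sat M as (alpha A i)}"

definition epss :: "'r sort_data \<Rightarrow> ('r, 'a) struct \<Rightarrow> ((nat \<times> 'a list) \<times> (nat \<times> 'a list)) set" where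
  "epss A M = {((i, as), (j, bs)). i \<in> idx A \<and> j \<in> idx A \<and>
     length as = vars A i \<and> set as \<subseteq> univ M \<and> length bs = vars A j \<and> set bs \<subseteq> univ M \<and>
     sat M (as @ bs) (eps A i j)}"

definition interp_sort :: "'r sort_data \<Rightarrow> ('r, 'a) struct \<Rightarrow> (nat \<times> 'a list) set set" where
  "interp_sort A M = alphas A M // epss A M"

text \<open>The disjoint union, over the indices i and the tuples \<open>as\<close>, of the Borel subspaces of models
  in which \<open>as\<close> satisfies \<open>\<alpha>\<^sub>i\<close>.\<close>

definition alphasB :: "'r lang \<Rightarrow> 'r fm set \<Rightarrow> 'r sort_data \<Rightarrow>
    (('r, nat) struct \<times> (nat \<times> nat list)) measure" where
  "alphasB L T A = (let \<Omega> = (SIGMA M : Mod L T. alphas A M) in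
    sigma \<Omega> {S. S \<subseteq> \<Omega> \<and> (\<forall>i as. {M. (M, (i, as)) \<in> S} \<in>
      sets (restrict_space (ModB L T) {M. (M, (i, as)) \<in> \<Omega>}))})"

definition sortB :: "'r lang \<Rightarrow> 'r fm set \<Rightarrow> 'r sort_data \<Rightarrow>
    (('r, nat) struct \<times> (nat \<times> nat list) set) measure" where
  "sortB L T A = (let \<Omega> = (SIGMA M : Mod L T. interp_sort A M) in
    sigma \<Omega> {S. S \<subseteq> \<Omega> \<and>
      {(M, u) \<in> space (alphasB L T A). (M, epss A M `` {u}) \<in> S} \<in> sets (alphasB L T A)})"

definition sort_gspace :: "'r lang \<Rightarrow> 'r fm set \<Rightarrow> 'r sort_data \<Rightarrow>
    (('r, nat) struct \<times> (nat \<times> nat list) set, ('r, nat) struct, 'r miso) gspace" where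
  "sort_gspace L T A = \<lparr>
    pts = sortB L T A,
    proj = fst,
    act = (\<lambda>(M, g, N) (M', c). (N, (\<lambda>(i, as). (i, map g as)) ` c))\<rparr>"

end

theory Submission
  imports Defs
begin

text \<open>Points of \<open>X\<close> can be named by finite tuples of elements of the model below them, and the property of
  being a name is definable.

  By the Lusin--Novikov theorem (\<open>countable_to_one_cover\<close>), \<open>X\<close> is a union of countably many Borel sets
  \<open>V\<^sub>j\<close> on which the projection \<open>p\<close> is injective. Let \<open>x\<close> lie over \<open>M\<close>. An enumeration \<open>k\<close> of the universe
  of \<open>M\<close> is an isomorphism onto \<open>M\<close> from the structure \<open>pull L M k\<close>, and its inverse moves \<open>x\<close> to a point
  over that structure, which lies in some \<open>V\<^sub>j\<close>. By Baire category there are \<open>j\<close> and a finite tuple \<open>a\<close>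
  such that \<open>x\<close> is moved into the same \<open>V\<^sub>j\<close> by comeagerly many of the enumerations that start with \<open>a\<close>;
  call \<open>(j, a)\<close> a name of \<open>x\<close>. So every point has a name (\<open>star_cover\<close>). A name denotes at most one
  point over \<open>M\<close> (\<open>star_inj\<close>): two such points are moved into \<open>V\<^sub>j\<close> by a common enumeration, to points
  over the same structure, and \<open>p\<close> is injective on \<open>V\<^sub>j\<close>. Isomorphisms carry names to names
  (\<open>star_act\<close>).

  Category quantifiers preserve Borel sets (\<open>good_translate\<close>), so the set of points with a given name is
  Borel, and so is its image under \<open>p\<close>, by the Lusin--Souslin theorem (\<open>inj_image_sets\<close>). Hence ``\<open>a\<close> is a
  \<open>j\<close>-name over \<open>M\<close>'' and ``\<open>a\<close> and \<open>b\<close> name the same point over \<open>M\<close>'' are isomorphism-invariant Borel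
  conditions, and by the Lopez-Escobar theorem (\<open>Lopez_Escobar\<close>) they are given by formulas \<open>\<alpha>\<^sub>i\<close> and
  \<open>\<epsilon>\<^sub>i\<^sub>j\<close>. Sending a point to the set of its names is then the required isomorphism.

  In every model these formulas define an equivalence relation. To make this provable, each of them is
  replaced by its conjunction with the sentence \<open>\<theta>\<close> that states the axioms of an equivalence relation.
  Models of the theory satisfy \<open>\<theta>\<close>, so nothing changes semantically, while the axioms for the new formulas
  have short derivations (\<open>imaginary_sort_relativize\<close>): \<open>\<theta>\<close> is available in the antecedent of each of
  them.\<close>

section \<open>Analytic subsets of Baire space\<close>

type_synonym baire = "nat \<Rightarrow> nat"

lemma tree_branch:
  assumes "P []" and step: "\<And>s. P s \<Longrightarrow> \<exists>k. P (s @ [k])"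
  shows "\<exists>x :: nat \<Rightarrow> 'b. \<forall>n. P (map x [0..<n])"
proof -
  define S where "S = rec_nat [] (\<lambda>_ s. s @ [SOME k. P (s @ [k])])"
  define x where "x n = (SOME k. P (S n @ [k]))" for n
  have "P (S n) \<and> S n = map x [0..<n]" for n
  proof (induction n)
    case 0
    then show ?case using assms(1) by (simp add: S_def)
  next
    case (Suc n)
    have "P (S n @ [x n])" unfolding x_def by (rule someI_ex) (use Suc step in blast)
    moreover have "S (Suc n) = S n @ [x n]" by (simp add: S_def x_def)
    ultimately show ?case using Suc by simp
  qed
  then show ?thesis by metis
qed

lemma continuous_on_snd_coord:
  "continuous_on S (\<lambda>p :: 'a::topological_space \<times> baire. snd p i)"
  by (intro continuous_on_product_then_coordinatewise[OF continuous_on_snd] continuous_on_id)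

lemma continuous_on_reindex:
  "continuous_on UNIV (\<lambda>p :: 'a::topological_space \<times> baire. (fst p, \<lambda>m. snd p (h m)))"
  by (intro continuous_on_Pair continuous_on_fst continuous_on_id
      continuous_on_coordinatewise_then_product continuous_on_snd_coord)

lemma closed_discrete_vimage:
  fixes f :: "'a::topological_space \<Rightarrow> 'b::discrete_topology"
  assumes "continuous_on UNIV f"
  shows "closed {x. f x \<in> A}"
  using closed_vimage[OF _ assms, of A] by (simp add: closed_def open_discrete vimage_def)

text \<open>Projections along Baire space of closed sets, rather than continuous images: closure under countable
  unions, countable intersections and projections then only needs recoding of the witness.\<close>

definition analytic :: "'a::topological_space set \<Rightarrow> bool" where
  "analytic A \<longleftrightarrow> (\<exists>C :: ('a \<times> baire) set. closed C \<and> A = fst ` C)"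

lemma analyticI: 
  fixes P :: "'a::topological_space \<Rightarrow> baire \<Rightarrow> bool"
  shows "closed {(x, z). P x z} \<Longrightarrow> (\<And>x. x \<in> A \<longleftrightarrow> (\<exists>z. P x z)) \<Longrightarrow> analytic A"
  unfolding analytic_def by (rule exI[of _ "{(x, z). P x z}"]) (auto simp: image_iff)

lemma analyticD:
  assumes "analytic A"
  shows "\<exists>C :: 'a::topological_space \<times> baire \<Rightarrow> bool. closed {p. C p} \<and> (\<forall>x. x \<in> A \<longleftrightarrow> (\<exists>z. C (x, z)))"
proof -
  obtain C :: "('a \<times> baire) set" where "closed C" "A = fst ` C" using assms by (auto simp: analytic_def)
  then have "closed {p. p \<in> C} \<and> (\<forall>x. x \<in> A \<longleftrightarrow> (\<exists>z. (x, z) \<in> C))" by force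
  then show ?thesis by (rule exI[of _ "\<lambda>p. p \<in> C"])
qed

lemma analytic_closed: "closed A \<Longrightarrow> analytic A"
  unfolding analytic_def by (rule exI[of _ "A \<times> UNIV"]) (auto intro: closed_Times)

lemma analytic_UN:
  fixes A :: "nat \<Rightarrow> 'a::topological_space set"
  assumes "\<And>n. analytic (A n)"
  shows "analytic (\<Union>n. A n)"
proof -
  have "\<exists>C :: 'a \<times> baire \<Rightarrow> bool. closed {p. C p} \<and> (\<forall>x. x \<in> A n \<longleftrightarrow> (\<exists>z. C (x, z)))" for n
    using assms[of n] by (rule analyticD)
  then obtain C :: "nat \<Rightarrow> 'a \<times> baire \<Rightarrow> bool" where C: "\<And>n. closed {p. C n p}" "\<And>n x. x \<in> A n \<longleftrightarrow> (\<exists>z. C n (x, z))"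
    by metis
  show ?thesis
  proof (rule analyticI[where P = "\<lambda>x z. \<forall>n. z 0 \<in> - {n} \<or> C n (x, \<lambda>m. z (Suc m))"])
    have "closed {p :: 'a \<times> baire. snd p 0 \<in> - {n}}" for n
      by (intro closed_discrete_vimage continuous_on_snd_coord)
    moreover have "closed {p :: 'a \<times> baire. C n (fst p, \<lambda>m. snd p (Suc m))}" for n
      using closed_vimage[OF C(1)[of n], of "\<lambda>p. (fst p, \<lambda>m. snd p (Suc m))"]
      by (simp add: vimage_def continuous_on_reindex)
    ultimately show "closed {(x, z). \<forall>n. z 0 \<in> - {n} \<or> C n (x, \<lambda>m. z (Suc m))}"
      unfolding case_prod_unfold by (intro closed_Collect_all closed_Collect_disj)
    show "x \<in> (\<Union>n. A n) \<longleftrightarrow> (\<exists>z. \<forall>n. z 0 \<in> - {n} \<or> C n (x, \<lambda>m. z (Suc m)))" for x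
    proof
      assume "x \<in> (\<Union>n. A n)"
      then obtain n z where "C n (x, z)" using C(2) by blast
      then show "\<exists>z. \<forall>n. z 0 \<in> - {n} \<or> C n (x, \<lambda>m. z (Suc m))"
        by (intro exI[of _ "case_nat n z"]) auto
    qed (use C(2) in blast)
  qed
qed

lemma analytic_INT:
  fixes A :: "nat \<Rightarrow> 'a::topological_space set"
  assumes "\<And>n. analytic (A n)"
  shows "analytic (\<Inter>n. A n)"
proof -
  have "\<exists>C :: 'a \<times> baire \<Rightarrow> bool. closed {p. C p} \<and> (\<forall>x. x \<in> A n \<longleftrightarrow> (\<exists>z. C (x, z)))" for n
    using assms[of n] by (rule analyticD)
  then obtain C :: "nat \<Rightarrow> 'a \<times> baire \<Rightarrow> bool" where C: "\<And>n. closed {p. C n p}" "\<And>n x. x \<in> A n \<longleftrightarrow> (\<exists>z. C n (x, z))"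
    by metis
  show ?thesis
  proof (rule analyticI[where P = "\<lambda>x z. \<forall>n. C n (x, \<lambda>m. z (prod_encode (n, m)))"])
    have "closed {p :: 'a \<times> baire. C n (fst p, \<lambda>m. snd p (prod_encode (n, m)))}" for n
      using closed_vimage[OF C(1)[of n], of "\<lambda>p. (fst p, \<lambda>m. snd p (prod_encode (n, m)))"]
      by (simp add: vimage_def continuous_on_reindex)
    then show "closed {(x, z). \<forall>n. C n (x, \<lambda>m. z (prod_encode (n, m)))}"
      unfolding case_prod_unfold by (intro closed_Collect_all)
    show "x \<in> (\<Inter>n. A n) \<longleftrightarrow> (\<exists>z. \<forall>n. C n (x, \<lambda>m. z (prod_encode (n, m))))" for x
    proof
      assume "x \<in> (\<Inter>n. A n)"
      then have "\<forall>n. \<exists>z. C n (x, z)" using C(2) by blast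
      then obtain z where "\<And>n. C n (x, z n)" by metis
      then show "\<exists>z. \<forall>n. C n (x, \<lambda>m. z (prod_encode (n, m)))"
        by (intro exI[of _ "\<lambda>i. case prod_decode i of (n, m) \<Rightarrow> z n m"]) simp
    qed (use C(2) in blast)
  qed
qed

lemma analytic_Int: "analytic A \<Longrightarrow> analytic B \<Longrightarrow> analytic (A \<inter> B)"
proof -
  assume *: "analytic A" "analytic B"
  have "x \<in> A \<inter> B \<longleftrightarrow> (\<forall>n::nat. x \<in> (if n = 0 then A else B))" for x
    using zero_neq_one[where 'a = nat] by (metis IntD1 IntD2 IntI)
  then have "A \<inter> B = (\<Inter>n::nat. if n = 0 then A else B)" by blast
  moreover have "analytic (\<Inter>n::nat. if n = 0 then A else B)"
    by (rule analytic_INT) (use * in simp)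
  ultimately show ?thesis by simp
qed

lemma open_agree_prefix:
  fixes y :: "nat \<Rightarrow> nat"
  assumes "open U" "y \<in> U"
  shows "\<exists>n. \<forall>y'. (\<forall>i<n. y' i = y i) \<longrightarrow> y' \<in> U"
proof -
  obtain X where X: "y \<in> Pi\<^sub>E UNIV X" "finite {i. X i \<noteq> UNIV}" "Pi\<^sub>E UNIV X \<subseteq> U"
    using product_topology_open_contains_basis[of "\<lambda>_. euclidean" UNIV U y] assms
    by (auto simp: euclidean_product_topology[symmetric] open_fun_def)
  obtain n where n: "\<And>i. X i \<noteq> UNIV \<Longrightarrow> i < n"
    using X(2) finite_nat_set_iff_bounded by auto
  have "y' \<in> U" if "\<forall>i<n. y' i = y i" for y'
  proof -
    have "y' i \<in> X i" for i using X(1) n[of i] that by (cases "X i = UNIV") (auto simp: PiE_iff)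
    then show ?thesis using X(3) by (auto simp: PiE_iff)
  qed
  then show ?thesis by blast
qed

text \<open>A neighbourhood of a point contains a box of two cylinders. Cylinders are closed, and there are only
  countably many.\<close>

lemma open_F_sigma:
  fixes U :: "(baire \<times> baire) set"
  assumes "open U"
  shows "\<exists>C. (\<forall>n::nat. closed (C n)) \<and> U = (\<Union>n. C n)"
proof -
  define B where "B st = {p :: baire \<times> baire. 
    (\<forall>i. fst p i \<in> {c. i < length (fst st) \<longrightarrow> c = fst st ! i}) \<and>
    (\<forall>i. snd p i \<in> {c. i < length (snd st) \<longrightarrow> c = snd st ! i})}" for st :: "nat list \<times> nat list"
  have "continuous_on UNIV (\<lambda>p :: baire \<times> baire. fst p i)" for i
    by (intro continuous_on_product_then_coordinatewise[OF continuous_on_fst] continuous_on_id)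
  then have B: "closed (B st)" for st unfolding B_def
    by (intro closed_Collect_conj closed_Collect_all closed_discrete_vimage continuous_on_snd_coord)
  let ?C = "\<lambda>n::nat. if B (from_nat n) \<subseteq> U then B (from_nat n) else {}"
  have "p \<in> (\<Union>n. ?C n)" if "p \<in> U" for p
  proof -
    obtain V W where VW: "open V" "open W" "fst p \<in> V" "snd p \<in> W" "V \<times> W \<subseteq> U"
      using assms \<open>p \<in> U\<close> by (metis open_prod_elim mem_Times_iff)
    obtain m where m: "\<And>y'. (\<forall>i<m. y' i = fst p i) \<Longrightarrow> y' \<in> V" using open_agree_prefix[OF VW(1,3)] by blast
    obtain n where n: "\<And>y'. (\<forall>i<n. y' i = snd p i) \<Longrightarrow> y' \<in> W" using open_agree_prefix[OF VW(2,4)] by blast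
    let ?st = "(map (fst p) [0..<m], map (snd p) [0..<n])"
    have "B ?st \<subseteq> V \<times> W" using m n by (auto simp: B_def)
    then have "B ?st \<subseteq> U" "p \<in> B ?st" using VW(5) by (auto simp: B_def)
    then show ?thesis by (intro UN_I[of "to_nat ?st"]) auto
  qed
  then have "U = (\<Union>n. ?C n)" by (auto split: if_splits)
  moreover have "\<forall>n. closed (?C n)" using B by simp
  ultimately show ?thesis by (intro exI[of _ ?C]) blast
qed

text \<open>The sets that are analytic together with their complements form a sigma-algebra, and it contains the
  open sets because these are countable unions of closed sets.\<close>

lemma analytic_borel:
  fixes A :: "(baire \<times> baire) set"
  assumes "A \<in> sets borel"
  shows "analytic A"
proof -
  have "A \<in> sigma_sets UNIV {S. open S}" using assms by (simp add: borel_def)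
  then have "analytic A \<and> analytic (- A)"
  proof induction
    case (Basic U)
    then obtain C where "\<forall>n::nat. closed (C n)" "U = (\<Union>n. C n)" using open_F_sigma by blast
    moreover have "closed (- U)" using Basic by (simp add: closed_def)
    ultimately show ?case by (blast intro: analytic_UN analytic_closed)
  next
    case Empty
    then show ?case by (simp add: analytic_closed)
  next
    case (Compl B)
    then show ?case unfolding Compl_eq_Diff_UNIV[symmetric] double_complement by blast
  next
    case (Union B)
    then show ?case unfolding Compl_UN by (intro conjI analytic_UN analytic_INT) blast+
  qed
  then show ?thesis ..
qed

lemma analytic_fst_image:
  fixes A :: "('a::topological_space \<times> baire) set"
  assumes "analytic A"
  shows "analytic (fst ` A)"
proof -
  obtain C :: "('a \<times> baire) \<times> baire \<Rightarrow> bool"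
    where C: "closed {p. C p}" "\<And>x. x \<in> A \<longleftrightarrow> (\<exists>z. C (x, z))"
    using analyticD[OF assms] by metis
  let ?h = "\<lambda>p :: 'a \<times> baire. ((fst p, \<lambda>m. snd p (2 * m)), \<lambda>m. snd p (2 * m + 1))"
  show ?thesis
  proof (rule analyticI[where P = "\<lambda>x z. C (?h (x, z))"])
    show "closed {(x, z). C (?h (x, z))}"
      using closed_vimage[OF C(1), of ?h]
      by (simp add: vimage_def case_prod_unfold continuous_on_Pair continuous_on_reindex
          continuous_on_coordinatewise_then_product continuous_on_snd_coord)
    show "x \<in> fst ` A \<longleftrightarrow> (\<exists>z. C (?h (x, z)))" for x
    proof
      assume "x \<in> fst ` A"
      then obtain y z where "C ((x, y), z)" using C(2) by force
      then show "\<exists>z. C (?h (x, z))"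
        by (intro exI[of _ "\<lambda>i. if even i then y (i div 2) else z (i div 2)"]) simp
    qed (use C(2) in force)
  qed
qed

lemma analytic_cont_image:
  fixes A :: "baire set" and g :: "baire \<Rightarrow> nat \<Rightarrow> nat"
  assumes "analytic A" "continuous_on UNIV g"
  shows "analytic (g ` A)"
proof -
  obtain C :: "baire \<times> baire \<Rightarrow> bool"
    where C: "closed {p. C p}" "\<And>x. x \<in> A \<longleftrightarrow> (\<exists>z. C (x, z))"
    using analyticD[OF assms(1)] by metis
  have "analytic {(y, x). x \<in> A \<and> y = g x}"
  proof (rule analyticI[where P = "\<lambda>p z. C (snd p, z) \<and> fst p = g (snd p)"])
    have C': "closed {p :: (baire \<times> baire) \<times> baire. C (snd (fst p), snd p)}"
      using closed_vimage[OF C(1), of "\<lambda>p. (snd (fst p), snd p)"]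
      by (simp add: vimage_def continuous_on_Pair continuous_on_fst continuous_on_snd)
    have "closed {p :: (baire \<times> baire) \<times> baire. \<forall>i. fst (fst p) i = g (snd (fst p)) i}"
    proof (intro closed_Collect_all closed_Collect_eq)
      show "continuous_on UNIV (\<lambda>p :: (baire \<times> baire) \<times> baire. fst (fst p) i)" for i
        by (rule continuous_on_product_then_coordinatewise[OF continuous_on_fst[OF continuous_on_fst[OF continuous_on_id]]])
      show "continuous_on UNIV (\<lambda>p :: (baire \<times> baire) \<times> baire. g (snd (fst p)) i)" for i
        by (rule continuous_on_product_then_coordinatewise[OF continuous_on_compose2[OF assms(2)
              continuous_on_snd[OF continuous_on_fst[OF continuous_on_id]] subset_UNIV]])
    qed
    then have "closed {p :: (baire \<times> baire) \<times> baire. fst (fst p) = g (snd (fst p))}"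
      by (simp only: fun_eq_iff)
    with C' show "closed {(p, z). C (snd p, z) \<and> fst p = g (snd p)}"
      unfolding case_prod_unfold by (intro closed_Collect_conj)
  qed (use C(2) in auto)
  from analytic_fst_image[OF this] have "analytic (fst ` {(y, x). x \<in> A \<and> y = g x})" .
  moreover have "fst ` {(y, x). x \<in> A \<and> y = g x} = g ` A"
    by (simp add: image_iff set_eq_iff Bex_def)
  ultimately show ?thesis by simp
qed

lemma measurable_fun_nat:
  fixes f :: "'a \<Rightarrow> nat \<Rightarrow> nat"
  assumes "\<And>i c. {x \<in> space M. f x i = c} \<in> sets M"
  shows "f \<in> M \<rightarrow>\<^sub>M borel"
proof (rule measurable_coordinatewise_then_product)
  fix i
  show "(\<lambda>x. f x i) \<in> borel_measurable M"
  proof (rule borel_measurableI)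
    fix S :: "nat set"
    have "(\<lambda>x. f x i) -` S \<inter> space M = (\<Union>c\<in>S. {x \<in> space M. f x i = c})" by auto
    also have "\<dots> \<in> sets M" using assms by (intro sets.countable_UN'') auto
    finally show "(\<lambda>x. f x i) -` S \<inter> space M \<in> sets M" .
  qed
qed

lemma sets_fun_nat_eq:
  fixes f :: "'a \<Rightarrow> nat \<Rightarrow> nat"
  assumes "f \<in> M \<rightarrow>\<^sub>M borel"
  shows "{x \<in> space M. f x i = c} \<in> sets M"
proof -
  have "(\<lambda>x. f x i) \<in> M \<rightarrow>\<^sub>M borel" using assms by (rule measurable_product_then_coordinatewise)
  from measurable_sets[OF this, of "{c}"] show ?thesis
    by (simp add: vimage_def Int_def conj_commute)
qed

lemma sets_Collect_mem: "A \<in> sets M \<Longrightarrow> {x \<in> space M. x \<in> A} \<in> sets M"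
  using sets.sets_into_space[of A M] by (simp add: Collect_conj_eq Int_absorb1)

lemma sets_fun_nat_fun_eq:
  fixes f g :: "'a \<Rightarrow> nat \<Rightarrow> nat"
  assumes "f \<in> M \<rightarrow>\<^sub>M borel" "g \<in> M \<rightarrow>\<^sub>M borel"
  shows "{x \<in> space M. f x = g x} \<in> sets M"
proof -
  have "{x \<in> space M. f x = g x} = 
      {x \<in> space M. \<forall>i. \<exists>c. x \<in> {x \<in> space M. f x i = c} \<and> x \<in> {x \<in> space M. g x i = c}}"
    by auto
  also have "\<dots> \<in> sets M"
    by (intro sets.sets_Collect_countable_All sets.sets_Collect_countable_Ex sets.sets_Collect_conj
        sets_fun_nat_eq[OF assms(1), THEN sets_Collect_mem] sets_fun_nat_eq[OF assms(2), THEN sets_Collect_mem])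
  finally show ?thesis .
qed

lemma analytic_borel_image:
  fixes g :: "baire \<Rightarrow> nat \<Rightarrow> nat"
  assumes "S \<in> sets borel" "g \<in> borel \<rightarrow>\<^sub>M borel"
  shows "analytic (g ` S)"
proof -
  have fst: "fst \<in> (borel :: (baire \<times> baire) measure) \<rightarrow>\<^sub>M borel"
    and snd: "snd \<in> (borel :: (baire \<times> baire) measure) \<rightarrow>\<^sub>M borel"
    by (intro borel_measurable_continuous_onI continuous_on_fst continuous_on_snd continuous_on_id)+
  have "{p \<in> space (borel :: (baire \<times> baire) measure). g (snd p) = fst p} \<in> sets borel"
    by (rule sets_fun_nat_fun_eq[OF measurable_compose[OF snd assms(2)] fst])
  moreover have "snd -` S \<inter> space borel \<in> sets (borel :: (baire \<times> baire) measure)"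
    by (rule measurable_sets[OF snd assms(1)])
  ultimately have "{p \<in> space borel. g (snd p) = fst p} \<inter> (snd -` S \<inter> space borel) \<in> sets borel"
    by (rule sets.Int)
  then have "analytic ({p. g (snd p) = fst p} \<inter> snd -` S)"
    by (simp add: analytic_borel)
  from analytic_fst_image[OF this] have "analytic (fst ` ({p. g (snd p) = fst p} \<inter> snd -` S))" .
  moreover have "fst ` ({p. g (snd p) = fst p} \<inter> snd -` S) = g ` S"
    by (simp add: image_iff set_eq_iff Bex_def)
  ultimately show ?thesis by simp
qed

section \<open>Lusin separation and the Lusin--Souslin theorem\<close>

lemma closed_agree_prefix:
  fixes y z :: "nat \<Rightarrow> nat"
  assumes "closed {p. C p}"
    and "\<And>n. \<exists>y' z'. C (y', z') \<and> (\<forall>i<n. y' i = y i \<and> z' i = z i)"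
  shows "C (y, z)"
proof (rule ccontr)
  assume "\<not> C (y, z)"
  then have "open (- {p. C p})" "(y, z) \<in> - {p. C p}" using assms(1) by (simp_all add: closed_def)
  then obtain U V where UV: "open U" "open V" "y \<in> U" "z \<in> V" "U \<times> V \<subseteq> - {p. C p}"
    by (metis open_prod_elim mem_Times_iff fst_conv snd_conv)
  obtain m where m: "\<And>y'. (\<forall>i<m. y' i = y i) \<Longrightarrow> y' \<in> U" using open_agree_prefix[OF UV(1,3)] by blast
  obtain n where n: "\<And>z'. (\<forall>i<n. z' i = z i) \<Longrightarrow> z' \<in> V" using open_agree_prefix[OF UV(2,4)] by blast
  obtain y' z' where "C (y', z')" "\<forall>i<max m n. y' i = y i \<and> z' i = z i" using assms(2) by blast
  then have "(y', z') \<in> U \<times> V" "C (y', z')" using m n by auto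
  then show False using UV(5) by blast
qed

lemma sets_borel_coord_eq: "{y :: nat \<Rightarrow> nat. y i = c} \<in> sets borel"
  using sets_fun_nat_eq[of "\<lambda>y. y" borel i c] by simp

text \<open>If the two sets cannot be separated, then neither can some pair of pieces of them, cut out by fixing one
  more coordinate of the points and of the witnesses: countably many separations of pieces combine to
  one of the whole. In the limit this leads to a point of each set, by closedness. The two points
  differ in some coordinate, so that from some stage on the pieces are separated by a cylinder.\<close>

theorem Lusin_separation:
  fixes A B :: "baire set"
  assumes "analytic A" "analytic B" "A \<inter> B = {}"
  shows "\<exists>F \<in> sets borel. A \<subseteq> F \<and> F \<inter> B = {}"
proof (rule ccontr)
  assume *: "\<not> ?thesis"
  obtain C :: "baire \<times> baire \<Rightarrow> bool"
    where C: "closed {p. C p}" "\<And>x. x \<in> A \<longleftrightarrow> (\<exists>z. C (x, z))"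
    using analyticD[OF assms(1)] by metis
  obtain D :: "baire \<times> baire \<Rightarrow> bool"
    where D: "closed {p. D p}" "\<And>x. x \<in> B \<longleftrightarrow> (\<exists>z. D (x, z))"
    using analyticD[OF assms(2)] by metis
  define NA where "NA s = {y. \<exists>z. C (y, z) \<and> (\<forall>i<length s. (y i, z i) = fst (s ! i))}"
    for s :: "((nat \<times> nat) \<times> nat \<times> nat) list"
  define NB where "NB s = {y. \<exists>z. D (y, z) \<and> (\<forall>i<length s. (y i, z i) = snd (s ! i))}"
    for s :: "((nat \<times> nat) \<times> nat \<times> nat) list"
  define sep where "sep s \<longleftrightarrow> (\<exists>F \<in> sets borel. NA s \<subseteq> F \<and> F \<inter> NB s = {})" for s
  have "NA [] = A" "NB [] = B" using C(2) D(2) by (auto simp: NA_def NB_def)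
  then have "\<not> sep []" using * by (simp add: sep_def)
  moreover have "\<exists>k. \<not> sep (s @ [k])" if "\<not> sep s" for s
  proof (rule ccontr)
    assume "\<not> ?thesis"
    then have "\<forall>k. \<exists>F \<in> sets borel. NA (s @ [k]) \<subseteq> F \<and> F \<inter> NB (s @ [k]) = {}"
      by (simp add: sep_def)
    then obtain F where F: "\<And>k. F k \<in> sets borel" "\<And>k. NA (s @ [k]) \<subseteq> F k"
      "\<And>k. F k \<inter> NB (s @ [k]) = {}" by metis
    have NA: "\<exists>p. \<forall>q. y \<in> NA (s @ [(p, q)])" if y: "y \<in> NA s" for y
    proof -
      obtain z where "C (y, z)" "\<forall>i<length s. (y i, z i) = fst (s ! i)"
        using y unfolding NA_def by blast
      then show ?thesis
        by (intro exI[of _ "(y (length s), z (length s))"]) (auto simp: NA_def nth_append less_Suc_eq)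
    qed
    have NB: "\<exists>q. \<forall>p. y \<in> NB (s @ [(p, q)])" if y: "y \<in> NB s" for y
    proof -
      obtain z where "D (y, z)" "\<forall>i<length s. (y i, z i) = snd (s ! i)"
        using y unfolding NB_def by blast
      then show ?thesis
        by (intro exI[of _ "(y (length s), z (length s))"]) (auto simp: NB_def nth_append less_Suc_eq)
    qed
    \<comment> \<open>the pair \<open>p\<close> selects the piece of \<open>A\<close> and \<open>q\<close> that of \<open>B\<close>\<close>
    let ?F = "\<Union>p. \<Inter>q. F (p, q)"
    have "?F \<in> sets borel" using F(1) by (intro sets.countable_UN' sets.countable_INT') auto
    moreover have "NA s \<subseteq> ?F"
    proof
      fix y assume "y \<in> NA s"
      from NA[OF this] obtain p where "\<And>q. y \<in> NA (s @ [(p, q)])" by blast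
      then have "\<And>q. y \<in> F (p, q)" using F(2) by (rule subsetD[rotated])
      then show "y \<in> ?F" by blast
    qed
    moreover have "y \<notin> ?F" if y: "y \<in> NB s" for y
    proof
      assume "y \<in> ?F"
      then obtain p where p: "\<And>q. y \<in> F (p, q)" by blast
      obtain q where "y \<in> NB (s @ [(p, q)])" using NB[OF y] by blast
      then show False using p[of q] F(3)[of "(p, q)"] by blast
    qed
    then have "?F \<inter> NB s = {}" by blast
    ultimately have "sep s" unfolding sep_def by blast
    then show False using that by blast
  qed
  ultimately obtain x where x: "\<And>n. \<not> sep (map x [0..<n])"
    using tree_branch[of "\<lambda>s. \<not> sep s"] by blast
  define y where "y i = fst (fst (x i))" for i
  define z where "z i = snd (fst (x i))" for i
  define y' where "y' i = fst (snd (x i))" for i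
  define z' where "z' i = snd (snd (x i))" for i
  have NA: "NA (map x [0..<n]) = {u. \<exists>w. C (u, w) \<and> (\<forall>i<n. u i = y i \<and> w i = z i)}" for n
    by (auto simp: NA_def y_def z_def prod_eq_iff)
  have NB: "NB (map x [0..<n]) = {u. \<exists>w. D (u, w) \<and> (\<forall>i<n. u i = y' i \<and> w i = z' i)}" for n
    by (auto simp: NB_def y'_def z'_def prod_eq_iff)
  have "NA (map x [0..<n]) \<noteq> {}" for n
    using x[of n] unfolding sep_def by (metis Int_empty_left empty_subsetI sets.empty_sets)
  then have "\<exists>u w. C (u, w) \<and> (\<forall>i<n. u i = y i \<and> w i = z i)" for n
    unfolding NA by blast
  then have "C (y, z)" by (rule closed_agree_prefix[OF C(1)])
  have "NB (map x [0..<n]) \<noteq> {}" for n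
    using x[of n] unfolding sep_def by (metis Int_empty_right top_greatest sets.top space_borel)
  then have "\<exists>u w. D (u, w) \<and> (\<forall>i<n. u i = y' i \<and> w i = z' i)" for n
    unfolding NB by blast
  then have "D (y', z')" by (rule closed_agree_prefix[OF D(1)])
  have "y \<in> A" "y' \<in> B" using C(2) D(2) \<open>C (y, z)\<close> \<open>D (y', z')\<close> by blast+
  then obtain i where i: "y i \<noteq> y' i" using assms(3) by (metis disjoint_iff ext)
  have "sep (map x [0..<Suc i])"
    unfolding sep_def NA NB by (rule bexI[OF _ sets_borel_coord_eq[of i "y i"]]) (use i in auto)
  then show False using x by blast
qed

text \<open>For each coordinate \<open>i\<close>, injectivity makes the images of the level sets \<open>{x. e x i = c}\<close> disjoint
  analytic sets, which Lusin separation encloses in disjoint Borel sets. Thus \<open>e x\<close> can be read off from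
  \<open>q x\<close> in a Borel way.\<close>

lemma separating_family:
  fixes e q :: "'a \<Rightarrow> nat \<Rightarrow> nat"
  assumes "\<And>i c. analytic (q ` {x \<in> E. e x i = c})"
    and inj: "\<And>x x'. x \<in> E \<Longrightarrow> x' \<in> E \<Longrightarrow> q x = q x' \<Longrightarrow> e x = e x'"
  obtains G where "\<And>i c. G i c \<in> sets borel" "\<And>i c d. c \<noteq> d \<Longrightarrow> G i c \<inter> G i d = {}"
    "\<And>x i. x \<in> E \<Longrightarrow> q x \<in> G i (e x i)"
proof -
  have "\<exists>F. F \<in> sets borel \<and> (c \<noteq> d \<longrightarrow>
      (\<forall>x \<in> E. (e x i = c \<longrightarrow> q x \<in> F) \<and> (e x i = d \<longrightarrow> q x \<notin> F)))" for i c d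
  proof (cases "c = d")
    case False
    have "q ` {x \<in> E. e x i = c} \<inter> q ` {x \<in> E. e x i = d} = {}"
    proof (rule ccontr)
      assume "\<not> ?thesis"
      then obtain x x' where "x \<in> E" "x' \<in> E" "q x = q x'" "e x i = c" "e x' i = d" by auto
      then show False using inj[of x x'] False by simp
    qed
    from Lusin_separation[OF assms(1) assms(1) this] show ?thesis by blast
  qed (use sets.empty_sets in blast)
  then have ex: "\<forall>i c d. \<exists>F. F \<in> sets borel \<and> (c \<noteq> d \<longrightarrow>
      (\<forall>x \<in> E. (e x i = c \<longrightarrow> q x \<in> F) \<and> (e x i = d \<longrightarrow> q x \<notin> F)))" by blast
  obtain F where F: "\<And>i c d. F i c d \<in> sets borel"
    "\<And>i c d x. c \<noteq> d \<Longrightarrow> x \<in> E \<Longrightarrow> e x i = c \<Longrightarrow> q x \<in> F i c d"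
    "\<And>i c d x. c \<noteq> d \<Longrightarrow> x \<in> E \<Longrightarrow> e x i = d \<Longrightarrow> q x \<notin> F i c d"
    using ex[unfolded choice_iff] by blast
  define G where "G i c = (\<Inter>d. if d = c then UNIV else F i c d - F i d c)" for i c
  show thesis
  proof
    have "(if d = c then UNIV else F i c d - F i d c) \<in> sets borel" for i c d
      using F(1)[of i c d] F(1)[of i d c] by simp
    then show "G i c \<in> sets borel" for i c
      unfolding G_def by (intro sets.countable_INT' image_subsetI) simp_all
    show "G i c \<inter> G i d = {}" if "c \<noteq> d" for i c d
    proof -
      have "x \<in> F i c d - F i d c" if "x \<in> G i c" for x
        using INT_D[OF that[unfolded G_def], of d] \<open>c \<noteq> d\<close> by simp
      moreover have "x \<in> F i d c - F i c d" if "x \<in> G i d" for x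
        using INT_D[OF that[unfolded G_def], of c] \<open>c \<noteq> d\<close> by simp
      ultimately show ?thesis by blast
    qed
    show "q x \<in> G i (e x i)" if "x \<in> E" for x i
    proof -
      note \<open>x \<in> E\<close>
      have "q x \<in> F i (e x i) d - F i d (e x i)" if "d \<noteq> e x i" for d
        using F(2)[of "e x i" d x i] F(3)[of d "e x i" x i] that \<open>x \<in> E\<close> by simp
      then show ?thesis unfolding G_def by simp
    qed
  qed
qed

text \<open>The separating family gives a Borel map \<open>r\<close> with \<open>r (q x) = x\<close> on \<open>S\<close>; then \<open>q ` S\<close> is the set of all
  \<open>y\<close> with \<open>r y \<in> S\<close> and \<open>q (r y) = y\<close>.\<close>

theorem Lusin_Souslin:
  fixes q :: "baire \<Rightarrow> nat \<Rightarrow> nat"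
  assumes S: "S \<in> sets borel" and q: "q \<in> borel \<rightarrow>\<^sub>M borel" and inj: "inj_on q S"
  shows "q ` S \<in> sets borel"
proof -
  have "analytic (q ` {x \<in> S. x i = c})" for i c
    using analytic_borel_image[OF sets.Int[OF S sets_borel_coord_eq[of i c]] q] by (simp add: Int_def)
  then obtain G where G: "\<And>i c. G i c \<in> sets borel" "\<And>i c d. c \<noteq> d \<Longrightarrow> G i c \<inter> G i d = {}"
    "\<And>x i. x \<in> S \<Longrightarrow> q x \<in> G i (x i)"
    by (rule separating_family[of q S "\<lambda>x. x", OF _ inj_onD[OF inj]]) blast+
  define r where "r y i = (LEAST c. y \<in> G i c)" for y i
  have r: "r \<in> borel \<rightarrow>\<^sub>M borel"
  proof (rule measurable_fun_nat)
    fix i c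
    have "(\<lambda>y. LEAST c. y \<in> G i c) \<in> borel \<rightarrow>\<^sub>M count_space UNIV"
      by (rule measurable_Least) (use G(1) in \<open>simp add: pred_sets1\<close>)
    from measurable_sets[OF this, of "{c}"] show "{y \<in> space borel. r y i = c} \<in> sets borel"
      by (simp add: r_def vimage_def)
  qed
  have rq: "r (q x) = x" if "x \<in> S" for x
  proof
    fix i
    show "r (q x) i = x i"
      unfolding r_def using G(2) G(3)[OF that] by (intro Least_equality) (metis disjoint_iff linear)+
  qed
  have "q ` S = {y. r y \<in> S} \<inter> {y. q (r y) = y}"
    using rq by force
  also have "\<dots> \<in> sets borel"
  proof (rule sets.Int)
    show "{y. r y \<in> S} \<in> sets borel" using measurable_sets[OF r S] by (simp add: vimage_def)
    show "{y. q (r y) = y} \<in> sets borel"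
      using sets_fun_nat_fun_eq[OF measurable_compose[OF r q] measurable_ident_sets[OF refl]] by simp
  qed
  finally show ?thesis .
qed

section \<open>The Lusin--Novikov theorem\<close>

text \<open>The Lusin--Novikov theorem says that a Borel set on which \<open>q\<close> has countable fibres is thin. Thin sets
  form a sigma-ideal of Borel sets.\<close>

definition thin :: "(baire \<Rightarrow> nat \<Rightarrow> nat) \<Rightarrow> baire set \<Rightarrow> bool" where
  "thin q B \<longleftrightarrow> (\<exists>U. (\<forall>n::nat. U n \<in> sets borel \<and> inj_on q (U n)) \<and> B = (\<Union>n. U n))"

lemma thin_sets: "thin q B \<Longrightarrow> B \<in> sets borel"
  unfolding thin_def by (auto intro!: sets.countable_UN')

lemma thin_inj: "B \<in> sets borel \<Longrightarrow> inj_on q B \<Longrightarrow> thin q B"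
  unfolding thin_def by (intro exI[of _ "\<lambda>_. B"]) simp

lemma thin_UN: 
  assumes "\<And>n::nat. thin q (B n)"
  shows "thin q (\<Union>n. B n)"
proof -
  have "\<forall>n. \<exists>U. (\<forall>m::nat. U m \<in> sets borel \<and> inj_on q (U m)) \<and> B n = (\<Union>m. U m)"
    using assms unfolding thin_def by blast
  from choice[OF this]
  obtain U where U: "\<forall>n. (\<forall>m::nat. U n m \<in> sets borel \<and> inj_on q (U n m)) \<and> B n = (\<Union>m. U n m)"
    by blast
  have "(\<Union>n. B n) = (\<Union>k. case_prod U (prod_decode k))"
    using U by (auto simp: set_eq_iff) (metis prod_encode_inverse case_prod_conv)
  then show ?thesis
    unfolding thin_def using U by (intro exI[of _ "\<lambda>k. case_prod U (prod_decode k)"]) (simp add: case_prod_unfold)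
qed

lemma thin_countable_UN:
  assumes "countable I" "\<And>i. i \<in> I \<Longrightarrow> thin q (B i)"
  shows "thin q (\<Union>i\<in>I. B i)"
proof (cases "I = {}")
  case False
  then have "(\<Union>i\<in>I. B i) = (\<Union>n. B (from_nat_into I n))"
    using range_from_nat_into[OF False assms(1)] by (metis image_image)
  then show ?thesis
    using thin_UN[of q "\<lambda>n. B (from_nat_into I n)"] assms(2) from_nat_into[OF False] by simp
qed (simp add: thin_inj)

lemma thin_Un: "thin q A \<Longrightarrow> thin q B \<Longrightarrow> thin q (A \<union> B)"
  using thin_countable_UN[of "{A, B}" q "\<lambda>A. A"] by auto

lemma thin_subset:
  assumes "thin q B" "A \<in> sets borel" "A \<subseteq> B"
  shows "thin q A"
proof -
  obtain U where U: "\<forall>n::nat. U n \<in> sets borel \<and> inj_on q (U n)" "B = (\<Union>n. U n)"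
    using assms(1) by (auto simp: thin_def)
  have "A = (\<Union>n. U n \<inter> A)" using U(2) assms(3) by blast
  then show ?thesis
    unfolding thin_def using U(1) assms(2) by (intro exI[of _ "\<lambda>n. U n \<inter> A"]) (auto intro: inj_on_subset)
qed

lemma uncountable_nat_bool: "uncountable (UNIV :: (nat \<Rightarrow> bool) set)"
proof
  assume "countable (UNIV :: (nat \<Rightarrow> bool) set)"
  then obtain f :: "(nat \<Rightarrow> bool) \<Rightarrow> nat" where f: "inj f" by (auto simp: countable_def)
  define d where "d n \<longleftrightarrow> \<not> inv f n n" for n
  have "d (f d) \<longleftrightarrow> \<not> d (f d)" by (subst d_def) (simp add: f)
  then show False by blast
qed

lemma interleave_measurable:
  fixes q :: "baire \<Rightarrow> nat \<Rightarrow> nat"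
  assumes q: "q \<in> borel \<rightarrow>\<^sub>M borel"
  shows "(\<lambda>x i. if even i then x (i div 2) else q x (i div 2)) \<in> borel \<rightarrow>\<^sub>M borel"
proof (rule measurable_fun_nat)
  fix i c
  show "{x \<in> space borel. (if even i then x (i div 2) else q x (i div 2)) = c} \<in> sets borel"
    using sets_borel_coord_eq[of "i div 2" c] sets_fun_nat_eq[OF q, of "i div 2" c]
    by (cases "even i") simp_all
qed

text \<open>\<open>E\<close> interleaves a point with its image under \<open>q\<close>, so that \<open>q\<close> becomes a continuous function of the
  code \<open>E x\<close>, and \<open>C\<close> is a closed set that projects to the codes of the points of \<open>S\<close>. A finite
  sequence of pairs prescribes the first coordinates of a code and of a witness for it.\<close>

locale fibre_scheme =
  fixes S :: "baire set" and q :: "baire \<Rightarrow> nat \<Rightarrow> nat"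
    and C :: "baire \<times> baire \<Rightarrow> bool"
    and E :: "baire \<Rightarrow> nat \<Rightarrow> nat"
  assumes S: "S \<in> sets borel" and q: "q \<in> borel \<rightarrow>\<^sub>M borel"
    and E_def: "E = (\<lambda>x i. if even i then x (i div 2) else q x (i div 2))"
    and closed_C: "closed {p. C p}"
    and C: "\<And>y. y \<in> E ` S \<longleftrightarrow> (\<exists>z. C (y, z))"
begin

definition node :: "(nat \<times> nat) list \<Rightarrow> baire set" where
  "node s = {x \<in> S. \<exists>z. C (E x, z) \<and> (\<forall>i<length s. (E x i, z i) = s ! i)}"

text \<open>However large the thin set that is removed, some fibre of \<open>q\<close> still meets all the nodes in \<open>W\<close>. If \<open>S\<close> is not thin, then \<open>{[]}\<close> is large; a large finite set of nodes can be split again and again, and this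
  grows a perfect set inside a single fibre.\<close>

definition large :: "(nat \<times> nat) list set \<Rightarrow> bool" where
  "large W \<longleftrightarrow> (\<forall>B. thin q B \<longrightarrow> (\<Inter>s\<in>W. q ` (node s - B)) \<noteq> {})"

lemma E_even: "E x (2 * i) = x i" and E_odd: "E x (2 * i + 1) = q x i"
  by (simp_all add: E_def)

lemma inj_E: "inj E"
proof (rule injI)
  fix x y assume "E x = E y"
  then show "x = y" using E_even by (metis ext)
qed

lemma node_Nil: "node [] = S"
  using C by (auto simp: node_def)

lemma analytic_node: 
  assumes "V \<in> sets borel"
  shows "analytic (q ` (node s \<inter> V))"
proof -
  have cyl: "closed {p :: baire \<times> baire. fst p i = c}"
    "closed {p :: baire \<times> baire. snd p i = c}" for i c
  proof -
    have "continuous_on UNIV (\<lambda>p :: baire \<times> baire. fst p i)"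
      by (intro continuous_on_product_then_coordinatewise[OF continuous_on_fst] continuous_on_id)
    from closed_discrete_vimage[OF this, of "{c}"] 
    show "closed {p :: baire \<times> baire. fst p i = c}" by simp
    from closed_discrete_vimage[OF continuous_on_snd_coord, of i "{c}"] 
    show "closed {p :: baire \<times> baire. snd p i = c}" by simp
  qed
  have "E ` node s = {y. \<exists>z. C (y, z) \<and> (\<forall>i<length s. (y i, z i) = s ! i)}" (is "_ = ?R")
  proof
    show "?R \<subseteq> E ` node s"
    proof
      fix y assume "y \<in> ?R"
      then obtain z where z: "C (y, z)" "\<forall>i<length s. (y i, z i) = s ! i" by blast
      then obtain x where "x \<in> S" "y = E x" using C by blast
      then show "y \<in> E ` node s" using z by (auto simp: node_def)
    qed
  qed (auto simp: node_def)
  moreover have "analytic ?R"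
  proof (rule analyticI[where P = "\<lambda>y z. C (y, z) \<and> (\<forall>i\<in>{..<length s}. y i = fst (s ! i) \<and> z i = snd (s ! i))"])
    have "closed (\<Inter>i\<in>{..<length s}. {p. fst p i = fst (s ! i)} \<inter> {p. snd p i = snd (s ! i)})"
      by (intro closed_INT ballI closed_Int cyl)
    from closed_Int[OF closed_C this]
    show "closed {(y, z). C (y, z) \<and> (\<forall>i\<in>{..<length s}. y i = fst (s ! i) \<and> z i = snd (s ! i))}"
      by (rule back_subst[of closed]) auto
  qed (auto simp: prod_eq_iff)
  ultimately have "analytic (E ` node s \<inter> E ` V)"
    using analytic_Int analytic_borel_image[OF assms interleave_measurable[OF q, folded E_def]] by simp
  moreover have "continuous_on UNIV (\<lambda>y :: nat \<Rightarrow> nat. \<lambda>i. y (2 * i + 1))"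
    by (intro continuous_on_coordinatewise_then_product continuous_on_product_coordinates)
  ultimately have "analytic ((\<lambda>y. \<lambda>i. y (2 * i + 1)) ` (E ` node s \<inter> E ` V))"
    by (rule analytic_cont_image)
  moreover have "(\<lambda>y. \<lambda>i. y (2 * i + 1)) ` (E ` node s \<inter> E ` V) = q ` (node s \<inter> V)"
    unfolding image_Int[OF inj_E, symmetric] image_image E_odd ..
  ultimately show ?thesis by simp
qed

lemma mem_node: "x \<in> S \<Longrightarrow> C (E x, z) \<Longrightarrow> x \<in> node (map (\<lambda>i. (E x i, z i)) [0..<n])"
  by (auto simp: node_def)

lemma node_coord: "x \<in> node (map (\<lambda>i. (a i, b i)) [0..<n]) \<Longrightarrow> i < n \<Longrightarrow> E x i = a i"
  by (auto simp: node_def)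

text \<open>If no splitting of \<open>s\<close> into two disjoint nodes is large, then one thin set \<open>BB\<close> witnesses this for all
  the countably many splittings. Outside \<open>BB\<close>, the points of \<open>node s\<close> whose value under \<open>q\<close> is also taken in
  all nodes of \<open>W\<close> form a set \<open>D\<close> on which \<open>q\<close> is injective, since two such points with the same value
  would be separated by a large splitting. The set \<open>D\<close> is only analytic, but by separation it is contained
  in a Borel set \<open>D'\<close> on which \<open>q\<close> is still injective. So \<open>BB \<union> D'\<close> is thin and contradicts largeness.\<close>

lemma split_one:
  assumes "large (insert s W)" "finite W"
  shows "\<exists>v w. length s < length v \<and> length s < length w \<and> take (length s) v = s \<and> take (length s) w = s
    \<and> node v \<inter> node w = {} \<and> large ({v, w} \<union> W)"
proof (rule ccontr)
  assume *: "\<not> ?thesis"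
  define I where "I = {(v, w). length s < length v \<and> length s < length w
    \<and> take (length s) v = s \<and> take (length s) w = s \<and> node v \<inter> node w = {}}"
  have "\<forall>i\<in>I. \<exists>B. thin q B \<and> (\<Inter>r\<in>{fst i, snd i} \<union> W. q ` (node r - B)) = {}"
    using * unfolding I_def large_def by auto
  then obtain B where B: "\<And>i. i \<in> I \<Longrightarrow> thin q (B i)"
    "\<And>i. i \<in> I \<Longrightarrow> (\<Inter>r\<in>{fst i, snd i} \<union> W. q ` (node r - B i)) = {}" by metis
  define BB where "BB = (\<Union>i\<in>I. B i)"
  have thin_BB: "thin q BB" unfolding BB_def by (rule thin_countable_UN) (use B(1) in auto)
  define D where "D = {x \<in> node s - BB. \<forall>r\<in>W. q x \<in> q ` (node r - BB)}"
  have inj: "x = x'" if "x \<in> D" "x' \<in> D" "q x = q x'" for x x'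
  proof (rule ccontr)
    assume "x \<noteq> x'"
    then obtain i where i: "E x i \<noteq> E x' i" using inj_E by (metis injD ext)
    obtain z where z: "C (E x, z)" "\<forall>i<length s. (E x i, z i) = s ! i" "x \<in> S"
      using \<open>x \<in> D\<close> unfolding D_def node_def by blast
    obtain z' where z': "C (E x', z')" "\<forall>i<length s. (E x' i, z' i) = s ! i" "x' \<in> S"
      using \<open>x' \<in> D\<close> unfolding D_def node_def by blast
    define n where "n = Suc (max (length s) i)"
    have n: "length s < n" "i < n" by (simp_all add: n_def)
    let ?v = "map (\<lambda>i. (E x i, z i)) [0..<n]" and ?w = "map (\<lambda>i. (E x' i, z' i)) [0..<n]"
    have x: "x \<in> node ?v" "x' \<in> node ?w" using mem_node z z' by blast+
    have "E u i = E x i" if "u \<in> node ?v" for u using node_coord[OF that n(2)] .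
    moreover have "E u i = E x' i" if "u \<in> node ?w" for u using node_coord[OF that n(2)] .
    ultimately have "\<not> (u \<in> node ?v \<and> u \<in> node ?w)" for u using i by fastforce
    then have "node ?v \<inter> node ?w = {}" by blast
    moreover have "take (length s) ?v = s" "take (length s) ?w = s"
      using z(2) z'(2) n(1) by (auto intro!: nth_equalityI)
    ultimately have "(?v, ?w) \<in> I" using n(1) by (simp add: I_def)
    then have "BB \<supseteq> B (?v, ?w)" "(\<Inter>r\<in>{?v, ?w} \<union> W. q ` (node r - B (?v, ?w))) = {}"
      using B(2)[of "(?v, ?w)"] unfolding BB_def by auto
    moreover have "q x \<in> q ` (node r - BB)" if "r \<in> {?v, ?w} \<union> W" for r
    proof -
      have D: "x \<notin> BB" "x' \<notin> BB" "\<forall>r\<in>W. q x \<in> q ` (node r - BB)"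
        using \<open>x \<in> D\<close> \<open>x' \<in> D\<close> unfolding D_def by blast+
      then have "q x \<in> q ` (node ?v - BB)" "q x' \<in> q ` (node ?w - BB)"
        using x by blast+
      then show ?thesis using that D(3) \<open>q x = q x'\<close> by auto
    qed
    ultimately show False by (blast)
  qed
  have "analytic (q ` {x \<in> D. x i = c})" for i c
  proof -
    let ?V = "{x. x i = c}"
    have V: "?V \<inter> - BB \<in> sets borel" "- BB \<in> sets borel"
      using thin_sets[OF thin_BB] sets_borel_coord_eq[of i c] by auto
    have "analytic (q ` (node s \<inter> (?V \<inter> - BB)) \<inter> (\<Inter>r\<in>W. q ` (node r \<inter> - BB)))"
    proof (cases "W = {}")
      case True
      then show ?thesis using analytic_node[OF V(1)] by simp
    next
      case False
      have "analytic (\<Inter>n. q ` (node (from_nat_into W n) \<inter> - BB))"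
        by (rule analytic_INT) (rule analytic_node[OF V(2)])
      moreover have "(\<Inter>n. q ` (node (from_nat_into W n) \<inter> - BB)) = (\<Inter>r\<in>W. q ` (node r \<inter> - BB))"
        by (subst (2) range_from_nat_into[OF False countable_finite[OF assms(2)], symmetric])
          (simp only: image_image)
      ultimately show ?thesis using analytic_Int[OF analytic_node[OF V(1)]] by simp
    qed
    moreover have "q ` {x \<in> D. x i = c} = q ` (node s \<inter> (?V \<inter> - BB)) \<inter> (\<Inter>r\<in>W. q ` (node r \<inter> - BB))"
      (is "?L = ?R")
    proof
      show "?L \<subseteq> ?R" unfolding D_def by auto
      show "?R \<subseteq> ?L"
      proof
        fix y assume y: "y \<in> ?R"
        then obtain x where "x \<in> node s" "x i = c" "x \<notin> BB" "y = q x" by blast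
        moreover from this y have "x \<in> D" unfolding D_def by (simp add: Diff_eq)
        ultimately show "y \<in> ?L" by blast
      qed
    qed
    ultimately show ?thesis by simp
  qed
  then obtain G where G: "\<And>i c. G i c \<in> sets borel" "\<And>i c d. c \<noteq> d \<Longrightarrow> G i c \<inter> G i d = {}"
    "\<And>x i. x \<in> D \<Longrightarrow> q x \<in> G i (x i)"
    by (rule separating_family[of q D "\<lambda>x. x", OF _ inj]) blast+
  define D' where "D' = (\<Inter>i. \<Union>c. {x. x i = c} \<inter> q -` G i c)"
  have "q -` G i c \<in> sets borel" for i c using measurable_sets[OF q G(1)] by simp
  then have "D' \<in> sets borel" unfolding D'_def
    by (intro sets.countable_INT' sets.countable_UN' image_subsetI sets.Int sets_borel_coord_eq) simp_all
  moreover have "inj_on q D'"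
  proof (intro inj_onI ext)
    fix x x' i assume "x \<in> D'" "x' \<in> D'" "q x = q x'"
    then have "q x \<in> G i (x i) \<inter> G i (x' i)" unfolding D'_def by auto
    then show "x i = x' i" using G(2) by blast
  qed
  ultimately have "thin q (BB \<union> D')" using thin_BB thin_inj thin_Un by blast
  then have "(\<Inter>r\<in>insert s W. q ` (node r - (BB \<union> D'))) \<noteq> {}"
    using assms(1) unfolding large_def by blast
  then obtain y where y: "\<And>r. r \<in> insert s W \<Longrightarrow> y \<in> q ` (node r - (BB \<union> D'))" by blast
  then obtain x where x: "x \<in> node s" "x \<notin> BB" "x \<notin> D'" "y = q x" by blast
  have "x \<in> D" using x y unfolding D_def by blast
  then have "x \<in> D'" using G(3) unfolding D'_def by blast
  then show False using x by blast
qed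

lemma split_all:
  assumes "finite V" "finite W" "large (V \<union> W)"
  shows "\<exists>f. large ((\<Union>s\<in>V. {f s False, f s True}) \<union> W) \<and> (\<forall>s\<in>V. node (f s False) \<inter> node (f s True) = {} \<and>
    (\<forall>b. length s < length (f s b) \<and> take (length s) (f s b) = s))"
  using assms
proof (induction V arbitrary: W)
  case (insert s V)
  have "large (insert s (V \<union> W))" using insert.prems by simp
  from split_one[OF this] obtain v w where vw: "length s < length v" "length s < length w" 
    "take (length s) v = s" "take (length s) w = s" "node v \<inter> node w = {}" "large ({v, w} \<union> (V \<union> W))"
    using insert by auto
  then have "large (V \<union> ({v, w} \<union> W))" by (simp add: Un_left_commute)
  from insert.IH[OF _ this] insert.prems obtain f where f:
    "large ((\<Union>s\<in>V. {f s False, f s True}) \<union> ({v, w} \<union> W))"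
    "\<forall>s\<in>V. node (f s False) \<inter> node (f s True) = {} \<and>
    (\<forall>b. length s < length (f s b) \<and> take (length s) (f s b) = s)" by auto
  let ?f = "f(s := \<lambda>b. if b then w else v)"
  have "(\<Union>s\<in>V. {?f s False, ?f s True}) = (\<Union>s\<in>V. {f s False, f s True})"
    using insert.hyps by (intro SUP_cong) auto
  then have "(\<Union>s\<in>insert s V. {?f s False, ?f s True}) \<union> W = (\<Union>s\<in>V. {f s False, f s True}) \<union> ({v, w} \<union> W)"
    by auto
  then show ?case using f vw insert.hyps by (intro exI[of _ ?f]) auto
qed auto

text \<open>Repeated splitting yields a Cantor scheme of nodes \<open>br \<beta> n\<close>. By closedness of \<open>C\<close> every branch \<open>\<beta>\<close>
  converges to the code of a point \<open>x \<beta>\<close>, and different branches give different points. All nodes of one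
  level contain points with the same value under \<open>q\<close>, and longer nodes determine more coordinates of this
  value; hence all points \<open>x \<beta>\<close> lie in one fibre.\<close>

lemma large_imp_uncountable_fibre:
  assumes "large {[]}"
  shows "\<exists>y. uncountable {x \<in> S. q x = y}"
proof -
  define P where "P W \<longleftrightarrow> finite W \<and> large W" for W
  define R where "R W f \<longleftrightarrow> large (\<Union>s\<in>W. {f s False, f s True}) \<and> (\<forall>s\<in>W. node (f s False) \<inter> node (f s True) = {} \<and>
    (\<forall>b. length s < length (f s b) \<and> take (length s) (f s b) = s))" for W f
  define F where "F W = (SOME f. R W f)" for W
  have F: "R W (F W)" if "P W" for W
  proof -
    have "\<exists>f. R W f" using split_all[of W "{}"] that unfolding P_def R_def by simp
    then show ?thesis unfolding F_def by (rule someI_ex)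
  qed
  define L where "L = rec_nat {[]} (\<lambda>_ W. \<Union>s\<in>W. {F W s False, F W s True})"
  have L0: "L 0 = {[]}" and LS: "L (Suc n) = (\<Union>s\<in>L n. {F (L n) s False, F (L n) s True})" for n
    by (simp_all add: L_def)
  have PL: "P (L n)" for n
  proof (induction n)
    case (Suc n)
    then show ?case using F[OF Suc] unfolding LS by (simp add: P_def R_def)
  qed (use assms in \<open>simp add: L0 P_def\<close>)
  \<comment> \<open>the node of level \<open>n\<close> along the branch \<open>\<beta>\<close>\<close>
  define br where "br \<beta> = rec_nat [] (\<lambda>n s. F (L n) s (\<beta> n))" for \<beta> :: "nat \<Rightarrow> bool"
  have br0: "br \<beta> 0 = []" and brS: "br \<beta> (Suc n) = F (L n) (br \<beta> n) (\<beta> n)" for \<beta> n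
    by (simp_all add: br_def)
  have br_L: "br \<beta> n \<in> L n" for \<beta> n
  proof (induction n)
    case (Suc n)
    then show ?case unfolding brS LS by (intro UN_I[of "br \<beta> n"]) (cases "\<beta> n"; simp)+
  qed (simp add: br0 L0)
  have step: "length (br \<beta> n) < length (br \<beta> (Suc n))" "take (length (br \<beta> n)) (br \<beta> (Suc n)) = br \<beta> n" for \<beta> n
    using F[OF PL[of n]] br_L[of \<beta> n] unfolding R_def brS by auto
  have len: "n \<le> length (br \<beta> n)" for \<beta> n
    by (induction n) (use step(1) in \<open>auto simp: Suc_le_eq intro: le_less_trans\<close>)
  have pre: "m \<le> n \<Longrightarrow> take (length (br \<beta> m)) (br \<beta> n) = br \<beta> m" for \<beta> m n
  proof (induction n rule: dec_induct)
    case (step n)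
    have "length (br \<beta> m) \<le> length (br \<beta> n)"
      using arg_cong[OF step.IH, of length] by simp
    then have "take (length (br \<beta> m)) (br \<beta> (Suc n)) = take (length (br \<beta> m)) (take (length (br \<beta> n)) (br \<beta> (Suc n)))"
      by simp
    then show ?case using step.IH \<open>\<And>n \<beta>. take (length (br \<beta> n)) (br \<beta> (Suc n)) = br \<beta> n\<close> by simp
  qed simp
  \<comment> \<open>the common extension of the nodes along \<open>\<beta>\<close>\<close>
  define w where "w \<beta> i = br \<beta> (Suc i) ! i" for \<beta> i
  have w: "br \<beta> n ! i = w \<beta> i" if "i < length (br \<beta> n)" for \<beta> n i
  proof -
    have "br \<beta> n ! i = br \<beta> (max n (Suc i)) ! i"
      using pre[of n "max n (Suc i)" \<beta>] that by (metis max.cobounded1 nth_take)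
    moreover have "br \<beta> (Suc i) ! i = br \<beta> (max n (Suc i)) ! i"
      using pre[of "Suc i" "max n (Suc i)" \<beta>] len[of "Suc i" \<beta>] by (metis max.cobounded2 nth_take Suc_le_lessD)
    ultimately show ?thesis by (simp add: w_def)
  qed
  have "large (L n)" for n using PL by (simp add: P_def)
  then have "(\<Inter>s\<in>L n. q ` (node s - {})) \<noteq> {}" for n
    unfolding large_def using thin_inj[of "{}" q] by blast
  then have common: "\<exists>y. \<forall>s\<in>L n. y \<in> q ` node s" for n
    unfolding Diff_empty by (simp only: ex_in_conv[symmetric] INT_iff)
  have ne: "\<exists>x. x \<in> node (br \<beta> n)" for \<beta> n using common[of n] br_L[of \<beta> n] by blast
  have "C (\<lambda>i. fst (w \<beta> i), \<lambda>i. snd (w \<beta> i))" for \<beta>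
  proof (rule closed_agree_prefix[OF closed_C])
    fix n
    obtain x z where "C (E x, z)" "\<forall>i<length (br \<beta> n). (E x i, z i) = br \<beta> n ! i"
      using ne[of \<beta> n] unfolding node_def by blast
    then have "C (E x, z) \<and> (\<forall>i<n. E x i = fst (w \<beta> i) \<and> z i = snd (w \<beta> i))"
      using w[of _ \<beta> n] len[of n \<beta>] by (metis fst_conv snd_conv less_le_trans)
    then show "\<exists>y' z'. C (y', z') \<and> (\<forall>i<n. y' i = fst (w \<beta> i) \<and> z' i = snd (w \<beta> i))" by blast
  qed
  then have "\<exists>x. x \<in> S \<and> E x = (\<lambda>i. fst (w \<beta> i)) \<and> C (E x, \<lambda>i. snd (w \<beta> i))" for \<beta>
    using C by (metis imageE)
  then obtain x where x: "\<And>\<beta>. x \<beta> \<in> S" "\<And>\<beta>. E (x \<beta>) = (\<lambda>i. fst (w \<beta> i))" 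
    "\<And>\<beta>. C (E (x \<beta>), \<lambda>i. snd (w \<beta> i))" by metis
  have x_node: "x \<beta> \<in> node (br \<beta> n)" for \<beta> n
  proof -
    have "\<forall>i<length (br \<beta> n). (E (x \<beta>) i, snd (w \<beta> i)) = br \<beta> n ! i"
      using w[of _ \<beta> n] x(2)[of \<beta>] by simp
    then show ?thesis unfolding node_def using x(1,3)[of \<beta>] by blast
  qed
  have "q (x \<beta>) = q (x \<gamma>)" for \<beta> \<gamma>
  proof
    fix m
    obtain y where y: "y \<in> q ` node (br \<beta> (2 * m + 2))" "y \<in> q ` node (br \<gamma> (2 * m + 2))"
      using common[of "2 * m + 2"] br_L by blast
    have "q (x \<delta>) m = y m" if y\<delta>: "y \<in> q ` node (br \<delta> (2 * m + 2))" for \<delta>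
    proof -
      obtain u z where u: "y = q u" "\<forall>i<length (br \<delta> (2 * m + 2)). (E u i, z i) = br \<delta> (2 * m + 2) ! i"
        using y\<delta> unfolding node_def by blast
      have l: "2 * m + 1 < length (br \<delta> (2 * m + 2))" using len[of "2 * m + 2" \<delta>] by simp
      have "y m = E u (2 * m + 1)" using u(1) by (simp add: E_def)
      also have "\<dots> = fst (w \<delta> (2 * m + 1))" using u(2) l w[OF l] by (metis fst_conv)
      also have "\<dots> = q (x \<delta>) m" using x(2)[of \<delta>] E_odd by metis
      finally show ?thesis by simp
    qed
    then show "q (x \<beta>) m = q (x \<gamma>) m" using y by simp
  qed
  moreover have "inj x"
  proof (rule injI, rule ccontr)
    fix \<beta> \<gamma> assume eq: "x \<beta> = x \<gamma>" and "\<beta> \<noteq> \<gamma>"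
    then have ex: "\<exists>n. \<beta> n \<noteq> \<gamma> n" by blast
    define n where "n = (LEAST n. \<beta> n \<noteq> \<gamma> n)"
    have n: "\<beta> n \<noteq> \<gamma> n" "\<And>m. m < n \<Longrightarrow> \<beta> m = \<gamma> m"
      using LeastI_ex[OF ex] not_less_Least unfolding n_def by blast+
    have "m \<le> n \<Longrightarrow> br \<beta> m = br \<gamma> m" for m
      by (induction m) (use n(2) in \<open>auto simp: br0 brS\<close>)
    then have "br \<beta> n = br \<gamma> n" by simp
    then have "node (br \<beta> (Suc n)) \<inter> node (br \<gamma> (Suc n)) = {}"
      using F[OF PL[of n]] br_L[of \<beta> n] n(1) unfolding R_def brS 
      by (cases "\<beta> n"; cases "\<gamma> n") auto
    then show False using x_node[of \<beta> "Suc n"] x_node[of \<gamma> "Suc n"] eq by auto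
  qed
  ultimately have sub: "range x \<subseteq> {u \<in> S. q u = q (x (\<lambda>_. True))}" using x(1) by auto
  have "uncountable (range x)" using \<open>inj x\<close> uncountable_nat_bool countable_image_inj_on by blast
  then show ?thesis using countable_subset[OF sub] by blast
qed

end

theorem Lusin_Novikov:
  fixes q :: "baire \<Rightarrow> nat \<Rightarrow> nat"
  assumes S: "S \<in> sets borel" and q: "q \<in> borel \<rightarrow>\<^sub>M borel"
    and fibres: "\<And>y. countable {x \<in> S. q x = y}"
  shows "\<exists>U. (\<forall>n::nat. U n \<in> sets borel \<and> inj_on q (U n)) \<and> S = (\<Union>n. U n)"
proof -
  define E where "E = (\<lambda>x i. if even i then x (i div 2) else q x (i div 2))"
  from analyticD[OF analytic_borel_image[OF S interleave_measurable[OF q, folded E_def]]]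
  obtain C :: "baire \<times> baire \<Rightarrow> bool"
    where C: "closed {p. C p}" "\<And>y. y \<in> E ` S \<longleftrightarrow> (\<exists>z. C (y, z))" by metis
  interpret fibre_scheme S q C E
    by unfold_locales (use S q C E_def in auto)
  have "\<not> large {[]}" using large_imp_uncountable_fibre fibres by blast
  then obtain B where B: "thin q B" "q ` (node [] - B) = {}" unfolding large_def by auto
  then have "S \<subseteq> B" by (auto simp: node_Nil)
  then show ?thesis using thin_subset[OF B(1) S] by (simp add: thin_def)
qed

section \<open>Standard Borel spaces as Borel subsets of Baire space\<close>

lemma (in Metric_space) mcomplete_limit:
  assumes "mcomplete" "range u \<subseteq> M" "\<And>\<epsilon>. 0 < \<epsilon> \<Longrightarrow> \<exists>N. \<forall>n m. N \<le> n \<longrightarrow> N \<le> m \<longrightarrow> d (u n) (u m) < \<epsilon>"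
  shows "\<exists>l\<in>M. (\<lambda>n. d (u n) l) \<longlonglongrightarrow> 0"
proof -
  have "MCauchy u" using assms(2,3) by (simp add: MCauchy_def)
  then obtain l where "limitin mtopology u l sequentially" using assms(1) by (auto simp: mcomplete_def)
  then have "l \<in> M" and l: "\<And>\<epsilon>. 0 < \<epsilon> \<Longrightarrow> \<forall>\<^sub>F n in sequentially. u n \<in> M \<and> d (u n) l < \<epsilon>"
    by (auto simp: limitin_metric)
  have "(\<lambda>n. d (u n) l) \<longlonglongrightarrow> 0"
    by (rule tendstoI, rule eventually_mono[OF l]) auto
  then show ?thesis using \<open>l \<in> M\<close> by blast
qed

lemma (in Metric_space) limit_dist:
  assumes "range u \<subseteq> M" "l \<in> M" "a \<in> M" "(\<lambda>n. d (u n) l) \<longlonglongrightarrow> 0"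
  shows "(\<lambda>n. d a (u n)) \<longlonglongrightarrow> d a l"
proof -
  have "\<bar>d a (u n) - d a l\<bar> \<le> d (u n) l" for n
    using mdist_reverse_triangle[of "u n" a l] assms(1-3) by (auto simp: commute)
  then have "(\<lambda>n. d a (u n) - d a l) \<longlonglongrightarrow> 0"
    by (intro Lim_null_comparison[OF _ assms(4)]) simp
  then show ?thesis by (simp add: LIM_zero_iff)
qed

lemma (in Metric_space) limit_unique:
  assumes "range u \<subseteq> M" "l \<in> M" "l' \<in> M" "(\<lambda>n. d (u n) l) \<longlonglongrightarrow> 0" "(\<lambda>n. d (u n) l') \<longlonglongrightarrow> 0"
  shows "l = l'"
proof -
  have "(\<lambda>n. d l' (u n)) \<longlonglongrightarrow> d l' l" by (rule limit_dist) fact+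
  moreover have "(\<lambda>n. d l' (u n)) = (\<lambda>n. d (u n) l')" by (simp add: commute)
  ultimately have "d l' l = 0" using assms(5) LIMSEQ_unique by auto
  then show ?thesis using assms by simp
qed

text \<open>Fix a dense sequence \<open>a\<close>, and code a point \<open>x\<close> by the sequence of the least indices \<open>e x n\<close> such that
  \<open>a (e x n)\<close> is at distance less than \<open>2\<^sup>-\<^sup>n\<close> from \<open>x\<close>. Decoding is taking limits, so the distances of \<open>h z\<close>
  to the points \<open>a m\<close> are Borel functions of \<open>z\<close>. Therefore the set \<open>S\<close> of the codes is Borel: it consists of the
  \<open>z\<close> that converge and satisfy the defining condition with respect to their own limit.\<close>

lemma standard_borel_code:
  assumes "standard_borel X"
  shows "\<exists>S e h. S \<in> sets borel \<and> e \<in> X \<rightarrow>\<^sub>M borel \<and> (\<forall>x\<in>space X. e x \<in> S \<and> h (e x) = x) \<and>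
    (\<forall>z\<in>S. h z \<in> space X \<and> e (h z) = (z :: nat \<Rightarrow> nat)) \<and> (\<forall>A\<in>sets X. {z\<in>S. h z \<in> A} \<in> sets borel)"
proof (cases "space X = {}")
  case True
  then show ?thesis
    by (intro exI[of _ "{}"] exI[of _ "\<lambda>_ _. 0"] exI[of _ "\<lambda>_. undefined"]) auto
next
  case ne: False
  obtain \<tau> where \<tau>: "topspace \<tau> = space X" "completely_metrizable_space \<tau>" "second_countable \<tau>"
    "sets X = sigma_sets (space X) {U. openin \<tau> U}"
    using assms by (auto simp: standard_borel_def)
  obtain M d where Md: "Metric_space M d" "Metric_space.mcomplete M d" "\<tau> = Metric_space.mtopology M d"
    using \<tau>(2) by (auto simp: completely_metrizable_space_def)
  interpret Metric_space M d by (rule Md(1))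
  note \<tau>_eq = Md(3)
  have M: "space X = M" using \<tau>(1) by (simp add: \<tau>_eq)
  obtain Q where Q: "countable Q" "Q \<subseteq> M" "mtopology closure_of Q = M"
    using second_countable_imp_separable_space[OF \<tau>(3)] by (auto simp: separable_space_def \<tau>_eq)
  have "Q \<noteq> {}" using Q(3) ne M by auto
  define a where "a = from_nat_into Q"
  have a: "a n \<in> M" for n using from_nat_into[OF \<open>Q \<noteq> {}\<close>] Q(2) by (auto simp: a_def)
  have dense: "\<exists>n. d (a n) x < r" if x: "x \<in> M" "0 < r" for x r
  proof -
    have "x \<in> mtopology closure_of Q" using Q(3) x by simp
    then obtain y where "y \<in> Q" "y \<in> mball x r" using x unfolding metric_closure_of by blast
    then show ?thesis using from_nat_into_surj[OF Q(1)] by (metis a_def commute in_mball)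
  qed
  have pred: "{x \<in> space X. d (a m) x < r} \<in> sets X" for m r
  proof -
    have "{x \<in> space X. d (a m) x < r} = mball (a m) r" using a by (auto simp: M)
    then show ?thesis unfolding \<tau>(4) by (auto simp: \<tau>_eq)
  qed
  define e where "e x n = (LEAST m. d (a m) x < (1/2) ^ n)" for x n
  have e: "d (a (e x n)) x < (1/2) ^ n" if "x \<in> M" for x n
    unfolding e_def by (rule LeastI_ex) (use dense that in simp)
  have e_meas: "e \<in> X \<rightarrow>\<^sub>M borel"
  proof (rule measurable_fun_nat)
    fix i c
    have "(\<lambda>x. LEAST m. d (a m) x < (1/2) ^ i) \<in> X \<rightarrow>\<^sub>M count_space UNIV"
      by (rule measurable_Least) (use pred in \<open>simp add: Measurable.pred_def\<close>)
    from measurable_sets[OF this, of "{c}"]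
    have "(\<lambda>x. LEAST m. d (a m) x < (1/2) ^ i) -` {c} \<inter> space X \<in> sets X" by simp
    also have "(\<lambda>x. LEAST m. d (a m) x < (1/2) ^ i) -` {c} \<inter> space X = {x \<in> space X. e x i = c}"
      unfolding e_def by blast
    finally show "{x \<in> space X. e x i = c} \<in> sets X" .
  qed
  \<comment> \<open>contains all codes, by the triangle inequality\<close>
  define F where "F = {z :: nat \<Rightarrow> nat. \<forall>n. \<forall>m. n \<le> m \<longrightarrow> d (a (z n)) (a (z m)) < 2 * (1/2) ^ n}"
  have F_sets: "F \<in> sets borel"
  proof -
    have "{z :: nat \<Rightarrow> nat. d (a (z n)) (a (z m)) < r} \<in> sets borel" for n m r
    proof -
      have "{z :: nat \<Rightarrow> nat. d (a (z n)) (a (z m)) < r} =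
        (\<Union>p \<in> {p. d (a (fst p)) (a (snd p)) < r}. {z. z n = fst p} \<inter> {z. z m = snd p})" by auto
      also have "\<dots> \<in> sets borel"
        by (intro sets.countable_UN' image_subsetI sets.Int sets_borel_coord_eq) simp_all
      finally show ?thesis .
    qed
    then have "(\<Inter>n. \<Inter>m. if n \<le> m then {z :: nat \<Rightarrow> nat. d (a (z n)) (a (z m)) < 2 * (1/2) ^ n} else UNIV) \<in> sets borel"
      by (intro sets.countable_INT' image_subsetI) simp_all
    also have "(\<Inter>n. \<Inter>m. if n \<le> m then {z :: nat \<Rightarrow> nat. d (a (z n)) (a (z m)) < 2 * (1/2) ^ n} else UNIV) = F"
      unfolding F_def by (auto split: if_splits)
    finally show ?thesis .
  qed
  define h where "h z = (SOME l. l \<in> M \<and> (\<lambda>n. d (a (z n)) l) \<longlonglongrightarrow> 0)" for z :: "nat \<Rightarrow> nat"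
  have h: "h z \<in> M" "(\<lambda>n. d (a (z n)) (h z)) \<longlonglongrightarrow> 0" if "z \<in> F" for z
  proof -
    have "\<exists>l\<in>M. (\<lambda>n. d (a (z n)) l) \<longlonglongrightarrow> 0"
    proof (rule mcomplete_limit[OF Md(2)])
      fix \<epsilon> :: real assume "0 < \<epsilon>"
      then obtain N where N: "(1/2) ^ N < \<epsilon> / 2" using real_arch_pow_inv[of "\<epsilon> / 2" "1/2"] by auto
      have "d (a (z n)) (a (z m)) < \<epsilon>" if "N \<le> n" "N \<le> m" for n m
      proof -
        have "2 * (1/2) ^ k < \<epsilon>" if "N \<le> k" for k :: nat
          using power_decreasing[OF that, of "1/2 :: real"] N by linarith
        moreover have "n \<le> m \<or> m \<le> n" by linarith
        ultimately show ?thesis using \<open>z \<in> F\<close> that commute unfolding F_def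
          by (smt (verit) mem_Collect_eq)
      qed
      then show "\<exists>N. \<forall>n m. N \<le> n \<longrightarrow> N \<le> m \<longrightarrow> d (a (z n)) (a (z m)) < \<epsilon>" by blast
    qed (use a in auto)
    then have "\<exists>l. l \<in> M \<and> (\<lambda>n. d (a (z n)) l) \<longlonglongrightarrow> 0" by blast
    from someI_ex[OF this] show "h z \<in> M" "(\<lambda>n. d (a (z n)) (h z)) \<longlonglongrightarrow> 0" by (simp_all add: h_def)
  qed
  have h_sets: "{z \<in> F. d (a m) (h z) < r} \<in> sets borel" for m r
  proof -
    let ?B = "restrict_space borel F"
    have "(\<lambda>z. d (a m) (h z)) \<in> borel_measurable ?B"
    proof (rule borel_measurable_LIMSEQ_real)
      fix z assume "z \<in> space ?B"
      then have "z \<in> F" by (simp add: space_restrict_space)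
      show "(\<lambda>i. d (a m) (a (z i))) \<longlonglongrightarrow> d (a m) (h z)"
        by (rule limit_dist) (use a h[OF \<open>z \<in> F\<close>] in auto)
    next
      fix i
      have "(\<lambda>z :: nat \<Rightarrow> nat. d (a m) (a (z i))) \<in> borel \<rightarrow>\<^sub>M borel"
      proof (rule borel_measurableI)
        fix T :: "real set"
        have "(\<lambda>z. d (a m) (a (z i))) -` T \<inter> space borel = (\<Union>c \<in> {c. d (a m) (a c) \<in> T}. {z. z i = c})" by auto
        also have "\<dots> \<in> sets borel"
          by (intro sets.countable_UN' image_subsetI sets_borel_coord_eq) simp_all
        finally show "(\<lambda>z. d (a m) (a (z i))) -` T \<inter> space borel \<in> sets borel" .
      qed
      then show "(\<lambda>z :: nat \<Rightarrow> nat. d (a m) (a (z i))) \<in> borel_measurable ?B"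
        by (rule measurable_restrict_space1)
    qed
    from measurable_sets[OF this, of "{..<r}"]
    have "{z \<in> F. d (a m) (h z) < r} \<in> sets ?B"
      by (simp add: space_restrict_space vimage_def Int_def conj_commute)
    then show ?thesis using F_sets by (simp add: sets_restrict_space_iff)
  qed
  define S where "S = {z \<in> F. \<forall>n. d (a (z n)) (h z) < (1/2) ^ n \<and> (\<forall>m<z n. \<not> d (a m) (h z) < (1/2) ^ n)}"
  have S_sets: "S \<in> sets borel"
  proof -
    have "S = (\<Inter>n. \<Union>c. {z. z n = c} \<inter> ({z \<in> F. d (a c) (h z) < (1/2) ^ n} -
        (\<Union>m\<in>{..<c}. {z \<in> F. d (a m) (h z) < (1/2) ^ n})))"
      unfolding S_def by auto
    also have "\<dots> \<in> sets borel"
      by (intro sets.countable_INT' sets.countable_UN' image_subsetI sets.Int sets.Diff sets_borel_coord_eq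
          h_sets) simp_all
    finally show ?thesis .
  qed
  have e_S: "e x \<in> S \<and> h (e x) = x" if x: "x \<in> M" for x
  proof -
    have "d (a (e x n)) (a (e x m)) < 2 * (1/2) ^ n" if "n \<le> m" for n m
    proof -
      have "d (a (e x n)) (a (e x m)) \<le> d (a (e x n)) x + d (a (e x m)) x"
        using triangle[of "a (e x n)" x "a (e x m)"] a x commute by metis
      also have "\<dots> < (1/2) ^ n + (1/2) ^ m" using e[OF x] by (intro add_strict_mono)
      also have "(1/2 :: real) ^ m \<le> (1/2) ^ n" using that by (intro power_decreasing) auto
      finally show ?thesis by simp
    qed
    then have F: "e x \<in> F" by (simp add: F_def)
    have "(\<lambda>n. d (a (e x n)) x) \<longlonglongrightarrow> 0"
    proof (rule Lim_null_comparison)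
      show "\<forall>\<^sub>F n in sequentially. norm (d (a (e x n)) x) \<le> (1/2) ^ n"
        using less_imp_le[OF e[OF x]] by (intro always_eventually) simp
      show "(\<lambda>n. (1/2 :: real) ^ n) \<longlonglongrightarrow> 0" by (rule LIMSEQ_power_zero) simp
    qed
    then have hx: "h (e x) = x"
      using limit_unique[of "\<lambda>n. a (e x n)" "h (e x)" x] a h[OF F] x by auto
    moreover have "\<forall>m<e x n. \<not> d (a m) x < (1/2) ^ n" for n
      unfolding e_def using not_less_Least by blast
    ultimately show ?thesis using F e[OF x] by (simp add: S_def)
  qed
  have h_S: "h z \<in> M \<and> e (h z) = z" if "z \<in> S" for z
  proof
    show "h z \<in> M" using h that by (simp add: S_def)
    show "e (h z) = z"
    proof
      fix n
      show "e (h z) n = z n"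
        unfolding e_def using that by (intro Least_equality) (auto simp: S_def not_less[symmetric])
    qed
  qed
  have "{z \<in> S. h z \<in> A} \<in> sets borel" if "A \<in> sets X" for A
  proof -
    have "A \<in> sigma_sets (space X) {U. openin \<tau> U}" using that \<tau>(4) by simp
    then show ?thesis
    proof induction
      case (Basic U)
      define I where "I = {(m, k :: nat). mball (a m) (1 / (Suc k)) \<subseteq> U}"
      have "{z \<in> S. h z \<in> U} = (\<Union>(m, k)\<in>I. {z \<in> F. d (a m) (h z) < 1 / (Suc k)} \<inter> S)"
      proof (intro equalityI subsetI)
        fix z assume z: "z \<in> {z \<in> S. h z \<in> U}"
        then obtain r where r: "0 < r" "mball (h z) r \<subseteq> U" "h z \<in> M"
          using Basic unfolding \<tau>_eq mem_Collect_eq openin_mtopology by blast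
        obtain k where k: "1 / (Suc k) < r / 2" using nat_approx_posE[of "r / 2"] r(1) by auto
        obtain m where m: "d (a m) (h z) < 1 / (Suc k)" using dense[OF r(3), of "1 / (Suc k)"] by auto
        have "mball (a m) (1 / (Suc k)) \<subseteq> mball (h z) r"
        proof
          fix y assume "y \<in> mball (a m) (1 / (Suc k))"
          then have y: "y \<in> M" "d (a m) y < 1 / (Suc k)" by auto
          have "d (h z) y \<le> d (a m) (h z) + d (a m) y"
            using triangle[of "h z" "a m" y] a r(3) y(1) commute by metis
          then show "y \<in> mball (h z) r" using y r(3) m k by auto
        qed
        then have "(m, k) \<in> I" using r(2) by (auto simp: I_def)
        then show "z \<in> (\<Union>(m, k)\<in>I. {z \<in> F. d (a m) (h z) < 1 / (Suc k)} \<inter> S)"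
          using z m by (auto simp: S_def)
      next
        fix z assume "z \<in> (\<Union>(m, k)\<in>I. {z \<in> F. d (a m) (h z) < 1 / (Suc k)} \<inter> S)"
        then obtain m k where "mball (a m) (1 / (Suc k)) \<subseteq> U" "d (a m) (h z) < 1 / (Suc k)" "z \<in> S"
          by (auto simp: I_def)
        moreover have "h z \<in> mball (a m) (1 / (Suc k))" using calculation h_S a by auto
        ultimately show "z \<in> {z \<in> S. h z \<in> U}" by auto
      qed
      also have "\<dots> \<in> sets borel" unfolding case_prod_unfold
        by (intro sets.countable_UN' image_subsetI sets.Int h_sets S_sets) simp_all
      finally show ?case .
    next
      case Empty
      then show ?case by simp
    next
      case (Compl A)
      have "{z \<in> S. h z \<in> space X - A} = S - {z \<in> S. h z \<in> A}" using h_S M by auto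
      then show ?case using Compl.IH S_sets by simp
    next
      case (Union A)
      have "{z \<in> S. h z \<in> (\<Union>i. A i)} = (\<Union>i. {z \<in> S. h z \<in> A i})" by auto
      then show ?case using Union.IH by (auto intro!: sets.countable_UN')
    qed
  qed
  then show ?thesis using S_sets e_meas e_S h_S M
    by (intro exI[of _ S] exI[of _ e] exI[of _ h]) simp
qed

text \<open>Together with the space, a Borel map to Baire space is transported to a Borel map \<open>q'\<close> that is defined
  on all of Baire space.\<close>

lemma standard_borel_Baire_code:
  fixes q :: "'x \<Rightarrow> nat \<Rightarrow> nat"
  assumes "standard_borel X" and q: "q \<in> X \<rightarrow>\<^sub>M borel"
  obtains S e h q' where "S \<in> sets borel" "e \<in> X \<rightarrow>\<^sub>M borel" "\<And>x. x \<in> space X \<Longrightarrow> e x \<in> S \<and> h (e x) = x"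
    "\<And>z. z \<in> S \<Longrightarrow> h z \<in> space X \<and> e (h z) = (z :: nat \<Rightarrow> nat)" "\<And>A. A \<in> sets X \<Longrightarrow> {z\<in>S. h z \<in> A} \<in> sets borel"
    "q' \<in> borel \<rightarrow>\<^sub>M borel" "\<And>z. z \<in> S \<Longrightarrow> q' z = q (h z)"
proof -
  obtain S e h where S: "S \<in> sets borel" "e \<in> X \<rightarrow>\<^sub>M borel" "\<And>x. x \<in> space X \<Longrightarrow> e x \<in> S \<and> h (e x) = x"
    "\<And>z. z \<in> S \<Longrightarrow> h z \<in> space X \<and> e (h z) = (z :: nat \<Rightarrow> nat)" "\<And>A. A \<in> sets X \<Longrightarrow> {z\<in>S. h z \<in> A} \<in> sets borel"
    using standard_borel_code[OF assms(1)] by blast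
  define q' where "q' z = (if z \<in> S then q (h z) else (\<lambda>_. 0))" for z
  have "q' \<in> borel \<rightarrow>\<^sub>M borel"
  proof (rule measurable_fun_nat)
    fix i c
    have "{z \<in> space borel. q' z i = c} = {z \<in> S. h z \<in> {x \<in> space X. q x i = c}} \<union> ((- S) \<inter> {z. 0 = c})"
      using S(4) by (auto simp: q'_def)
    moreover have "{z :: nat \<Rightarrow> nat. 0 = c} \<in> sets borel" by (cases "0 = c") simp_all
    ultimately show "{z \<in> space borel. q' z i = c} \<in> sets borel"
      using S(1) S(5)[OF sets_fun_nat_eq[OF q, of i c]] by simp
  qed
  then show thesis using S by (intro that[of S e h q']) (simp_all add: q'_def)
qed

lemma standard_borel_inj_image:
  fixes q :: "'x \<Rightarrow> nat \<Rightarrow> nat"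
  assumes "standard_borel X" and q: "q \<in> X \<rightarrow>\<^sub>M borel" and U: "U \<in> sets X" and inj: "inj_on q U"
  shows "q ` U \<in> sets borel"
proof -
  obtain S e h q' where *: "S \<in> sets borel" "e \<in> X \<rightarrow>\<^sub>M borel" "\<And>x. x \<in> space X \<Longrightarrow> e x \<in> S \<and> h (e x) = x"
    "\<And>z. z \<in> S \<Longrightarrow> h z \<in> space X \<and> e (h z) = (z :: nat \<Rightarrow> nat)" "\<And>A. A \<in> sets X \<Longrightarrow> {z\<in>S. h z \<in> A} \<in> sets borel"
    "q' \<in> borel \<rightarrow>\<^sub>M borel" "\<And>z. z \<in> S \<Longrightarrow> q' z = q (h z)"
    by (rule standard_borel_Baire_code[OF assms(1,2)]) (rule that; assumption)
  let ?V = "{z\<in>S. h z \<in> U}"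
  have "inj_on q' ?V"
  proof (rule inj_onI)
    fix z z' assume "z \<in> ?V" "z' \<in> ?V" "q' z = q' z'"
    then have "h z = h z'" using inj *(7) by (auto dest: inj_onD)
    then show "z = z'" using *(4) \<open>z \<in> ?V\<close> \<open>z' \<in> ?V\<close> by (metis mem_Collect_eq)
  qed
  then have "q' ` ?V \<in> sets borel" using Lusin_Souslin[OF *(5)[OF U] *(6)] by blast
  moreover have "q' ` ?V = q ` U"
  proof
    show "q ` U \<subseteq> q' ` ?V"
    proof
      fix y assume "y \<in> q ` U"
      then obtain x where x: "x \<in> U" "y = q x" by blast
      then have "x \<in> space X" using sets.sets_into_space[OF U] by blast
      from *(3)[OF this] show "y \<in> q' ` ?V" using *(7)[of "e x"] x by (intro image_eqI[of _ _ "e x"]) auto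
    qed
  qed (use *(7) in auto)
  ultimately show ?thesis by simp
qed

lemma standard_borel_countable_fibres:
  fixes q :: "'x \<Rightarrow> nat \<Rightarrow> nat"
  assumes "standard_borel X" and q: "q \<in> X \<rightarrow>\<^sub>M borel"
    and fibres: "\<And>y. countable {x \<in> space X. q x = y}"
  shows "\<exists>U. (\<forall>n::nat. U n \<in> sets X \<and> inj_on q (U n)) \<and> space X = (\<Union>n. U n)"
proof -
  obtain S e h q' where *: "S \<in> sets borel" "e \<in> X \<rightarrow>\<^sub>M borel" "\<And>x. x \<in> space X \<Longrightarrow> e x \<in> S \<and> h (e x) = x"
    "\<And>z. z \<in> S \<Longrightarrow> h z \<in> space X \<and> e (h z) = (z :: nat \<Rightarrow> nat)" "\<And>A. A \<in> sets X \<Longrightarrow> {z\<in>S. h z \<in> A} \<in> sets borel"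
    "q' \<in> borel \<rightarrow>\<^sub>M borel" "\<And>z. z \<in> S \<Longrightarrow> q' z = q (h z)"
    by (rule standard_borel_Baire_code[OF assms(1,2)]) (rule that; assumption)
  have "{z \<in> S. q' z = y} \<subseteq> e ` {x \<in> space X. q x = y}" for y
  proof
    fix z assume "z \<in> {z \<in> S. q' z = y}"
    then show "z \<in> e ` {x \<in> space X. q x = y}" using *(4)[of z] *(7)[of z] by (intro image_eqI[of _ _ "h z"]) auto
  qed
  then have "countable {z \<in> S. q' z = y}" for y
    by (rule countable_subset) (rule countable_image[OF fibres])
  from Lusin_Novikov[OF *(1,6) this]
  obtain U where U': "(\<forall>n::nat. U n \<in> sets borel \<and> inj_on q' (U n)) \<and> S = (\<Union>n. U n)" by (rule exE)
  then have U: "\<And>n. U n \<in> sets borel" "\<And>n. inj_on q' (U n)" "S = (\<Union>n. U n)" by simp_all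
  have "e -` U n \<inter> space X \<in> sets X" for n using measurable_sets[OF *(2) U(1)] .
  moreover have "inj_on q (e -` U n \<inter> space X)" for n
  proof (rule inj_onI)
    fix x x' assume x: "x \<in> e -` U n \<inter> space X" "x' \<in> e -` U n \<inter> space X" "q x = q x'"
    then have "q' (e x) = q' (e x')" using *(3)[of x] *(3)[of x'] *(7)[of "e x"] *(7)[of "e x'"] by auto
    then have "e x = e x'" using x U(2)[of n] by (auto dest: inj_onD)
    then show "x = x'" using x *(3) by (metis IntD2)
  qed
  moreover have "space X = (\<Union>n. e -` U n \<inter> space X)" using *(3) U(3) by blast
  ultimately show ?thesis by (intro exI[of _ "\<lambda>n. e -` U n \<inter> space X"]) blast
qed

text \<open>Reduces maps into a countably separated space to maps into Baire space: the code of a point records to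
  which sets of the separating family it belongs.\<close>

lemma countably_separated_code:
  assumes "countable G" "G \<subseteq> sets Y"
    and sep: "\<And>y y'. y \<in> space Y \<Longrightarrow> y' \<in> space Y \<Longrightarrow> (\<And>A. A \<in> G \<Longrightarrow> y \<in> A \<longleftrightarrow> y' \<in> A) \<Longrightarrow> y = y'"
  obtains c :: "'y \<Rightarrow> nat \<Rightarrow> nat" where "c \<in> Y \<rightarrow>\<^sub>M borel" "inj_on c (space Y)"
proof -
  let ?A = "from_nat_into (insert {} G)"
  define c where "c y n = (if y \<in> ?A n then 1 else 0 :: nat)" for y n
  have A: "?A n \<in> sets Y" for n using from_nat_into[of "insert {} G" n] assms(2) by auto
  have range: "range ?A = insert {} G" using assms(1) by (intro range_from_nat_into) auto
  have "c \<in> Y \<rightarrow>\<^sub>M borel"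
  proof (rule measurable_fun_nat)
    fix i k
    have "{y \<in> space Y. c y i = k} = (?A i \<inter> {y \<in> space Y. k = 1}) \<union> ((space Y - ?A i) \<inter> {y \<in> space Y. k = 0})"
      using sets.sets_into_space[OF A[of i]] by (auto simp: c_def)
    then show "{y \<in> space Y. c y i = k} \<in> sets Y" using A[of i] by simp
  qed
  moreover have "inj_on c (space Y)"
  proof (rule inj_onI)
    fix y y' assume y: "y \<in> space Y" "y' \<in> space Y" "c y = c y'"
    show "y = y'"
    proof (rule sep[OF y(1,2)])
      fix B assume "B \<in> G"
      then obtain n where "B = ?A n" using range by blast
      then show "y \<in> B \<longleftrightarrow> y' \<in> B" using fun_cong[OF y(3), of n] by (simp add: c_def split: if_splits)
    qed
  qed
  ultimately show thesis by (rule that)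
qed

lemma countable_to_one_cover:
  assumes X: "standard_borel X" and p: "p \<in> X \<rightarrow>\<^sub>M Y"
    and G: "countable G" "G \<subseteq> sets Y"
      "\<And>y y'. y \<in> space Y \<Longrightarrow> y' \<in> space Y \<Longrightarrow> (\<And>A. A \<in> G \<Longrightarrow> y \<in> A \<longleftrightarrow> y' \<in> A) \<Longrightarrow> y = y'"
    and fibres: "\<And>y. y \<in> space Y \<Longrightarrow> countable {x \<in> space X. p x = y}"
  shows "\<exists>U. (\<forall>n::nat. U n \<in> sets X \<and> inj_on p (U n)) \<and> space X = (\<Union>n. U n)"
proof -
  obtain c :: "'b \<Rightarrow> nat \<Rightarrow> nat" where c: "c \<in> Y \<rightarrow>\<^sub>M borel" "inj_on c (space Y)"
    using countably_separated_code[OF G] by blast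
  have pY: "p x \<in> space Y" if "x \<in> space X" for x using measurable_space[OF p that] .
  have "countable {x \<in> space X. c (p x) = z}" for z
  proof (cases "\<exists>x0 \<in> space X. c (p x0) = z")
    case True
    then obtain x0 where x0: "x0 \<in> space X" "c (p x0) = z" by blast
    have "{x \<in> space X. c (p x) = z} \<subseteq> {x \<in> space X. p x = p x0}"
      using c(2) pY x0 by (auto dest: inj_onD)
    then show ?thesis using countable_subset fibres[OF pY[OF x0(1)]] by blast
  next
    case False
    then have "{x \<in> space X. c (p x) = z} = {}" by blast
    then show ?thesis by (simp only: countable_empty)
  qed
  from standard_borel_countable_fibres[OF X measurable_compose[OF p c(1)] this]
  obtain U where U: "\<And>n::nat. U n \<in> sets X" "\<And>n. inj_on (\<lambda>x. c (p x)) (U n)" "space X = (\<Union>n. U n)" by blast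
  have "inj_on p (U n)" for n using U(2)[of n] by (auto simp: inj_on_def)
  then show ?thesis using U by blast
qed

lemma inj_image_sets:
  assumes X: "standard_borel X" and p: "p \<in> X \<rightarrow>\<^sub>M Y"
    and G: "countable G" "G \<subseteq> sets Y"
      "\<And>y y'. y \<in> space Y \<Longrightarrow> y' \<in> space Y \<Longrightarrow> (\<And>A. A \<in> G \<Longrightarrow> y \<in> A \<longleftrightarrow> y' \<in> A) \<Longrightarrow> y = y'"
    and U: "U \<in> sets X" "inj_on p U"
  shows "p ` U \<in> sets Y"
proof -
  obtain c :: "'b \<Rightarrow> nat \<Rightarrow> nat" where c: "c \<in> Y \<rightarrow>\<^sub>M borel" "inj_on c (space Y)"
    using countably_separated_code[OF G] by blast
  have pY: "p x \<in> space Y" if "x \<in> U" for x 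
    using measurable_space[OF p] sets.sets_into_space[OF U(1)] that by blast
  have "inj_on (\<lambda>x. c (p x)) U"
    using U(2) c(2) pY by (auto simp: inj_on_def)
  from standard_borel_inj_image[OF X measurable_compose[OF p c(1)] U(1) this]
  have "c -` ((\<lambda>x. c (p x)) ` U) \<inter> space Y \<in> sets Y" by (rule measurable_sets[OF c(1)])
  also have "c -` ((\<lambda>x. c (p x)) ` U) \<inter> space Y = p ` U"
    using pY c(2) by (auto dest: inj_onD)
  finally show ?thesis .
qed

section \<open>The Borel space of models\<close>

text \<open>The universes of the structures in \<open>Mod L T\<close>.\<close>

definition initial :: "nat set \<Rightarrow> bool" where
  "initial U \<longleftrightarrow> U \<in> insert UNIV (range (\<lambda>n. {..<n}))"

lemma initial_down: "initial U \<Longrightarrow> n \<in> U \<Longrightarrow> m \<le> n \<Longrightarrow> m \<in> U"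
  by (auto simp: initial_def)

lemma initial_card: "initial U \<Longrightarrow> infinite U \<or> n \<le> card U \<longleftrightarrow> {..<n} \<subseteq> U"
  by (auto simp: initial_def)

lemma Mod_initial: "M \<in> Mod L T \<Longrightarrow> initial (univ M)"
  by (simp add: Mod_def initial_def)

lemma ModB_gen_sub:
  "{{M \<in> Mod L T. infinite (univ M) \<or> n \<le> card (univ M)} | n. True} \<union>
     {{M \<in> Mod L T. set as \<subseteq> univ M \<and> as \<in> intp M R} | R as. R \<in> syms L \<and> length as = arity L R} \<subseteq> Pow (Mod L T)"
  by auto

lemma space_ModB [simp]: "space (ModB L T) = Mod L T"
  unfolding ModB_def by (rule space_measure_of[OF ModB_gen_sub])

lemma sets_ModB_gen: "A \<in> {{M \<in> Mod L T. infinite (univ M) \<or> n \<le> card (univ M)} | n. True} \<union>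
     {{M \<in> Mod L T. set as \<subseteq> univ M \<and> as \<in> intp M R} | R as. R \<in> syms L \<and> length as = arity L R} \<Longrightarrow> A \<in> sets (ModB L T)"
  unfolding ModB_def sets_measure_of[OF ModB_gen_sub] by (rule sigma_sets.Basic)

lemma sets_Mod_lessThan: "{M \<in> Mod L T. {..<n} \<subseteq> univ M} \<in> sets (ModB L T)"
proof -
  have "{M \<in> Mod L T. {..<n} \<subseteq> univ M} = {M \<in> Mod L T. infinite (univ M) \<or> n \<le> card (univ M)}"
    using initial_card Mod_initial by blast
  then show ?thesis by (intro sets_ModB_gen) auto
qed

lemma sets_Mod_rel:
  assumes "R \<in> syms L" "length as = arity L R"
  shows "{M \<in> Mod L T. as \<in> intp M R} \<in> sets (ModB L T)"
proof -
  have "{M \<in> Mod L T. as \<in> intp M R} = {M \<in> Mod L T. set as \<subseteq> univ M \<and> as \<in> intp M R}"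
    by (auto simp: Mod_def is_struct_def)
  then show ?thesis using assms by (intro sets_ModB_gen) auto
qed

lemma initial_subset_lessThan: 
  assumes "initial U" 
  shows "set as \<subseteq> U \<longleftrightarrow> {..<fold (max \<circ> Suc) as 0} \<subseteq> U"
proof -
  have "{..<fold (max \<circ> Suc) as k} \<subseteq> U \<longleftrightarrow> {..<k} \<subseteq> U \<and> set as \<subseteq> U" for k
  proof (induction as arbitrary: k)
    case (Cons a as)
    have "{..<max (Suc a) k} \<subseteq> U \<longleftrightarrow> {..<k} \<subseteq> U \<and> a \<in> U"
      using initial_down[OF assms] by (auto simp: less_max_iff_disj less_Suc_eq_le)
    then show ?case using Cons by auto
  qed simp
  from this[of 0] show ?thesis by simp
qed

lemma sets_Mod_subset: "{M \<in> Mod L T. set as \<subseteq> univ M} \<in> sets (ModB L T)"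
proof -
  have "{M \<in> Mod L T. set as \<subseteq> univ M} = {M \<in> Mod L T. {..<fold (max \<circ> Suc) as 0} \<subseteq> univ M}"
    using initial_subset_lessThan Mod_initial by blast
  then show ?thesis using sets_Mod_lessThan by simp
qed

lemma ModB_countably_separated:
  assumes "countable (syms L)"
  shows "\<exists>G. countable G \<and> G \<subseteq> sets (ModB L T) \<and> (\<forall>M\<in>Mod L T. \<forall>N\<in>Mod L T. (\<forall>A\<in>G. M \<in> A \<longleftrightarrow> N \<in> A) \<longrightarrow> M = N)"
proof -
  let ?G1 = "range (\<lambda>n. {M \<in> Mod L T. {..<n} \<subseteq> univ M})"
  let ?G2 = "(\<lambda>(R, as). {M \<in> Mod L T. as \<in> intp M R}) ` (SIGMA R : syms L. {as. length as = arity L R})"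
  have "countable (?G1 \<union> ?G2)" using assms by auto
  moreover have "?G1 \<union> ?G2 \<subseteq> sets (ModB L T)" using sets_Mod_lessThan sets_Mod_rel by auto
  moreover have sep: "M = N" if M: "M \<in> Mod L T" "N \<in> Mod L T" and eq: "\<And>A. A \<in> ?G1 \<union> ?G2 \<Longrightarrow> M \<in> A \<longleftrightarrow> N \<in> A" for M N
  proof -
    have sub: "as \<in> intp N R \<Longrightarrow> R \<in> syms L \<and> length as = arity L R" if "N \<in> Mod L T" for N :: "('a, nat) struct" and R as
      using that by (auto simp: Mod_def is_struct_def)
    have "{..<n} \<subseteq> univ M \<longleftrightarrow> {..<n} \<subseteq> univ N" for n
      using eq[of "{M \<in> Mod L T. {..<n} \<subseteq> univ M}"] M by auto
    then have "n \<in> univ M \<longleftrightarrow> n \<in> univ N" for n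
      using initial_subset_lessThan[of "univ M" "[n]"] initial_subset_lessThan[of "univ N" "[n]"] M Mod_initial by force
    then have "univ M = univ N" by blast
    moreover have "intp M R = intp N R" for R
    proof (cases "R \<in> syms L")
      case True
      have "as \<in> intp M R \<longleftrightarrow> as \<in> intp N R" if "length as = arity L R" for as
        using eq[of "{M \<in> Mod L T. as \<in> intp M R}"] M True that by blast
      then show ?thesis using sub[OF M(1)] sub[OF M(2)] by blast
    next
      case False
      then show ?thesis using sub[OF M(1)] sub[OF M(2)] by blast
    qed
    ultimately show ?thesis by (simp add: fun_eq_iff)
  qed
  moreover have "\<forall>M\<in>Mod L T. \<forall>N\<in>Mod L T. (\<forall>A\<in>?G1 \<union> ?G2. M \<in> A \<longleftrightarrow> N \<in> A) \<longrightarrow> M = N"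
    by (intro ballI impI) (rule sep; simp)
  ultimately show ?thesis by (intro exI[of _ "?G1 \<union> ?G2"] conjI)
qed

section \<open>Category quantifiers over enumerations\<close>

text \<open>An enumeration of a universe \<open>U\<close>, which is an initial segment of the natural numbers, is a permutation
  of \<open>U\<close>. Its finite approximations, the conditions, are lists without repetition, written with the latest
  value first: extending a condition is then adding an element to the front, just as a quantifier adds a
  value to the front of an assignment.\<close>

definition condition :: "nat set \<Rightarrow> nat list \<Rightarrow> bool" where
  "condition U a \<longleftrightarrow> distinct a \<and> set a \<subseteq> U"

definition Sym :: "nat set \<Rightarrow> (nat \<Rightarrow> nat) set" where
  "Sym U = {k \<in> extensional U. bij_betw k U U}"

definition initial_part :: "(nat \<Rightarrow> nat) \<Rightarrow> nat \<Rightarrow> nat list" where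
  "initial_part k n = rev (map k [0..<n])"

definition enum_of :: "nat set \<Rightarrow> nat list \<Rightarrow> (nat \<Rightarrow> nat) set" where
  "enum_of U a = {k \<in> Sym U. {..<length a} \<subseteq> U \<and> initial_part k (length a) = a}"

text \<open>Comeagerness of \<open>A\<close> among the enumerations that extend \<open>a\<close>, in terms of conditions: \<open>A\<close> contains all
  enumerations that meet countably many sets of conditions which are dense below \<open>a\<close>. For a finite \<open>U\<close>,
  where enumerations are themselves conditions, this means that \<open>A\<close> contains all that extend
  \<open>a\<close>.\<close>

definition comeager :: "nat set \<Rightarrow> nat list \<Rightarrow> (nat \<Rightarrow> nat) set \<Rightarrow> bool" where
  "comeager U a A \<longleftrightarrow> (\<exists>D :: nat \<Rightarrow> nat list set.
     (\<forall>i b. condition U (b @ a) \<longrightarrow> (\<exists>c. condition U (c @ b @ a) \<and> c @ b @ a \<in> D i)) \<and>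
     (\<forall>k \<in> enum_of U a. (\<forall>i. \<exists>b. k \<in> enum_of U (b @ a) \<and> b @ a \<in> D i) \<longrightarrow> k \<in> A))"

lemma length_initial_part [simp]: "length (initial_part k n) = n"
  by (simp add: initial_part_def)

lemma initial_part_nth: "i < n \<Longrightarrow> rev (initial_part k n) ! i = k i"
  by (simp add: initial_part_def)

lemma initial_part_add: "initial_part k (m + n) = rev (map k [n..<n + m]) @ initial_part k n"
  unfolding initial_part_def by (subst add.commute, subst upt_add_eq_append) simp_all

lemma initial_part_append: "initial_part k (length b + n) = b @ a \<Longrightarrow> length a = n \<Longrightarrow> initial_part k n = a"
  unfolding initial_part_add by (simp add: append_eq_append_conv)

lemma condition_initial_part: "k \<in> Sym U \<Longrightarrow> {..<n} \<subseteq> U \<Longrightarrow> condition U (initial_part k n)"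
  unfolding condition_def initial_part_def Sym_def bij_betw_def
  by (auto simp: distinct_map lessThan_atLeast0[symmetric] inj_on_subset)

lemma condition_length:
  assumes "initial U" "condition U a"
  shows "{..<length a} \<subseteq> U"
proof -
  have "length a = card (set a)" using assms(2) by (simp add: condition_def distinct_card)
  moreover have "finite U \<Longrightarrow> card (set a) \<le> card U" using assms(2) by (auto simp: condition_def intro: card_mono)
  ultimately show ?thesis using initial_card[OF assms(1), of "length a"] by auto
qed

lemma enum_of_append: "enum_of U (b @ a) \<subseteq> enum_of U a"
  by (auto simp: enum_of_def dest: initial_part_append)

lemma enum_ofD: "k \<in> enum_of U a \<Longrightarrow> k \<in> Sym U" "k \<in> enum_of U a \<Longrightarrow> initial_part k (length a) = a"
  "k \<in> enum_of U a \<Longrightarrow> {..<length a} \<subseteq> U" "k \<in> enum_of U a \<Longrightarrow> condition U a"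
  using condition_initial_part[of k U "length a"] by (auto simp: enum_of_def)

lemma initial_part_extends:
  assumes "k \<in> enum_of U a" "length a \<le> n"
  shows "\<exists>b. initial_part k n = b @ a \<and> length b = n - length a"
proof -
  have "initial_part k ((n - length a) + length a) = rev (map k [length a..<length a + (n - length a)]) @ a"
    unfolding initial_part_add using enum_ofD(2)[OF assms(1)] by simp
  then show ?thesis using assms(2) by simp
qed

text \<open>The Baire category theorem. Conditions are extended step by step into the dense sets, and at step \<open>n\<close> the
  number \<open>n\<close> is added if it is missing, so that the limit is onto \<open>U\<close>. Since \<open>U\<close> is an initial segment, the
  numbers up to \<open>j \<in> U\<close> that are present after step \<open>j\<close> force the condition to be longer than \<open>j\<close>; hence the
  limit is defined on all of \<open>U\<close>.\<close>

lemma generic_exists: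
  assumes U: "initial U" and a: "condition U a"
    and D: "\<And>i b. condition U (b @ a) \<Longrightarrow> \<exists>c. condition U (c @ b @ a) \<and> c @ b @ a \<in> D i"
  shows "\<exists>k \<in> enum_of U a. \<forall>i::nat. \<exists>b. k \<in> enum_of U (b @ a) \<and> b @ a \<in> D i"
proof -
  define P where "P s \<longleftrightarrow> condition U (s @ a)" for s
  define Q where "Q n s t \<longleftrightarrow> (\<exists>c c'. t = c' @ c @ s \<and> c @ s @ a \<in> D n \<and> (n \<in> U \<longrightarrow> n \<in> set (t @ a)))" for n s t
  have "\<exists>s. \<forall>n. (P (s n) \<and> (n = 0 \<longrightarrow> s n = [])) \<and> Q n (s n) (s (Suc n))"
  proof (rule dependent_nat_choice)
    show "\<exists>x. P x \<and> (0 = 0 \<longrightarrow> x = [])" using a by (simp add: P_def)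
  next
    fix s and n :: nat assume "P s \<and> (n = 0 \<longrightarrow> s = [])"
    then obtain c where c: "condition U (c @ s @ a)" "c @ s @ a \<in> D n" using D[of s n] by (auto simp: P_def)
    define c' where "c' = (if n \<in> U \<and> n \<notin> set (c @ s @ a) then [n] else [])"
    have "P (c' @ c @ s)" using c(1) by (auto simp: P_def c'_def condition_def)
    moreover have "Q n s (c' @ c @ s)" unfolding Q_def using c(2)
      by (intro exI[of _ c] exI[of _ c']) (auto simp: c'_def)
    ultimately show "\<exists>y. (P y \<and> (Suc n = 0 \<longrightarrow> y = [])) \<and> Q n s y" by (intro exI[of _ "c' @ c @ s"]) simp
  qed
  then obtain s where s: "\<And>n. P (s n)" "s 0 = []" "\<And>n. Q n (s n) (s (Suc n))" by auto
  define t where "t n = s n @ a" for n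
  have condition_t: "condition U (t n)" for n using s(1) by (simp add: P_def t_def)
  have step: "\<exists>c. t (Suc n) = c @ t n" for n using s(3)[of n] by (auto simp: Q_def t_def)
  have mono: "\<exists>c. t m = c @ t n" if "n \<le> m" for n m using that
  proof (induction m rule: dec_induct)
    case (step m)
    then show ?case using \<open>\<And>n. \<exists>c. t (Suc n) = c @ t n\<close>[of m] by (metis append.assoc)
  qed simp
  have mem: "n \<in> set (t m)" if "n \<in> U" "n < m" for n m
  proof -
    have "n \<in> set (t (Suc n))" using s(3)[of n] that by (auto simp: Q_def t_def)
    then show ?thesis using mono[of "Suc n" m] that by auto
  qed
  have len: "j < length (t (Suc j))" if "j \<in> U" for j
  proof -
    have "{..j} \<subseteq> set (t (Suc j))" using mem initial_down[OF U that] by (auto simp: less_Suc_eq_le)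
    then have "card {..j} \<le> card (set (t (Suc j)))" by (intro card_mono) auto
    then show ?thesis using card_length[of "t (Suc j)"] by simp
  qed
  define k where "k j = (if j \<in> U then rev (t (Suc j)) ! j else undefined)" for j
  have coh: "rev (t n) ! j = rev (t m) ! j" if "j < length (t n)" "n \<le> m" for n m j
    using mono[OF that(2)] that(1) by (auto simp: nth_append)
  have k: "rev (t n) ! j = k j" if "j < length (t n)" for n j
  proof -
    have "j \<in> U" using condition_length[OF U condition_t, of n] that by auto
    then show ?thesis using coh[OF that, of "max n (Suc j)"] coh[OF len, of j "max n (Suc j)"]
      by (simp add: k_def)
  qed
  have init_k: "initial_part k (length (t n)) = t n" for n
  proof -
    have "rev (initial_part k (length (t n))) = rev (t n)"
      by (rule nth_equalityI) (simp_all add: initial_part_nth k)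
    then show ?thesis by simp
  qed
  have "k \<in> Sym U"
  proof -
    have "inj_on k U"
    proof (rule inj_onI)
      fix i j assume ij: "i \<in> U" "j \<in> U" "k i = k j"
      let ?m = "max (Suc i) (Suc j)"
      have "i < length (t ?m)" "j < length (t ?m)"
        using len[OF ij(1)] len[OF ij(2)] mono[of "Suc i" ?m] mono[of "Suc j" ?m] by auto
      moreover have "distinct (rev (t ?m))" using condition_t by (simp add: condition_def)
      ultimately show "i = j" using ij(3) k nth_eq_iff_index_eq[of "rev (t ?m)" i j] by simp
    qed
    moreover have "k ` U \<subseteq> U"
    proof (rule image_subsetI)
      fix j assume j: "j \<in> U"
      have "rev (t (Suc j)) ! j \<in> set (rev (t (Suc j)))" using len[OF j] by (intro nth_mem) simp
      then show "k j \<in> U" using condition_t[of "Suc j"] j by (auto simp: k_def condition_def)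
    qed
    moreover have "U \<subseteq> k ` U"
    proof
      fix n assume "n \<in> U"
      then have "n \<in> set (rev (t (Suc n)))" using mem by simp
      then obtain j where j: "j < length (t (Suc n))" "n = rev (t (Suc n)) ! j" by (auto simp: in_set_conv_nth simp del: set_rev)
      then have "j \<in> U" using condition_length[OF U condition_t, of "Suc n"] by auto
      then show "n \<in> k ` U" using j(2) k[OF j(1)] by auto
    qed
    ultimately show ?thesis by (auto simp: Sym_def bij_betw_def extensional_def k_def)
  qed
  then have ext: "k \<in> enum_of U (t n)" for n
    using init_k condition_length[OF U condition_t] by (simp add: enum_of_def)
  have "k \<in> enum_of U a" using ext[of 0] s(2) by (simp add: t_def)
  moreover have "\<exists>b. k \<in> enum_of U (b @ a) \<and> b @ a \<in> D i" for i
  proof -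
    obtain c c' where c: "t (Suc i) = c' @ c @ s i @ a" "c @ s i @ a \<in> D i"
      using s(3)[of i] by (auto simp: Q_def t_def)
    then have "k \<in> enum_of U (c @ s i @ a)" using ext[of "Suc i"] enum_of_append[of U c' "c @ s i @ a"] by auto
    then show ?thesis using c(2) by (intro exI[of _ "c @ s i"]) simp
  qed
  ultimately show ?thesis by blast
qed

lemma enum_of_nonempty: "initial U \<Longrightarrow> condition U a \<Longrightarrow> \<exists>k. k \<in> enum_of U a"
  using generic_exists[of U a "\<lambda>_. UNIV"] by (metis UNIV_I append_Nil)

lemma comeager_nonempty: "initial U \<Longrightarrow> condition U a \<Longrightarrow> comeager U a A \<Longrightarrow> \<exists>k \<in> enum_of U a. k \<in> A"
proof -
  assume U: "initial U" "condition U a" and "comeager U a A"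
  then obtain D where D: "\<And>i b. condition U (b @ a) \<Longrightarrow> \<exists>c. condition U (c @ b @ a) \<and> c @ b @ a \<in> D i"
     "\<And>k. k \<in> enum_of U a \<Longrightarrow> (\<forall>i::nat. \<exists>b. k \<in> enum_of U (b @ a) \<and> b @ a \<in> D i) \<Longrightarrow> k \<in> A"
    unfolding comeager_def by blast
  have "\<exists>k \<in> enum_of U a. \<forall>i. \<exists>b. k \<in> enum_of U (b @ a) \<and> b @ a \<in> D i"
    by (rule generic_exists[OF U]) (rule D(1))
  then show ?thesis using D(2) by blast
qed

lemma comeager_all: "enum_of U a \<subseteq> A \<Longrightarrow> comeager U a A"
  unfolding comeager_def by (intro exI[of _ "\<lambda>_. UNIV"]) (auto intro: exI[of _ "[]"])

lemma comeager_mono: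
  assumes "comeager U a A" "enum_of U a \<inter> A \<subseteq> B"
  shows "comeager U a B"
  using assms unfolding comeager_def by blast

lemma comeager_cong: "enum_of U a \<inter> A = enum_of U a \<inter> B \<Longrightarrow> comeager U a A = comeager U a B"
  by (metis comeager_mono inf_le2)

lemma comeager_INT:
  assumes "\<And>i::nat. comeager U a (A i)"
  shows "comeager U a (\<Inter>i. A i)"
proof -
  have "\<forall>i. \<exists>D. (\<forall>j b. condition U (b @ a) \<longrightarrow> (\<exists>c. condition U (c @ b @ a) \<and> c @ b @ a \<in> D j)) \<and>
     (\<forall>k \<in> enum_of U a. (\<forall>j::nat. \<exists>b. k \<in> enum_of U (b @ a) \<and> b @ a \<in> D j) \<longrightarrow> k \<in> A i)"
    using assms unfolding comeager_def by blast
  from choice[OF this] obtain D where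
    D: "\<And>i j b. condition U (b @ a) \<Longrightarrow> \<exists>c. condition U (c @ b @ a) \<and> c @ b @ a \<in> D i j"
     "\<And>i k. k \<in> enum_of U a \<Longrightarrow> (\<forall>j::nat. \<exists>b. k \<in> enum_of U (b @ a) \<and> b @ a \<in> D i j) \<Longrightarrow> k \<in> A i"
    by blast
  let ?D = "\<lambda>n. D (fst (prod_decode n)) (snd (prod_decode n))"
  have "k \<in> (\<Inter>i. A i)" if k: "k \<in> enum_of U a" and meets: "\<forall>n. \<exists>b. k \<in> enum_of U (b @ a) \<and> b @ a \<in> ?D n" for k
  proof
    fix i
    have "\<forall>j. \<exists>b. k \<in> enum_of U (b @ a) \<and> b @ a \<in> D i j"
    proof
      fix j show "\<exists>b. k \<in> enum_of U (b @ a) \<and> b @ a \<in> D i j"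
        using spec[OF meets, of "prod_encode (i, j)"] by simp
    qed
    then show "k \<in> A i" by (rule D(2)[OF k])
  qed
  then show ?thesis unfolding comeager_def using D(1) by (intro exI[of _ ?D]) blast
qed

lemma comeager_Int: 
  assumes "comeager U a A" "comeager U a B"
  shows "comeager U a (A \<inter> B)"
proof -
  have "comeager U a (\<Inter>i::nat. if i = 0 then A else B)" by (rule comeager_INT) (use assms in simp)
  then show ?thesis
  proof (rule comeager_mono)
    have "k \<in> A \<inter> B" if "k \<in> (\<Inter>i::nat. if i = 0 then A else B)" for k
      using INT_D[OF that, of 0] INT_D[OF that, of 1] by simp
    then show "enum_of U a \<inter> (\<Inter>i::nat. if i = 0 then A else B) \<subseteq> A \<inter> B" by blast
  qed
qed

lemma comeager_append: 
  assumes "comeager U a A"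
  shows "comeager U (b @ a) A"
proof -
  obtain D where D: "\<And>i b. condition U (b @ a) \<Longrightarrow> \<exists>c. condition U (c @ b @ a) \<and> c @ b @ a \<in> D i"
     "\<And>k. k \<in> enum_of U a \<Longrightarrow> (\<forall>i::nat. \<exists>b. k \<in> enum_of U (b @ a) \<and> b @ a \<in> D i) \<Longrightarrow> k \<in> A"
    using assms unfolding comeager_def by blast
  have "k \<in> A" if k: "k \<in> enum_of U (b @ a)" and meets: "\<forall>i. \<exists>c. k \<in> enum_of U (c @ b @ a) \<and> c @ b @ a \<in> D i" for k
  proof (rule D(2))
    show "k \<in> enum_of U a" using k enum_of_append by blast
    show "\<forall>i. \<exists>b. k \<in> enum_of U (b @ a) \<and> b @ a \<in> D i" using meets by (metis append_assoc)
  qed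
  moreover have "\<exists>d. condition U (d @ c @ b @ a) \<and> d @ c @ b @ a \<in> D i" if "condition U (c @ b @ a)" for c i
    using D(1)[of "c @ b" i] that by simp
  ultimately show ?thesis unfolding comeager_def by (intro exI[of _ D]) blast
qed

text \<open>Dense sets for the various extensions of \<open>a\<close> are glued along the conditions in \<open>Gm\<close>, those that are
  minimal among the conditions below which \<open>A\<close> is comeager. An enumeration extends at most one of them, so
  it meets all dense sets of the same family.\<close>

lemma comeager_local:
  assumes loc: "\<And>b. condition U (b @ a) \<Longrightarrow> \<exists>c. condition U (c @ b @ a) \<and> comeager U (c @ b @ a) A"
  shows "comeager U a A"
proof -
  define G where "G = {b. condition U (b @ a) \<and> comeager U (b @ a) A}"
  define Gm where "Gm = {b \<in> G. \<forall>b1 b2. b = b1 @ b2 \<longrightarrow> b2 \<in> G \<longrightarrow> b1 = []}"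
  have "\<forall>s. \<exists>D. s \<in> G \<longrightarrow> ((\<forall>j b. condition U (b @ s @ a) \<longrightarrow> (\<exists>c. condition U (c @ b @ s @ a) \<and> c @ b @ s @ a \<in> D j)) \<and>
     (\<forall>k \<in> enum_of U (s @ a). (\<forall>j::nat. \<exists>b. k \<in> enum_of U (b @ s @ a) \<and> b @ s @ a \<in> D j) \<longrightarrow> k \<in> A))"
    unfolding G_def comeager_def by blast
  from choice[OF this] obtain D where
    D: "\<And>s j b. s \<in> G \<Longrightarrow> condition U (b @ s @ a) \<Longrightarrow> \<exists>c. condition U (c @ b @ s @ a) \<and> c @ b @ s @ a \<in> D s j"
     "\<And>s k. s \<in> G \<Longrightarrow> k \<in> enum_of U (s @ a) \<Longrightarrow> 
        (\<forall>j::nat. \<exists>b. k \<in> enum_of U (b @ s @ a) \<and> b @ s @ a \<in> D s j) \<Longrightarrow> k \<in> A"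
    by blast
  have min: "\<exists>b1 b2. b = b1 @ b2 \<and> b2 \<in> Gm" if "b \<in> G" for b
    using that
  proof (induction "length b" arbitrary: b rule: less_induct)
    case less
    show ?case
    proof (cases "b \<in> Gm")
      case True
      then show ?thesis by (intro exI[of _ "[]"] exI[of _ b]) simp
    next
      case False
      then obtain b1 b2 where b: "b = b1 @ b2" "b2 \<in> G" "b1 \<noteq> []" using less.prems by (auto simp: Gm_def)
      then obtain c1 c2 where "b2 = c1 @ c2" "c2 \<in> Gm" using less.hyps[of b2] by auto
      then show ?thesis using b by (intro exI[of _ "b1 @ c1"] exI[of _ c2]) simp
    qed
  qed
  define E where "E i = {b1 @ b2 @ a | b1 b2. b2 \<in> Gm \<and> b1 @ b2 @ a \<in> D b2 i}" for i
  have "\<exists>c. condition U (c @ b @ a) \<and> c @ b @ a \<in> E i" if ba: "condition U (b @ a)" for i b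
  proof -
    obtain c where c: "condition U (c @ b @ a)" "c @ b \<in> G" using loc[OF ba] by (auto simp: G_def)
    obtain b1 b2 where b: "c @ b = b1 @ b2" "b2 \<in> Gm" using min[OF c(2)] by blast
    then have "b2 \<in> G" "condition U (b1 @ b2 @ a)" using c(1) by (auto simp: Gm_def) (metis append_assoc)
    from D(1)[OF this] obtain d where d: "condition U (d @ b1 @ b2 @ a)" "d @ b1 @ b2 @ a \<in> D b2 i" by blast
    have eq: "d @ b1 @ b2 @ a = (d @ c) @ b @ a" using b(1) by (metis append_assoc)
    have "(d @ b1) @ b2 @ a \<in> D b2 i" using d(2) by simp
    then have "(d @ b1) @ b2 @ a \<in> E i" unfolding E_def using b(2) by blast
    then show ?thesis using d(1) eq by (intro exI[of _ "d @ c"]) simp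
  qed
  moreover have "k \<in> A" if k: "k \<in> enum_of U a" and meets: "\<forall>i. \<exists>b. k \<in> enum_of U (b @ a) \<and> b @ a \<in> E i" for k
  proof -
    have "\<forall>i. \<exists>b1 b2. k \<in> enum_of U (b1 @ b2 @ a) \<and> b2 \<in> Gm \<and> b1 @ b2 @ a \<in> D b2 i"
    proof
      fix i
      obtain b where "k \<in> enum_of U (b @ a)" "b @ a \<in> E i" using meets by blast
      then show "\<exists>b1 b2. k \<in> enum_of U (b1 @ b2 @ a) \<and> b2 \<in> Gm \<and> b1 @ b2 @ a \<in> D b2 i"
        unfolding E_def mem_Collect_eq by metis
    qed
    then obtain b1 b2 where b: "\<And>i. k \<in> enum_of U (b1 i @ b2 i @ a)" "\<And>i. b2 i \<in> Gm" "\<And>i. b1 i @ b2 i @ a \<in> D (b2 i) i"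
      by metis
    have ext: "k \<in> enum_of U (b2 i @ a)" for i using b(1)[of i] enum_of_append by blast
    have "b2 i = b2 j" if "length (b2 i) \<le> length (b2 j)" for i j
    proof -
      obtain c where "initial_part k (length (b2 j @ a)) = c @ b2 i @ a"
        using initial_part_extends[OF ext[of i], of "length (b2 j @ a)"] \<open>length (b2 i) \<le> length (b2 j)\<close> by auto
      then have "b2 j @ a = (c @ b2 i) @ a" using enum_ofD(2)[OF ext[of j]] by simp
      then have "b2 j = c @ b2 i" by simp
      then show ?thesis using b(2)[of i] b(2)[of j] by (auto simp: Gm_def)
    qed
    then have "b2 i = b2 0" for i by (metis nle_le)
    then have "\<forall>i. \<exists>b. k \<in> enum_of U (b @ b2 0 @ a) \<and> b @ b2 0 @ a \<in> D (b2 0) i" using b by metis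
    moreover have "b2 0 \<in> G" using b(2) by (auto simp: Gm_def)
    ultimately show ?thesis using D(2) ext by blast
  qed
  ultimately show ?thesis unfolding comeager_def by (intro exI[of _ E]) blast
qed

text \<open>The form in which the Baire property is used: densely many conditions decide between \<open>A\<close> and its
  complement.\<close>

definition baire_property :: "nat set \<Rightarrow> (nat \<Rightarrow> nat) set \<Rightarrow> bool" where
  "baire_property U A \<longleftrightarrow> (\<forall>a. condition U a \<longrightarrow> (\<exists>b. condition U (b @ a) \<and> (comeager U (b @ a) A \<or> comeager U (b @ a) (- A))))"

text \<open>The rule that turns a category quantifier over a complement into an ordinary quantifier over
  conditions.\<close>

lemma comeager_Compl_iff:
  assumes "initial U" "condition U a" "baire_property U A"
  shows "comeager U a (- A) \<longleftrightarrow> (\<forall>b. condition U (b @ a) \<longrightarrow> \<not> comeager U (b @ a) A)"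
proof
  assume *: "comeager U a (- A)"
  show "\<forall>b. condition U (b @ a) \<longrightarrow> \<not> comeager U (b @ a) A"
  proof (intro allI impI notI)
    fix b assume b: "condition U (b @ a)" "comeager U (b @ a) A"
    from comeager_nonempty[OF assms(1) b(1) comeager_Int[OF b(2) comeager_append[OF *]]]
    show False by blast
  qed
next
  assume *: "\<forall>b. condition U (b @ a) \<longrightarrow> \<not> comeager U (b @ a) A"
  show "comeager U a (- A)"
  proof (rule comeager_local)
    fix b assume "condition U (b @ a)"
    then obtain c where c: "condition U (c @ b @ a)" "comeager U (c @ b @ a) A \<or> comeager U (c @ b @ a) (- A)"
      using assms(3) unfolding baire_property_def by blast
    moreover have "\<not> comeager U (c @ b @ a) A" using * c(1) by (metis append_assoc)
    ultimately show "\<exists>c. condition U (c @ b @ a) \<and> comeager U (c @ b @ a) (- A)" by blast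
  qed
qed

lemma baire_property_Compl: "baire_property U A \<Longrightarrow> baire_property U (- A)"
  unfolding baire_property_def by (metis double_complement)

lemma baire_property_INT:
  assumes "initial U" "\<And>i::nat. baire_property U (A i)"
  shows "baire_property U (\<Inter>i. A i)"
  unfolding baire_property_def
proof (intro allI impI)
  fix a assume a: "condition U a"
  show "\<exists>b. condition U (b @ a) \<and> (comeager U (b @ a) (\<Inter>i. A i) \<or> comeager U (b @ a) (- (\<Inter>i. A i)))"
  proof (cases "\<exists>b i. condition U (b @ a) \<and> comeager U (b @ a) (- A i)")
    case True
    then obtain b i where b: "condition U (b @ a)" "comeager U (b @ a) (- A i)" by blast
    have "comeager U (b @ a) (- (\<Inter>i. A i))" by (rule comeager_mono[OF b(2)]) blast
    then show ?thesis using b(1) by blast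
  next
    case False
    have "comeager U a (A i)" for i
    proof -
      have "comeager U a (- (- A i))"
        using comeager_Compl_iff[OF assms(1) a baire_property_Compl[OF assms(2)], of i] False by blast
      then show ?thesis by simp
    qed
    then have "comeager U a (\<Inter>i. A i)" by (rule comeager_INT)
    then show ?thesis using a by (intro exI[of _ "[]"]) simp
  qed
qed

text \<open>\<open>D n P\<close> is meant to say that the predicate \<open>P\<close> of a point \<open>w\<close> and a condition \<open>a\<close> of length \<open>n\<close> in the
  universe \<open>u w\<close> is definable. There are two instances: definability by a formula in \<open>n\<close> variables, which
  gives the Lopez-Escobar theorem, and measurability of all sections, which shows that category quantifiers
  preserve Borel sets.\<close>

locale definable_family =
  fixes \<Omega> :: "'w set" and u :: "'w \<Rightarrow> nat set" and D :: "nat \<Rightarrow> ('w \<Rightarrow> nat list \<Rightarrow> bool) \<Rightarrow> bool"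
  assumes initial: "\<And>w. w \<in> \<Omega> \<Longrightarrow> initial (u w)"
    and D_cong: "\<And>n P Q. D n P \<Longrightarrow> (\<And>w a. w \<in> \<Omega> \<Longrightarrow> condition (u w) a \<Longrightarrow> length a = n \<Longrightarrow> P w a \<longleftrightarrow> Q w a) \<Longrightarrow> D n Q"
    and D_neg: "\<And>n P. D n P \<Longrightarrow> D n (\<lambda>w a. \<not> P w a)"
    and D_conj: "\<And>n P. (\<And>i::nat. D n (P i)) \<Longrightarrow> D n (\<lambda>w a. \<forall>i. P i w a)"
    and D_all: "\<And>n P. D (Suc n) P \<Longrightarrow> D n (\<lambda>w a. \<forall>c \<in> u w - set a. P w (c # a))"
    and D_True: "\<And>n. D n (\<lambda>_ _. True)"
begin

text \<open>\<open>S\<close> can be quantified over: its sections have the Baire property, and comeagerness of the sections is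
  definable.\<close>

definition good :: "('w \<times> (nat \<Rightarrow> nat)) set \<Rightarrow> bool" where
  "good S \<longleftrightarrow> (\<forall>w \<in> \<Omega>. baire_property (u w) {k. (w, k) \<in> S}) \<and>
    (\<forall>n. D n (\<lambda>w a. comeager (u w) a {k. (w, k) \<in> S}))"

definition W :: "('w \<times> (nat \<Rightarrow> nat)) set" where
  "W = (SIGMA w : \<Omega>. Sym (u w))"

definition goodM :: "('w \<times> (nat \<Rightarrow> nat)) measure" where
  "goodM = sigma W {S. S \<subseteq> W \<and> good S}"

lemma D_ext: "D (m + n) P \<Longrightarrow> D n (\<lambda>w a. \<forall>b. length b = m \<longrightarrow> condition (u w) (b @ a) \<longrightarrow> P w (b @ a))"
proof (induction m arbitrary: P)
  case 0
  then have "D n P" by simp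
  then show ?case by (rule D_cong) simp
next
  case (Suc m)
  from Suc.IH[OF D_all[OF Suc.prems[simplified]]] show ?case
  proof (rule D_cong)
    fix w a
    show "(\<forall>b. length b = m \<longrightarrow> condition (u w) (b @ a) \<longrightarrow> (\<forall>c\<in>u w - set (b @ a). P w (c # b @ a))) \<longleftrightarrow>
      (\<forall>b. length b = Suc m \<longrightarrow> condition (u w) (b @ a) \<longrightarrow> P w (b @ a))" (is "?L \<longleftrightarrow> ?R")
    proof
      assume L: ?L
      show ?R
      proof (intro allI impI)
        fix b assume "length b = Suc m" "condition (u w) (b @ a)"
        then obtain c b' where "b = c # b'" "length b' = m" by (cases b) auto
        with L \<open>condition (u w) (b @ a)\<close> show "P w (b @ a)" by (auto simp: condition_def)
      qed
    next
      assume R: ?R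
      show ?L
      proof (intro allI impI ballI)
        fix b c assume "length b = m" "condition (u w) (b @ a)" "c \<in> u w - set (b @ a)"
        then show "P w (c # b @ a)" using R[rule_format, of "c # b"] by (auto simp: condition_def)
      qed
    qed
  qed
qed

lemma good_cong:
  assumes "good S" "S \<inter> W = S' \<inter> W"
  shows "good S'"
proof -
  have eq: "enum_of (u w) a \<inter> {k. (w, k) \<in> S} = enum_of (u w) a \<inter> {k. (w, k) \<in> S'}"
    "enum_of (u w) a \<inter> - {k. (w, k) \<in> S} = enum_of (u w) a \<inter> - {k. (w, k) \<in> S'}"
    if "w \<in> \<Omega>" for w a
    using assms(2) that enum_ofD(1)[of _ "u w" a] unfolding W_def by auto
  have "baire_property (u w) {k. (w, k) \<in> S'}" if "w \<in> \<Omega>" for w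
  proof -
    have "baire_property (u w) {k. (w, k) \<in> S}" using assms(1) that by (simp add: good_def)
    then show ?thesis unfolding baire_property_def comeager_cong[OF eq(1)[OF that]] comeager_cong[OF eq(2)[OF that]] .
  qed
  moreover have "D n (\<lambda>w a. comeager (u w) a {k. (w, k) \<in> S'})" for n
    by (rule D_cong[of n "\<lambda>w a. comeager (u w) a {k. (w, k) \<in> S}"])
      (use assms(1) comeager_cong[OF eq(1)] in \<open>auto simp: good_def\<close>)
  ultimately show ?thesis by (simp add: good_def)
qed

lemma good_Compl:
  assumes "good S"
  shows "good (- S)"
proof -
  have C: "{k. (w, k) \<in> - S} = - {k. (w, k) \<in> S}" for w by auto
  have B: "baire_property (u w) {k. (w, k) \<in> S}" if "w \<in> \<Omega>" for w using assms that by (simp add: good_def)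
  have "D n (\<lambda>w a. comeager (u w) a (- {k. (w, k) \<in> S}))" for n
  proof (rule D_cong)
    show "D n (\<lambda>w a. \<forall>m. \<forall>b. length b = m \<longrightarrow> condition (u w) (b @ a) \<longrightarrow> \<not> comeager (u w) (b @ a) {k. (w, k) \<in> S})"
      by (intro D_conj D_ext D_neg) (use assms in \<open>simp add: good_def\<close>)
    show "(\<forall>m. \<forall>b. length b = m \<longrightarrow> condition (u w) (b @ a) \<longrightarrow> \<not> comeager (u w) (b @ a) {k. (w, k) \<in> S}) \<longleftrightarrow>
      comeager (u w) a (- {k. (w, k) \<in> S})" if "w \<in> \<Omega>" "condition (u w) a" for w a
      using comeager_Compl_iff[OF initial that(2) B] that(1) by auto
  qed
  then show ?thesis using B baire_property_Compl unfolding good_def C by blast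
qed

lemma good_INT:
  assumes "\<And>i::nat. good (S i)"
  shows "good (\<Inter>i. S i)"
proof -
  have C: "{k. (w, k) \<in> (\<Inter>i. S i)} = (\<Inter>i. {k. (w, k) \<in> S i})" for w by auto
  have "D n (\<lambda>w a. comeager (u w) a (\<Inter>i. {k. (w, k) \<in> S i}))" for n
  proof (rule D_cong)
    show "D n (\<lambda>w a. \<forall>i. comeager (u w) a {k. (w, k) \<in> S i})"
      by (intro D_conj) (use assms in \<open>simp add: good_def\<close>)
    show "(\<forall>i. comeager (u w) a {k. (w, k) \<in> S i}) \<longleftrightarrow> comeager (u w) a (\<Inter>i. {k. (w, k) \<in> S i})" for w a
      using comeager_INT[of "u w" a "\<lambda>i. {k. (w, k) \<in> S i}"] comeager_mono by blast
  qed
  moreover have "baire_property (u w) (\<Inter>i. {k. (w, k) \<in> S i})" if "w \<in> \<Omega>" for w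
    using assms that by (intro baire_property_INT initial) (auto simp: good_def)
  ultimately show ?thesis unfolding good_def C by blast
qed

lemma good_Int:
  assumes "good S" "good S'"
  shows "good (S \<inter> S')"
proof -
  have "good (\<Inter>i::nat. if i = 0 then S else S')" by (rule good_INT) (use assms in simp)
  moreover have "(\<Inter>i::nat. if i = 0 then S else S') = S \<inter> S'"
    by (auto dest: spec[of _ "0::nat"] spec[of _ "1::nat"])
  ultimately show ?thesis by simp
qed

text \<open>By this lemma it suffices to check generators in order to obtain good sets. The measurable space that
  consists of the good subsets of \<open>W\<close> is \<open>goodM\<close>.\<close>

lemma sigma_algebra_good: "sigma_algebra W {S. S \<subseteq> W \<and> good S}"
proof (rule sigma_algebra_iff2[THEN iffD2], intro conjI ballI allI impI)
  have "baire_property U UNIV" for U unfolding baire_property_def by (metis append_Nil comeager_all top_greatest)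
  moreover have "D n (\<lambda>w a. comeager (u w) a UNIV)" for n
    by (rule D_cong[OF D_True]) (simp add: comeager_all)
  ultimately have "good UNIV" by (simp add: good_def)
  then have "good (- UNIV)" by (rule good_Compl)
  then show "{} \<in> {S. S \<subseteq> W \<and> good S}" by simp
next
  fix S assume "S \<in> {S. S \<subseteq> W \<and> good S}"
  then have "good (- S)" using good_Compl by blast
  then have "good (W - S)" by (rule good_cong) blast
  then show "W - S \<in> {S. S \<subseteq> W \<and> good S}" by blast
next
  fix A :: "nat \<Rightarrow> _" assume A: "range A \<subseteq> {S. S \<subseteq> W \<and> good S}"
  have "good (- (\<Inter>i. - A i))" using A by (intro good_Compl good_INT) blast
  moreover have "- (\<Inter>i. - A i) = (\<Union>i. A i)" by auto
  ultimately show "(\<Union>i. A i) \<in> {S. S \<subseteq> W \<and> good S}" using A by auto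
qed auto

lemma space_goodM [simp]: "space goodM = W"
  unfolding goodM_def by (rule space_measure_of) auto

lemma sets_goodM: "S \<in> sets goodM \<longleftrightarrow> S \<subseteq> W \<and> good S"
  unfolding goodM_def using sigma_algebra.sets_measure_of_eq[OF sigma_algebra_good] by simp

lemma good_W: "good S \<Longrightarrow> S \<inter> W \<in> sets goodM"
  unfolding sets_goodM by (auto elim: good_cong)

lemma good_const:
  assumes "\<And>n. D n (\<lambda>w a. P w)"
  shows "good {(w, k). P w}"
proof -
  have iff: "comeager (u w) a {k. P w} \<longleftrightarrow> P w" if "w \<in> \<Omega>" "condition (u w) a" for w a
    using comeager_nonempty[OF initial[OF that(1)] that(2)] comeager_all by (cases "P w") fastforce+
  have "baire_property (u w) {k. P w}" for w
    unfolding baire_property_def by (metis (mono_tags, lifting) append_Nil comeager_all Compl_iff mem_Collect_eq subsetI)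
  moreover have "D n (\<lambda>w a. comeager (u w) a {k. P w})" for n
    by (rule D_cong[OF assms]) (rule iff[symmetric])
  ultimately show ?thesis by (simp add: good_def)
qed

lemma D_lessThan: "D n (\<lambda>w a. {..<m} \<subseteq> u w)"
proof (cases "m \<le> n")
  case True
  show ?thesis
  proof (rule D_cong[OF D_True])
    show "True \<longleftrightarrow> {..<m} \<subseteq> u w" if "w \<in> \<Omega>" "condition (u w) a" "length a = n" for w a
      using condition_length[OF initial[OF that(1)] that(2)] that(3) True by auto
  qed
next
  case False
  have "D ((m - n) + n) (\<lambda>w a. \<not> True)" by (intro D_neg D_True)
  from D_neg[OF D_ext[OF this]] show ?thesis
  proof (rule D_cong)
    fix w a assume w: "w \<in> \<Omega>" "condition (u w) a" "length a = n"
    have "\<exists>b. length b = m - n \<and> condition (u w) (b @ a)" if m: "{..<m} \<subseteq> u w"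
    proof -
      obtain k where k: "k \<in> enum_of (u w) a" using enum_of_nonempty[OF initial[OF w(1)] w(2)] by blast
      then obtain b where "initial_part k m = b @ a" "length b = m - n" using initial_part_extends[OF k, of m] w(3) False by auto
      then show ?thesis using condition_initial_part[OF enum_ofD(1)[OF k] m] by auto
    qed
    moreover have "{..<m} \<subseteq> u w" if "length b = m - n" "condition (u w) (b @ a)" for b
      using condition_length[OF initial[OF w(1)] that(2)] that(1) w(3) False by simp
    ultimately show "(\<not> (\<forall>b. length b = m - n \<longrightarrow> condition (u w) (b @ a) \<longrightarrow> \<not> True)) \<longleftrightarrow> {..<m} \<subseteq> u w" by blast
  qed
qed

text \<open>Conditions that depend only on the first \<open>m\<close> values of the enumeration. Conditions of length at least
  \<open>m\<close> decide them; for a shorter one, comeagerness is truth for all its extensions to length \<open>m\<close>. The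
  restriction to universes with at least \<open>m\<close> elements makes the first \<open>m\<close> values exist.\<close>

lemma good_prefix:
  assumes D: "\<And>n. m \<le> n \<Longrightarrow> D n (Q n)"
    and Q: "\<And>w k n. w \<in> \<Omega> \<Longrightarrow> k \<in> Sym (u w) \<Longrightarrow> m \<le> n \<Longrightarrow> {..<n} \<subseteq> u w \<Longrightarrow> (w, k) \<in> S \<longleftrightarrow> Q n w (initial_part k n)"
  shows "good {(w, k). {..<m} \<subseteq> u w \<and> (w, k) \<in> S}"
proof -
  let ?S = "{(w, k). {..<m} \<subseteq> u w \<longrightarrow> (w, k) \<in> S}"
  have S: "{k. (w, k) \<in> ?S} = {k. {..<m} \<subseteq> u w \<longrightarrow> (w, k) \<in> S}" for w by simp
  have const: "k \<in> {k. {..<m} \<subseteq> u w \<longrightarrow> (w, k) \<in> S} \<longleftrightarrow> Q n w a"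
    if "w \<in> \<Omega>" "length a = n" "m \<le> n" "k \<in> enum_of (u w) a" for w a k n
    using Q[of w k n] enum_ofD[OF that(4)] that by auto
  have iff: "comeager (u w) a {k. {..<m} \<subseteq> u w \<longrightarrow> (w, k) \<in> S} \<longleftrightarrow> Q n w a"
    if w: "w \<in> \<Omega>" "condition (u w) a" "length a = n" "m \<le> n" for w a n
  proof
    assume "comeager (u w) a {k. {..<m} \<subseteq> u w \<longrightarrow> (w, k) \<in> S}"
    from comeager_nonempty[OF initial[OF w(1)] w(2) this] show "Q n w a" using const[OF w(1,3,4)] by blast
  next
    assume "Q n w a"
    then show "comeager (u w) a {k. {..<m} \<subseteq> u w \<longrightarrow> (w, k) \<in> S}"
      using const[OF w(1,3,4)] by (intro comeager_all) blast
  qed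
  have "D n (\<lambda>w a. comeager (u w) a {k. {..<m} \<subseteq> u w \<longrightarrow> (w, k) \<in> S})" for n
  proof (cases "m \<le> n")
    case True
    show ?thesis by (rule D_cong[OF D[OF True]]) (simp add: iff True)
  next
    case False
    then have "D ((m - n) + n) (Q m)" using D[of m] by simp
    from D_ext[OF this] show ?thesis
    proof (rule D_cong)
      fix w a assume w: "w \<in> \<Omega>" "condition (u w) a" "length a = n"
      let ?A = "{k. {..<m} \<subseteq> u w \<longrightarrow> (w, k) \<in> S}"
      show "(\<forall>b. length b = m - n \<longrightarrow> condition (u w) (b @ a) \<longrightarrow> Q m w (b @ a)) \<longleftrightarrow> comeager (u w) a ?A"
      proof
        assume *: "\<forall>b. length b = m - n \<longrightarrow> condition (u w) (b @ a) \<longrightarrow> Q m w (b @ a)"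
        show "comeager (u w) a ?A"
        proof (rule comeager_all, rule subsetI, rule CollectI, rule impI)
          fix k assume k: "k \<in> enum_of (u w) a" and m: "{..<m} \<subseteq> u w"
          obtain b where b: "initial_part k m = b @ a" "length b = m - n"
            using initial_part_extends[OF k, of m] w(3) False by auto
          then have "Q m w (initial_part k m)" using * condition_initial_part[OF enum_ofD(1)[OF k] m] by simp
          then show "(w, k) \<in> S" using Q[OF w(1) enum_ofD(1)[OF k] order_refl m] by blast
        qed
      next
        assume *: "comeager (u w) a ?A"
        show "\<forall>b. length b = m - n \<longrightarrow> condition (u w) (b @ a) \<longrightarrow> Q m w (b @ a)"
        proof (intro allI impI)
          fix b assume b: "length b = m - n" "condition (u w) (b @ a)"
          then show "Q m w (b @ a)"
            using iff[OF w(1) b(2), of m] comeager_append[OF *, of b] w(3) False by simp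
        qed
      qed
    qed
  qed
  moreover have "baire_property (u w) {k. {..<m} \<subseteq> u w \<longrightarrow> (w, k) \<in> S}" if w: "w \<in> \<Omega>" for w
    unfolding baire_property_def
  proof (intro allI impI)
    fix a assume a: "condition (u w) a"
    let ?A = "{k. {..<m} \<subseteq> u w \<longrightarrow> (w, k) \<in> S}"
    show "\<exists>b. condition (u w) (b @ a) \<and> (comeager (u w) (b @ a) ?A \<or> comeager (u w) (b @ a) (- ?A))"
    proof (cases "{..<m} \<subseteq> u w")
      case True
      let ?n = "max m (length a)"
      obtain k where k: "k \<in> enum_of (u w) a" using enum_of_nonempty[OF initial[OF w] a] by blast
      obtain b where b: "initial_part k ?n = b @ a" using initial_part_extends[OF k, of ?n] by auto
      have "{..<?n} \<subseteq> u w" using True enum_ofD(3)[OF k] by (auto simp: max_def)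
      then have c: "condition (u w) (b @ a)" using condition_initial_part[OF enum_ofD(1)[OF k], of ?n] b by simp
      have len: "length (b @ a) = ?n" using arg_cong[OF b, of length] by simp
      have "comeager (u w) (b @ a) ?A \<or> comeager (u w) (b @ a) (- ?A)"
      proof (cases "Q ?n w (b @ a)")
        case True
        then show ?thesis using iff[OF w c len] by simp
      next
        case False
        then have "comeager (u w) (b @ a) (- ?A)"
          using const[OF w len] by (intro comeager_all) auto
        then show ?thesis ..
      qed
      then show ?thesis using c by blast
    next
      case False
      then have "comeager (u w) a ?A" by (intro comeager_all) simp
      then show ?thesis using a by (intro exI[of _ "[]"]) simp
    qed
  qed
  ultimately have "good ?S" unfolding good_def S by blast
  then have "good (?S \<inter> {(w, k). {..<m} \<subseteq> u w})" by (intro good_Int good_const D_lessThan)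
  moreover have "?S \<inter> {(w, k). {..<m} \<subseteq> u w} = {(w, k). {..<m} \<subseteq> u w \<and> (w, k) \<in> S}" by auto
  ultimately show ?thesis by simp
qed

end

section \<open>Renaming and isomorphism invariance of formulas\<close>

lemma sat_Conj [simp]: "sat M as (Conj F) \<longleftrightarrow> (\<forall>\<phi> \<in> rcset F. sat M as \<phi>)"
  by (simp add: cimage.rep_eq)

lemma sat_Disj [simp]: "sat M as (Disj F) \<longleftrightarrow> (\<exists>\<phi> \<in> rcset F. sat M as \<phi>)"
  by (simp add: cimage.rep_eq)

declare sat.simps(4,5) [simp del]

lemma fml_mono: "fml L n \<phi> \<Longrightarrow> n \<le> m \<Longrightarrow> fml L m \<phi>"
proof (induction arbitrary: m rule: fml.induct)
  case (2 R ks n)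
  then have "set ks \<subseteq> {..<m}" by auto
  then show ?case using 2 by (auto intro: fml.intros)
next
  case (6 n \<phi>)
  then show ?case by (auto intro: fml.intros)
next
  case (7 n \<phi>)
  then show ?case by (auto intro: fml.intros)
qed (auto intro: fml.intros)

text \<open>The assignments \<open>as\<close> and \<open>bs\<close> need to match only on the \<open>n\<close> variables of the formula; both may be longer
  lists.\<close>

lemma sat_ren:
  "fml L n \<phi> \<Longrightarrow> (\<And>i. i < n \<Longrightarrow> as ! \<rho> i = bs ! i) \<Longrightarrow> sat M as (ren \<rho> \<phi>) \<longleftrightarrow> sat M bs \<phi>"
proof (induction arbitrary: as bs \<rho> rule: fml.induct)
  case (2 R ks n)
  then have eq: "map (\<lambda>k. as ! \<rho> k) ks = map (\<lambda>k. bs ! k) ks" by auto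
  show ?case unfolding ren.simps sat.simps map_map comp_def eq ..
next
  case (4 F n)
  then have "sat M as (ren \<rho> \<phi>) \<longleftrightarrow> sat M bs \<phi>" if "\<phi> \<in> rcset F" for \<phi> using that by blast
  then show ?case by (simp add: cimage.rep_eq)
next
  case (5 F n)
  then have "sat M as (ren \<rho> \<phi>) \<longleftrightarrow> sat M bs \<phi>" if "\<phi> \<in> rcset F" for \<phi> using that by blast
  then show ?case by (simp add: cimage.rep_eq)
next
  case (6 n \<phi>)
  have "sat M (a # as) (ren (case_nat 0 (\<lambda>k. Suc (\<rho> k))) \<phi>) \<longleftrightarrow> sat M (a # bs) \<phi>" for a
    by (rule 6) (use 6 in \<open>auto split: nat.split\<close>)
  then show ?case by simp
next
  case (7 n \<phi>)
  have "sat M (a # as) (ren (case_nat 0 (\<lambda>k. Suc (\<rho> k))) \<phi>) \<longleftrightarrow> sat M (a # bs) \<phi>" for a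
    by (rule 7) (use 7 in \<open>auto split: nat.split\<close>)
  then show ?case by simp
qed simp_all

lemma ren_ren: "ren \<sigma> (ren \<rho> \<phi>) = ren (\<lambda>k. \<sigma> (\<rho> k)) \<phi>"
proof (induction \<phi> arbitrary: \<sigma> \<rho>)
  case (Conj F)
  then have "ren \<sigma> ` ren \<rho> ` rcset F = ren (\<lambda>k. \<sigma> (\<rho> k)) ` rcset F" unfolding image_image by (intro image_cong) auto
  then show ?case by (simp add: rcset_inject[symmetric] cimage.rep_eq)
next
  case (Disj F)
  then have "ren \<sigma> ` ren \<rho> ` rcset F = ren (\<lambda>k. \<sigma> (\<rho> k)) ` rcset F" unfolding image_image by (intro image_cong) auto
  then show ?case by (simp add: rcset_inject[symmetric] cimage.rep_eq)
next
  case (All \<phi>)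
  have "(\<lambda>k. case_nat 0 (\<lambda>k. Suc (\<sigma> k)) (case_nat 0 (\<lambda>k. Suc (\<rho> k)) k)) = case_nat 0 (\<lambda>k. Suc (\<sigma> (\<rho> k)))"
    by (auto split: nat.split)
  then show ?case using All by simp
next
  case (Ex \<phi>)
  have "(\<lambda>k. case_nat 0 (\<lambda>k. Suc (\<sigma> k)) (case_nat 0 (\<lambda>k. Suc (\<rho> k)) k)) = case_nat 0 (\<lambda>k. Suc (\<sigma> (\<rho> k)))"
    by (auto split: nat.split)
  then show ?case using Ex by simp
qed (simp_all add: comp_def)

lemma ren_cong_id: "fml L n \<phi> \<Longrightarrow> (\<And>i. i < n \<Longrightarrow> \<rho> i = i) \<Longrightarrow> ren \<rho> \<phi> = \<phi>"
proof (induction arbitrary: \<rho> rule: fml.induct)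
  case (2 R ks n)
  then show ?case by (auto intro: map_idI)
next
  case (4 F n)
  then have "ren \<rho> ` rcset F = (\<lambda>x. x) ` rcset F" by (intro image_cong) auto
  then show ?case by (simp add: rcset_inject[symmetric] cimage.rep_eq)
next
  case (5 F n)
  then have "ren \<rho> ` rcset F = (\<lambda>x. x) ` rcset F" by (intro image_cong) auto
  then show ?case by (simp add: rcset_inject[symmetric] cimage.rep_eq)
next
  case (6 n \<phi>)
  have "ren (case_nat 0 (\<lambda>k. Suc (\<rho> k))) \<phi> = \<phi>"
    by (rule 6) (use 6 in \<open>auto split: nat.split\<close>)
  then show ?case by simp
next
  case (7 n \<phi>)
  have "ren (case_nat 0 (\<lambda>k. Suc (\<rho> k))) \<phi> = \<phi>"
    by (rule 7) (use 7 in \<open>auto split: nat.split\<close>)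
  then show ?case by simp
qed simp_all

lemma sat_cong: "fml L n \<phi> \<Longrightarrow> (\<And>i. i < n \<Longrightarrow> as ! i = bs ! i) \<Longrightarrow> sat M as \<phi> \<longleftrightarrow> sat M bs \<phi>"
  using sat_ren[of L n \<phi> as "\<lambda>i. i" bs M] ren_cong_id[of L n \<phi> "\<lambda>i. i"] by simp

lemma fml_ren: "fml L n \<phi> \<Longrightarrow> (\<And>i. i < n \<Longrightarrow> \<rho> i < m) \<Longrightarrow> fml L m (ren \<rho> \<phi>)"
proof (induction arbitrary: \<rho> m rule: fml.induct)
  case (2 R ks n)
  then have "set (map \<rho> ks) \<subseteq> {..<m}" by auto
  then show ?case using 2(1,2) unfolding ren.simps by (intro fml.intros) simp_all
next
  case (4 F n)
  then show ?case by (auto intro!: fml.intros simp: cimage.rep_eq)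
next
  case (5 F n)
  then show ?case by (auto intro!: fml.intros simp: cimage.rep_eq)
next
  case (6 n \<phi>)
  have "fml L (Suc m) (ren (case_nat 0 (\<lambda>k. Suc (\<rho> k))) \<phi>)"
    by (rule 6) (use 6 in \<open>auto split: nat.split\<close>)
  then show ?case by (auto intro: fml.intros)
next
  case (7 n \<phi>)
  have "fml L (Suc m) (ren (case_nat 0 (\<lambda>k. Suc (\<rho> k))) \<phi>)"
    by (rule 7) (use 7 in \<open>auto split: nat.split\<close>)
  then show ?case by (auto intro: fml.intros)
qed (auto intro: fml.intros)

lemma sat_iso:
  assumes iso: "is_iso L M g N"
  shows "fml L n \<phi> \<Longrightarrow> n \<le> length as \<Longrightarrow> set as \<subseteq> univ M \<Longrightarrow> sat M as \<phi> \<longleftrightarrow> sat N (map g as) \<phi>"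
proof (induction arbitrary: as rule: fml.induct)
  case (1 i n j)
  then have "as ! i \<in> univ M" "as ! j \<in> univ M" by (auto simp: subset_iff)
  then show ?case using 1 iso by (auto simp: is_iso_def bij_betw_def inj_on_def)
next
  case (2 R ks n)
  have "set (map (\<lambda>k. as ! k) ks) \<subseteq> univ M" using 2 by (auto simp: subset_iff)
  moreover have "map (\<lambda>k. map g as ! k) ks = map g (map (\<lambda>k. as ! k) ks)" using 2 by (auto simp: subset_iff)
  ultimately show ?case using iso 2 by (simp add: is_iso_def del: map_map)
next
  case (6 n \<phi>)
  have IH: "sat M (a # as) \<phi> \<longleftrightarrow> sat N (g a # map g as) \<phi>" if "a \<in> univ M" for a
    using 6(2)[of "a # as"] 6 that by simp
  have "univ N = g ` univ M" using iso by (simp add: is_iso_def bij_betw_def)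
  then show ?case using IH by simp
next
  case (7 n \<phi>)
  have IH: "sat M (a # as) \<phi> \<longleftrightarrow> sat N (g a # map g as) \<phi>" if "a \<in> univ M" for a
    using 7(2)[of "a # as"] 7 that by simp
  have "univ N = g ` univ M" using iso by (simp add: is_iso_def bij_betw_def)
  then show ?case using IH by simp
qed simp_all

lemma sat_Alls: "sat M bs (Alls n \<phi>) \<longleftrightarrow> (\<forall>as. length as = n \<longrightarrow> set as \<subseteq> univ M \<longrightarrow> sat M (as @ bs) \<phi>)"
proof (induction n arbitrary: bs)
  case (Suc n)
  have "sat M bs (Alls (Suc n) \<phi>) \<longleftrightarrow> (\<forall>a\<in>univ M. \<forall>as. length as = n \<longrightarrow> set as \<subseteq> univ M \<longrightarrow> sat M ((as @ [a]) @ bs) \<phi>)"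
    using Suc by simp
  also have "\<dots> \<longleftrightarrow> (\<forall>as. length as = Suc n \<longrightarrow> set as \<subseteq> univ M \<longrightarrow> sat M (as @ bs) \<phi>)"
    (is "?L \<longleftrightarrow> ?R")
  proof
    assume L: ?L
    show ?R
    proof (intro allI impI)
      fix as assume as: "length as = Suc n" "set as \<subseteq> univ M"
      then obtain cs a where "as = cs @ [a]" by (cases as rule: rev_cases) auto
      then show "sat M (as @ bs) \<phi>" using L as by auto
    qed
  next
    assume R: ?R
    show ?L
    proof (intro ballI allI impI)
      fix a as assume "a \<in> univ M" "length as = n" "set as \<subseteq> univ M"
      then show "sat M ((as @ [a]) @ bs) \<phi>" using R[rule_format, of "as @ [a]"] by simp
    qed
  qed
  finally show ?case .
qed simp

lemma sat_Exs: "sat M bs ((Ex ^^ n) \<phi>) \<longleftrightarrow> (\<exists>as. length as = n \<and> set as \<subseteq> univ M \<and> sat M (as @ bs) \<phi>)"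
proof (induction n arbitrary: bs)
  case (Suc n)
  have "sat M bs ((Ex ^^ Suc n) \<phi>) \<longleftrightarrow> (\<exists>a\<in>univ M. \<exists>as. length as = n \<and> set as \<subseteq> univ M \<and> sat M ((as @ [a]) @ bs) \<phi>)"
    using Suc by simp
  also have "\<dots> \<longleftrightarrow> (\<exists>as. length as = Suc n \<and> set as \<subseteq> univ M \<and> sat M (as @ bs) \<phi>)"
    (is "?L \<longleftrightarrow> ?R")
  proof
    assume ?L
    then obtain a as where "a \<in> univ M" "length as = n" "set as \<subseteq> univ M" "sat M ((as @ [a]) @ bs) \<phi>" by blast
    then show ?R by (intro exI[of _ "as @ [a]"]) simp
  next
    assume ?R
    then obtain as where as: "length as = Suc n" "set as \<subseteq> univ M" "sat M (as @ bs) \<phi>" by blast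
    then obtain cs a where "as = cs @ [a]" by (cases as rule: rev_cases) auto
    then show ?L using as by (intro bexI[of _ a] exI[of _ cs]) auto
  qed
  finally show ?case .
qed simp

lemma fml_Exs: "fml L (n + m) \<phi> \<Longrightarrow> fml L m ((Ex ^^ n) \<phi>)"
proof (induction n arbitrary: m)
  case (Suc n)
  then have "fml L (Suc m) ((Ex ^^ n) \<phi>)" by simp
  then show ?case by (simp add: fml.intros)
qed simp

lemma fml_Alls: "fml L (n + m) \<phi> \<Longrightarrow> fml L m (Alls n \<phi>)"
proof (induction n arbitrary: m)
  case (Suc n)
  then have "fml L (Suc m) (Alls n \<phi>)" by simp
  then show ?case by (simp add: fml.intros)
qed simp

lemma is_iso_inv:
  assumes "is_iso L M g N"
  shows "is_iso L N (restrict (inv_into (univ M) g) (univ N)) M"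
proof -
  have bij: "bij_betw g (univ M) (univ N)" using assms by (simp add: is_iso_def)
  have bij': "bij_betw (inv_into (univ M) g) (univ N) (univ M)" by (rule bij_betw_inv_into[OF bij])
  have "as \<in> intp N R \<longleftrightarrow> map (restrict (inv_into (univ M) g) (univ N)) as \<in> intp M R"
    if R: "R \<in> syms L" "length as = arity L R" "set as \<subseteq> univ N" for R as
  proof -
    let ?bs = "map (inv_into (univ M) g) as"
    have eq: "map (restrict (inv_into (univ M) g) (univ N)) as = ?bs" using R(3) by auto
    have "set ?bs \<subseteq> univ M" using R(3) bij' by (auto simp: bij_betw_def)
    moreover have "map g ?bs = as" 
      using R(3) bij by (auto intro!: map_idI bij_betw_inv_into_right)
    ultimately show ?thesis unfolding eq using assms R(1,2) unfolding is_iso_def by (metis length_map)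
  qed
  moreover have "bij_betw (restrict (inv_into (univ M) g) (univ N)) (univ N) (univ M)"
    using bij' by (simp cong: bij_betw_cong)
  ultimately show ?thesis by (simp add: is_iso_def)
qed

lemma Isos_inv:
  "(M, g, N) \<in> Isos L T \<Longrightarrow> (N, restrict (inv_into (univ M) g) (univ N), M) \<in> Isos L T"
  using is_iso_inv[of L M g N] by (simp add: Isos_def)

section \<open>The Lopez-Escobar theorem\<close>

text \<open>The structure on the same universe for which \<open>k\<close> is an isomorphism onto \<open>M\<close>.\<close>

definition pull :: "'r lang \<Rightarrow> ('r, nat) struct \<Rightarrow> (nat \<Rightarrow> nat) \<Rightarrow> ('r, nat) struct" where
  "pull L M k = \<lparr>univ = univ M,
     intp = (\<lambda>R. {as. R \<in> syms L \<and> length as = arity L R \<and> set as \<subseteq> univ M \<and> map k as \<in> intp M R})\<rparr>"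

lemma univ_pull [simp]: "univ (pull L M k) = univ M"
  by (simp add: pull_def)

lemma is_iso_pull: "k \<in> Sym (univ M) \<Longrightarrow> is_iso L (pull L M k) k M"
  by (auto simp: is_iso_def pull_def Sym_def)

lemma iso_Mod:
  assumes T: "is_theory L T" and iso: "is_iso L N g M" and M: "M \<in> Mod L T"
    and N: "is_struct L N" "initial (univ N)"
  shows "N \<in> Mod L T"
proof -
  have "sat N [] \<tau>" if "\<tau> \<in> T" for \<tau>
    using sat_iso[OF iso, of 0 \<tau> "[]"] T M that by (auto simp: is_theory_def Mod_def)
  then show ?thesis using N by (simp add: Mod_def initial_def)
qed

lemma pull_Isos:
  assumes "is_theory L T" "M \<in> Mod L T" "k \<in> Sym (univ M)"
  shows "(pull L M k, k, M) \<in> Isos L T"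
proof -
  have "is_struct L (pull L M k)" by (auto simp: is_struct_def pull_def)
  then have "pull L M k \<in> Mod L T"
    using iso_Mod[OF assms(1) is_iso_pull[OF assms(3)] assms(2)] Mod_initial[OF assms(2)] by simp
  then show ?thesis using assms is_iso_pull[OF assms(3)] by (simp add: Isos_def Sym_def)
qed

definition definable :: "'r lang \<Rightarrow> 'r fm set \<Rightarrow> nat \<Rightarrow> (('r, nat) struct \<Rightarrow> nat list \<Rightarrow> bool) \<Rightarrow> bool" where
  "definable L T n P \<longleftrightarrow> (\<exists>\<phi>. fml L n \<phi> \<and>
    (\<forall>M \<in> Mod L T. \<forall>a. condition (univ M) a \<longrightarrow> length a = n \<longrightarrow> (sat M a \<phi> \<longleftrightarrow> P M a)))"

text \<open>In the step for a quantifier, the new element has to differ from the entries of the condition; this is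
  expressed by a disjunction with equations.\<close>

interpretation Mod: definable_family "Mod L T" univ "definable L T" for L T
proof
  fix n P Q
  show "initial (univ M)" if "M \<in> Mod L T" for M using that by (rule Mod_initial)
  show "definable L T n Q" if "definable L T n P"
    "\<And>M a. M \<in> Mod L T \<Longrightarrow> condition (univ M) a \<Longrightarrow> length a = n \<Longrightarrow> P M a \<longleftrightarrow> Q M a"
    using that unfolding definable_def by blast
  show "definable L T n (\<lambda>M a. \<not> P M a)" if P: "definable L T n P"
  proof -
    obtain \<phi> where "fml L n \<phi>" "\<forall>M \<in> Mod L T. \<forall>a. condition (univ M) a \<longrightarrow> length a = n \<longrightarrow> (sat M a \<phi> \<longleftrightarrow> P M a)"
      using P by (auto simp: definable_def)
    then show ?thesis unfolding definable_def by (intro exI[of _ "Neg \<phi>"]) (simp add: fml.intros)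
  qed
  show "definable L T n (\<lambda>M a. \<forall>i. R i M a)" if R: "\<And>i::nat. definable L T n (R i)" for R
  proof -
    have "\<forall>i. \<exists>\<phi>. fml L n \<phi> \<and> (\<forall>M \<in> Mod L T. \<forall>a. condition (univ M) a \<longrightarrow> length a = n \<longrightarrow> (sat M a \<phi> \<longleftrightarrow> R i M a))"
      using R by (simp add: definable_def)
    from choice[OF this] obtain \<phi> where \<phi>: "\<And>i. fml L n (\<phi> i)"
      "\<And>i M a. M \<in> Mod L T \<Longrightarrow> condition (univ M) a \<Longrightarrow> length a = n \<Longrightarrow> sat M a (\<phi> i) \<longleftrightarrow> R i M a" by blast
    have "fml L n (Conj (acset (range \<phi>)))" using \<phi>(1) by (auto intro!: fml.intros)
    then show ?thesis unfolding definable_def using \<phi>(2)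
      by (intro exI[of _ "Conj (acset (range \<phi>))"]) simp
  qed
  show "definable L T n (\<lambda>M a. \<forall>c \<in> univ M - set a. P M (c # a))" if P: "definable L T (Suc n) P"
  proof -
    obtain \<phi> where \<phi>: "fml L (Suc n) \<phi>" 
      "\<And>M a. M \<in> Mod L T \<Longrightarrow> condition (univ M) a \<Longrightarrow> length a = Suc n \<Longrightarrow> sat M a \<phi> \<longleftrightarrow> P M a"
      using P unfolding definable_def by blast
    let ?F = "insert \<phi> ((\<lambda>i. Eq 0 (Suc i)) ` {..<n})"
    have F: "rcset (acset ?F) = ?F" by (intro acset_inverse) simp
    have "fml L n (All (Disj (acset ?F)))" using \<phi>(1) F by (auto intro!: fml.intros)
    moreover have "sat M a (All (Disj (acset ?F))) \<longleftrightarrow> (\<forall>c \<in> univ M - set a. P M (c # a))"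
      if M: "M \<in> Mod L T" "condition (univ M) a" "length a = n" for M a
    proof -
      have "sat M (c # a) (Disj (acset ?F)) \<longleftrightarrow> c \<in> set a \<or> sat M (c # a) \<phi>" for c
        using F M(3) by (auto simp: in_set_conv_nth)
      moreover have "sat M (c # a) \<phi> \<longleftrightarrow> P M (c # a)" if "c \<in> univ M - set a" for c
        using \<phi>(2)[OF M(1), of "c # a"] M that by (auto simp: condition_def)
      ultimately show ?thesis by auto
    qed
    ultimately show ?thesis unfolding definable_def by blast
  qed
  show "definable L T n (\<lambda>_ _. True)"
    unfolding definable_def by (intro exI[of _ "Conj (acset {})"]) (auto intro: fml.intros)
qed

text \<open>Position \<open>i\<close> of the enumeration is variable \<open>n - 1 - i\<close>, as conditions list the latest value first.\<close>

lemma definable_rel: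
  assumes "R \<in> syms L" "length bs = arity L R" "set bs \<subseteq> {..<n}"
  shows "definable L T n (\<lambda>M a. map (\<lambda>i. rev a ! i) bs \<in> intp M R)"
  unfolding definable_def
proof (intro exI[of _ "Rel R (map (\<lambda>i. n - 1 - i) bs)"] conjI ballI allI impI)
  have "set (map (\<lambda>i. n - 1 - i) bs) \<subseteq> {..<n}" using assms(3) by auto
  then show "fml L n (Rel R (map (\<lambda>i. n - 1 - i) bs))" using assms(1,2) by (intro fml.intros) simp_all
  fix M :: "('a, nat) struct" and a :: "nat list" assume "length a = n"
  then have "map (\<lambda>i. a ! (n - 1 - i)) bs = map (\<lambda>i. rev a ! i) bs"
    using assms(3) by (auto simp: rev_nth)
  then show "sat M a (Rel R (map (\<lambda>i. n - 1 - i) bs)) \<longleftrightarrow> map (\<lambda>i. rev a ! i) bs \<in> intp M R"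
    unfolding sat.simps map_map comp_def by (simp only:)
qed

text \<open>The generators of the Borel structure on the space of models become good sets: the size of the universe
  does not depend on the enumeration, and an atomic fact about \<open>pull L M k\<close> depends only on finitely many
  values of \<open>k\<close>.\<close>

lemma pull_measurable:
  assumes T: "is_theory L T"
  shows "(\<lambda>(M, k). pull L M k) \<in> Mod.goodM L T \<rightarrow>\<^sub>M ModB L T"
  unfolding ModB_def
proof (rule measurable_measure_of[OF ModB_gen_sub])
  have pull: "pull L M k \<in> Mod L T" if "(M, k) \<in> Mod.W L T" for M k
    using pull_Isos[OF T, of M k] that by (auto simp: Mod.W_def Isos_def)
  then show "(\<lambda>(M, k). pull L M k) \<in> space (Mod.goodM L T) \<rightarrow> Mod L T" by auto
  fix B assume "B \<in> {{M \<in> Mod L T. infinite (univ M) \<or> n \<le> card (univ M)} | n. True} \<union>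
     {{M \<in> Mod L T. set as \<subseteq> univ M \<and> as \<in> intp M R} | R as. R \<in> syms L \<and> length as = arity L R}"
  then consider n where "B = {M \<in> Mod L T. infinite (univ M) \<or> n \<le> card (univ M)}"
    | R as where "B = {M \<in> Mod L T. set as \<subseteq> univ M \<and> as \<in> intp M R}" "R \<in> syms L" "length as = arity L R"
    by blast
  then show "(\<lambda>(M, k). pull L M k) -` B \<inter> space (Mod.goodM L T) \<in> sets (Mod.goodM L T)"
  proof cases
    case (1 n)
    have "(\<lambda>(M, k). pull L M k) -` B \<inter> space (Mod.goodM L T) = {(M, k). {..<n} \<subseteq> univ M} \<inter> Mod.W L T"
    proof (rule set_eqI)
      fix x :: "('a, nat) struct \<times> (nat \<Rightarrow> nat)"
      obtain M k where x: "x = (M, k)" by (cases x)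
      have "pull L M k \<in> B \<longleftrightarrow> {..<n} \<subseteq> univ M" if Mk: "(M, k) \<in> Mod.W L T"
        using pull[OF Mk] initial_card[OF Mod_initial[OF pull[OF Mk]], of n] unfolding 1 by simp
      then show "x \<in> (\<lambda>(M, k). pull L M k) -` B \<inter> space (Mod.goodM L T) \<longleftrightarrow> x \<in> {(M, k). {..<n} \<subseteq> univ M} \<inter> Mod.W L T"
        unfolding x by auto
    qed
    then show ?thesis using Mod.good_W[OF Mod.good_const[OF Mod.D_lessThan]] by simp
  next
    case (2 R as)
    let ?m = "fold (max \<circ> Suc) as 0"
    have m: "set as \<subseteq> {..<?m}"
      using initial_subset_lessThan[of "{..<?m}" as] by (auto simp: initial_def)
    let ?S = "{(M, k). map k as \<in> intp M R}"
    have "Mod.good L T {(M, k). {..<?m} \<subseteq> univ M \<and> (M, k) \<in> ?S}"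
    proof (rule Mod.good_prefix)
      fix n assume n: "?m \<le> n"
      then have sub: "set as \<subseteq> {..<n}" using m by auto
      show "definable L T n (\<lambda>M a. map (\<lambda>i. rev a ! i) as \<in> intp M R)"
        by (rule definable_rel[OF 2(2,3) sub])
      fix M :: "('a, nat) struct" and k
      have "map (\<lambda>i. rev (initial_part k n) ! i) as = map k as" using sub by (auto simp: initial_part_nth)
      then show "(M, k) \<in> ?S \<longleftrightarrow> map (\<lambda>i. rev (initial_part k n) ! i) as \<in> intp M R"
        unfolding mem_Collect_eq prod.case by (simp only:)
    qed
    from Mod.good_W[OF this]
    have "{(M, k). {..<?m} \<subseteq> univ M \<and> (M, k) \<in> ?S} \<inter> Mod.W L T \<in> sets (Mod.goodM L T)" .
    also have "{(M, k). {..<?m} \<subseteq> univ M \<and> (M, k) \<in> ?S} \<inter> Mod.W L T =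
      (\<lambda>(M, k). pull L M k) -` B \<inter> space (Mod.goodM L T)"
      using pull initial_subset_lessThan[OF Mod_initial, of _ L T as] 2 unfolding 2(1)
      by (auto simp: Mod.W_def) (auto simp: pull_def)
    finally show ?thesis .
  qed
qed

lemma distinct_iff_nth_less: "distinct a \<longleftrightarrow> (\<forall>i j. i < j \<longrightarrow> j < length a \<longrightarrow> a ! i \<noteq> a ! j)"
proof
  assume *: "\<forall>i j. i < j \<longrightarrow> j < length a \<longrightarrow> a ! i \<noteq> a ! j"
  show "distinct a"
    unfolding distinct_conv_nth
  proof (intro allI impI)
    fix i j assume "i < length a" "j < length a" "i \<noteq> j"
    then show "a ! i \<noteq> a ! j" using *[rule_format, of i j] *[rule_format, of j i] by (cases "i < j") auto
  qed
qed (simp add: nth_eq_iff_index_eq)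

text \<open>Let \<open>p\<close> be a tuple of indices. For all enumerations \<open>k\<close> of \<open>M\<close> that extend a condition \<open>a\<close> whose length
  exceeds the entries of \<open>p\<close>, the isomorphism \<open>k\<close> turns \<open>\<rho> (pull L M k) p\<close> into \<open>\<rho> M c\<close>, where \<open>c\<close> consists
  of the entries of \<open>a\<close> with indices \<open>p\<close>. So \<open>\<rho> M c\<close> holds iff \<open>\<rho> (pull L M k) p\<close> holds for comeagerly many
  such \<open>k\<close>, and this is definable from \<open>a\<close>, since the set of all \<open>N\<close> with \<open>\<rho> N p\<close> is Borel. The formula for
  \<open>\<rho>\<close> states that \<open>c\<close> arises in this way from some \<open>p\<close> and \<open>a\<close> for which the formula for \<open>p\<close> holds;
  repetitions in \<open>c\<close> are taken care of by those in \<open>p\<close>.\<close>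

theorem Lopez_Escobar:
  fixes \<rho> :: "('r, nat) struct \<Rightarrow> nat list \<Rightarrow> bool"
  assumes T: "is_theory L T"
    and borel: "\<And>c. length c = r \<Longrightarrow> {M \<in> Mod L T. set c \<subseteq> univ M \<and> \<rho> M c} \<in> sets (ModB L T)"
    and inv: "\<And>M g N c. (M, g, N) \<in> Isos L T \<Longrightarrow> set c \<subseteq> univ M \<Longrightarrow> length c = r \<Longrightarrow> \<rho> M c \<Longrightarrow> \<rho> N (map g c)"
  shows "\<exists>\<phi>. fml L r \<phi> \<and> (\<forall>M \<in> Mod L T. \<forall>c. length c = r \<longrightarrow> set c \<subseteq> univ M \<longrightarrow> (sat M c \<phi> \<longleftrightarrow> \<rho> M c))"
proof -
  define I where "I = {(n :: nat, p :: nat list). length p = r \<and> set p \<subseteq> {..<n}}"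
  have "\<exists>\<phi>. fml L n \<phi> \<and> (\<forall>M \<in> Mod L T. \<forall>a. condition (univ M) a \<longrightarrow> length a = n \<longrightarrow>
      (sat M a \<phi> \<longleftrightarrow> \<rho> M (map (\<lambda>i. rev a ! i) p)))" if np: "(n, p) \<in> I" for n and p :: "nat list"
  proof -
    let ?B = "{N \<in> Mod L T. set p \<subseteq> univ N \<and> \<rho> N p}"
    let ?S = "(\<lambda>(M, k). pull L M k) -` ?B \<inter> space (Mod.goodM L T)"
    have p: "length p = r" "set p \<subseteq> {..<n}" using np by (auto simp: I_def)
    have "?S \<in> sets (Mod.goodM L T)" by (rule measurable_sets[OF pull_measurable[OF T] borel[OF p(1)]])
    then have "Mod.good L T ?S" unfolding Mod.sets_goodM by blast
    then have "definable L T n (\<lambda>M a. comeager (univ M) a {k. (M, k) \<in> ?S})" unfolding Mod.good_def by blast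
    then have "definable L T n (\<lambda>M a. \<rho> M (map (\<lambda>i. rev a ! i) p))"
    proof (rule Mod.D_cong)
      fix M :: "('r, nat) struct" and a assume M: "M \<in> Mod L T" "condition (univ M) a" "length a = n"
      have "(M, k) \<in> ?S \<longleftrightarrow> \<rho> M (map (\<lambda>i. rev a ! i) p)" if k: "k \<in> enum_of (univ M) a" for k
      proof -
        note kS = enum_ofD(1)[OF k]
        have iso: "(pull L M k, k, M) \<in> Isos L T" by (rule pull_Isos[OF T M(1) kS])
        have sub: "set p \<subseteq> univ M" using p(2) enum_ofD(3)[OF k] M(3) by auto
        have "map k p = map (\<lambda>i. rev a ! i) p"
          using p(2) enum_ofD(2)[OF k] M(3) initial_part_nth[of _ n k] by auto
        then have eq: "\<rho> M (map k p) \<longleftrightarrow> \<rho> M (map (\<lambda>i. rev a ! i) p)" by (simp only:)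
        have "\<rho> (pull L M k) p \<longleftrightarrow> \<rho> M (map k p)"
        proof
          assume "\<rho> (pull L M k) p"
          then show "\<rho> M (map k p)" using inv[OF iso, of p] sub p(1) by simp
        next
          assume "\<rho> M (map k p)"
          moreover have bij: "bij_betw k (univ M) (univ M)" using kS by (simp add: Sym_def)
          moreover have "set (map k p) \<subseteq> univ M" using bij sub by (auto simp: bij_betw_def)
          ultimately have "\<rho> (pull L M k) (map (restrict (inv_into (univ M) k) (univ M)) (map k p))"
            using inv[OF Isos_inv[OF iso], of "map k p"] p(1) by simp
          moreover have "restrict (inv_into (univ M) k) (univ M) (k x) = x" if "x \<in> set p" for x
            using sub bij that bij_betwE[OF bij] by (auto simp: bij_betw_def)
          then have "map (restrict (inv_into (univ M) k) (univ M)) (map k p) = p"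
            unfolding map_map by (intro map_idI) (simp only: comp_apply)
          ultimately show "\<rho> (pull L M k) p" by simp
        qed
        moreover have "(M, k) \<in> ?S \<longleftrightarrow> \<rho> (pull L M k) p"
          using M(1) kS sub iso by (auto simp: Mod.W_def Isos_def)
        ultimately show ?thesis unfolding eq[symmetric] by simp
      qed
      then show "comeager (univ M) a {k. (M, k) \<in> ?S} \<longleftrightarrow> \<rho> M (map (\<lambda>i. rev a ! i) p)"
        using comeager_nonempty[OF Mod_initial[OF M(1)] M(2), of "{k. (M, k) \<in> ?S}"]
          comeager_all[of "univ M" a "{k. (M, k) \<in> ?S}"] by blast
    qed
    then show ?thesis by (simp add: definable_def)
  qed
  then have "\<forall>x. \<exists>\<phi>. x \<in> I \<longrightarrow> fml L (fst x) \<phi> \<and> (\<forall>M \<in> Mod L T. \<forall>a. condition (univ M) a \<longrightarrow> length a = fst x \<longrightarrow>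
      (sat M a \<phi> \<longleftrightarrow> \<rho> M (map (\<lambda>i. rev a ! i) (snd x))))" by auto
  from choice[OF this] obtain \<phi> where \<phi>': "\<forall>x. x \<in> I \<longrightarrow> fml L (fst x) (\<phi> x) \<and>
      (\<forall>M \<in> Mod L T. \<forall>a. condition (univ M) a \<longrightarrow> length a = fst x \<longrightarrow>
        (sat M a (\<phi> x) \<longleftrightarrow> \<rho> M (map (\<lambda>i. rev a ! i) (snd x))))" by (rule exE)
  have \<phi>: "(n, p) \<in> I \<Longrightarrow> fml L n (\<phi> (n, p))"
    "(n, p) \<in> I \<Longrightarrow> M \<in> Mod L T \<Longrightarrow> condition (univ M) a \<Longrightarrow> length a = n \<Longrightarrow>
      sat M a (\<phi> (n, p)) \<longleftrightarrow> \<rho> M (map (\<lambda>i. rev a ! i) p)" for n p M a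
    using \<phi>'[rule_format, of "(n, p)"] by simp_all
  \<comment> \<open>the variables below \<open>n\<close> stand for \<open>a\<close>, and \<open>n + j\<close> for the entry \<open>j\<close> of \<open>c\<close>\<close>
  define F where "F = (\<lambda>(n, p). {Neg (Eq i j) | i j. i < j \<and> j < n} \<union> (\<lambda>j. Eq (n + j) (n - 1 - p ! j)) ` {..<r} \<union> {\<phi> (n, p)})"
  have "finite {Neg (Eq i j) :: 'r fm | i j. i < j \<and> j < n}" for n
  proof -
    have "{Neg (Eq i j) :: 'r fm | i j. i < j \<and> j < n} \<subseteq> (\<lambda>(i, j). Neg (Eq i j)) ` ({..<n} \<times> {..<n})" by force
    then show ?thesis by (rule finite_subset) simp
  qed
  then have cF: "rcset (acset (F x)) = F x" for x
    by (intro acset_inverse) (auto simp: F_def case_prod_unfold intro!: countable_finite)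
  let ?\<Psi> = "\<lambda>x. (Ex ^^ fst x) (Conj (acset (F x)))"
  let ?\<Phi> = "Disj (acset (?\<Psi> ` I))"
  have c\<Phi>: "rcset (acset (?\<Psi> ` I)) = ?\<Psi> ` I" by (intro acset_inverse) simp
  have "fml L r ?\<Phi>"
  proof (rule fml.intros, unfold c\<Phi>, intro ballI)
    fix \<psi> assume "\<psi> \<in> ?\<Psi> ` I"
    then obtain n p where np: "(n, p) \<in> I" "\<psi> = ?\<Psi> (n, p)" by auto
    have "fml L (n + r) (Conj (acset (F (n, p))))"
    proof (rule fml.intros, unfold cF, intro ballI)
      fix \<xi> assume "\<xi> \<in> F (n, p)"
      then consider i j where "\<xi> = Neg (Eq i j)" "i < j" "j < n" 
        | j where "\<xi> = Eq (n + j) (n - 1 - p ! j)" "j < r" | "\<xi> = \<phi> (n, p)"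
        unfolding F_def by auto
      then show "fml L (n + r) \<xi>"
      proof cases
        case 2
        then have "p ! j \<in> set p" using np(1) by (simp add: I_def)
        then have "n > 0" using np(1) by (auto simp: I_def)
        then show ?thesis using 2 by (auto intro!: fml.intros)
      qed (use fml_mono[OF \<phi>(1)[OF np(1)], of "n + r"] in \<open>auto intro!: fml.intros\<close>)
    qed
    then show "fml L r \<psi>" unfolding np(2) by (simp add: fml_Exs)
  qed
  moreover have "sat M c ?\<Phi> \<longleftrightarrow> \<rho> M c" if M: "M \<in> Mod L T" "length c = r" "set c \<subseteq> univ M" for M c
  proof -
    have F_iff: "sat M (a @ c) (Conj (acset (F (n, p)))) \<longleftrightarrow> distinct a \<and> c = map (\<lambda>i. rev a ! i) p \<and> sat M a (\<phi> (n, p))"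
      if np: "(n, p) \<in> I" and a: "length a = n" for n p a
    proof -
      have "(\<forall>\<psi> \<in> {Neg (Eq i j) | i j. i < j \<and> j < n}. sat M (a @ c) \<psi>) \<longleftrightarrow> distinct a"
      proof -
        have "(\<forall>\<psi> \<in> {Neg (Eq i j) | i j. i < j \<and> j < n}. sat M (a @ c) \<psi>) \<longleftrightarrow> (\<forall>i j. i < j \<longrightarrow> j < n \<longrightarrow> a ! i \<noteq> a ! j)"
        proof -
          have "sat M (a @ c) (Neg (Eq i j)) \<longleftrightarrow> a ! i \<noteq> a ! j" if "i < j" "j < n" for i j
            using that a by (simp add: nth_append)
          then show ?thesis by blast
        qed
        also have "\<dots> \<longleftrightarrow> distinct a" using a distinct_iff_nth_less by blast
        finally show ?thesis .
      qed
      moreover have "(\<forall>\<psi> \<in> (\<lambda>j. Eq (n + j) (n - 1 - p ! j)) ` {..<r}. sat M (a @ c) \<psi>) \<longleftrightarrow> c = map (\<lambda>i. rev a ! i) p"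
      proof -
        have p: "p ! j < n" if "j < r" for j
        proof -
          have "p ! j \<in> set p" using np that by (simp add: I_def)
          then show ?thesis using np by (auto simp: I_def)
        qed
        have "sat M (a @ c) (Eq (n + j) (n - 1 - p ! j)) \<longleftrightarrow> c ! j = rev a ! (p ! j)" if "j < r" for j
          using a p[OF that] by (simp add: nth_append rev_nth)
        moreover have "c = map (\<lambda>i. rev a ! i) p \<longleftrightarrow> (\<forall>j<r. c ! j = rev a ! (p ! j))"
          using M(2) np by (auto simp: list_eq_iff_nth_eq I_def)
        ultimately show ?thesis by auto
      qed
      moreover have "sat M (a @ c) (\<phi> (n, p)) \<longleftrightarrow> sat M a (\<phi> (n, p))"
        by (rule sat_cong[OF \<phi>(1)[OF np]]) (use a in \<open>simp add: nth_append\<close>)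
      moreover have "(\<forall>\<psi> \<in> {\<phi> (n, p)}. sat M (a @ c) \<psi>) \<longleftrightarrow> sat M (a @ c) (\<phi> (n, p))" by simp
      ultimately show ?thesis unfolding sat_Conj cF unfolding F_def prod.case ball_Un by (simp only: conj_assoc)
    qed
    have "sat M c ?\<Phi> \<longleftrightarrow> (\<exists>(n, p) \<in> I. \<exists>a. length a = n \<and> set a \<subseteq> univ M \<and> sat M (a @ c) (Conj (acset (F (n, p)))))"
      unfolding sat_Disj c\<Phi> by (simp only: bex_simps sat_Exs case_prod_unfold prod.collapse)
    also have "\<dots> \<longleftrightarrow> (\<exists>(n, p) \<in> I. \<exists>a. length a = n \<and> condition (univ M) a \<and> c = map (\<lambda>i. rev a ! i) p \<and> \<rho> M c)"
    proof -
      have "(length a = n \<and> set a \<subseteq> univ M \<and> sat M (a @ c) (Conj (acset (F (n, p))))) \<longleftrightarrow>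
        (length a = n \<and> condition (univ M) a \<and> c = map (\<lambda>i. rev a ! i) p \<and> \<rho> M c)" if "(n, p) \<in> I" for n p a
        using F_iff[OF that, of a] \<phi>(2)[OF that M(1), of a] unfolding condition_def by blast
      then show ?thesis by blast
    qed
    also have "\<dots> \<longleftrightarrow> \<rho> M c"
    proof
      assume \<rho>: "\<rho> M c"
      define a where "a = rev (remdups c)"
      have "\<forall>x \<in> set c. \<exists>i. i < length a \<and> rev a ! i = x"
        by (simp add: a_def) (metis in_set_conv_nth set_remdups)
      then obtain ix where ix: "\<And>x. x \<in> set c \<Longrightarrow> ix x < length a \<and> rev a ! ix x = x" by metis
      have "(length a, map ix c) \<in> I" using M(2) ix by (auto simp: I_def)
      moreover have "condition (univ M) a" using M(3) by (simp add: a_def condition_def)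
      moreover have "c = map (\<lambda>i. rev a ! i) (map ix c)" using ix by (auto intro: map_idI[symmetric])
      ultimately show "\<exists>(n, p) \<in> I. \<exists>a. length a = n \<and> condition (univ M) a \<and> c = map (\<lambda>i. rev a ! i) p \<and> \<rho> M c"
        using \<rho> by blast
    qed auto
    finally show ?thesis .
  qed
  ultimately show ?thesis by blast
qed

section \<open>Derivations relative to the equivalence axioms\<close>

lemma cedent_insert: "fml L n \<phi> \<Longrightarrow> cedent L n \<Gamma> \<Longrightarrow> cedent L n (insert \<phi> \<Gamma>)"
  and cedent_empty: "cedent L n {}"
  by (simp_all add: cedent_def)

lemma rcset_pair: "rcset (cinsert a (csingle b)) = {a, b}"
  by (simp add: cinsert.rep_eq bot_cset.rep_eq)

lemma fml_And: "fml L n \<phi> \<Longrightarrow> fml L n \<psi> \<Longrightarrow> fml L n (And \<phi> \<psi>)"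
  and fml_Imp: "fml L n \<phi> \<Longrightarrow> fml L n \<psi> \<Longrightarrow> fml L n (Imp \<phi> \<psi>)"
  by (auto intro!: fml.intros simp: rcset_pair)

lemma sat_And: "sat M as (And \<phi> \<psi>) \<longleftrightarrow> sat M as \<phi> \<and> sat M as \<psi>"
  and sat_Imp: "sat M as (Imp \<phi> \<psi>) \<longleftrightarrow> (sat M as \<phi> \<longrightarrow> sat M as \<psi>)"
  by (auto simp: rcset_pair)

lemma prov_id: 
  assumes "\<phi> \<in> \<Gamma>" "\<phi> \<in> \<Delta>" "cedent L n \<Gamma>" "cedent L n \<Delta>"
  shows "prov L T n \<Gamma> \<Delta>"
  by (rule prov.Weak[OF prov.Init[of L n \<phi>]]) (use assms in \<open>auto simp: cedent_def\<close>)

lemma prov_AndR: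
  assumes "prov L T n \<Gamma> (insert \<phi> \<Delta>)" "prov L T n \<Gamma> (insert \<psi> \<Delta>)"
    "cedent L n \<Gamma>" "cedent L n \<Delta>" "fml L n \<phi>" "fml L n \<psi>"
  shows "prov L T n \<Gamma> (insert (And \<phi> \<psi>) \<Delta>)"
  by (rule prov.ConjR[OF assms(3,4) fml_And[OF assms(5,6)]]) (use assms(1,2) in \<open>auto simp: rcset_pair\<close>)

lemma prov_AndL:
  assumes "prov L T n (insert \<phi> (insert \<psi> \<Gamma>)) \<Delta>" "fml L n \<phi>" "fml L n \<psi>"
  shows "prov L T n (insert (And \<phi> \<psi>) \<Gamma>) \<Delta>"
proof -
  have "prov L T n (insert (And \<phi> \<psi>) (insert \<psi> \<Gamma>)) \<Delta>"
    by (rule prov.ConjL[of \<phi>]) (use assms fml_And in \<open>auto simp: rcset_pair\<close>)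
  then have "prov L T n (insert \<psi> (insert (And \<phi> \<psi>) \<Gamma>)) \<Delta>" by (simp add: insert_commute)
  then have "prov L T n (insert (And \<phi> \<psi>) (insert (And \<phi> \<psi>) \<Gamma>)) \<Delta>"
    by (rule prov.ConjL[of \<psi>, rotated -1]) (use assms fml_And in \<open>auto simp: rcset_pair\<close>)
  then show ?thesis by simp
qed

lemma prov_ImpR:
  assumes "prov L T n (insert \<phi> \<Gamma>) (insert \<psi> \<Delta>)" "fml L n \<phi>" "fml L n \<psi>"
  shows "prov L T n \<Gamma> (insert (Imp \<phi> \<psi>) \<Delta>)"
proof -
  have "prov L T n \<Gamma> (insert (Neg \<phi>) (insert \<psi> \<Delta>))" by (rule prov.NegR[OF assms(1)])
  then have "prov L T n \<Gamma> (insert (Imp \<phi> \<psi>) (insert \<psi> \<Delta>))"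
    by (rule prov.DisjR[of "Neg \<phi>", rotated -1]) (use assms fml_Imp in \<open>auto simp: rcset_pair\<close>)
  then have "prov L T n \<Gamma> (insert \<psi> (insert (Imp \<phi> \<psi>) \<Delta>))" by (simp add: insert_commute)
  then have "prov L T n \<Gamma> (insert (Imp \<phi> \<psi>) (insert (Imp \<phi> \<psi>) \<Delta>))"
    by (rule prov.DisjR[of \<psi>, rotated -1]) (use assms fml_Imp in \<open>auto simp: rcset_pair\<close>)
  then show ?thesis by simp
qed

lemma prov_ImpL:
  assumes "prov L T n \<Gamma> (insert \<phi> \<Delta>)" "prov L T n (insert \<psi> \<Gamma>) \<Delta>"
    "cedent L n \<Gamma>" "cedent L n \<Delta>" "fml L n \<phi>" "fml L n \<psi>"
  shows "prov L T n (insert (Imp \<phi> \<psi>) \<Gamma>) \<Delta>"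
  by (rule prov.DisjL[OF assms(3,4) fml_Imp[OF assms(5,6)]])
    (use prov.NegL[OF assms(1)] assms(2) in \<open>auto simp: rcset_pair\<close>)

lemma inst_ren_Suc: "inst 0 (ren (case_nat 0 (\<lambda>k. Suc (Suc k))) \<phi>) = \<phi>"
proof -
  have "(\<lambda>k. case_nat 0 (\<lambda>k. k) (case_nat 0 (\<lambda>k. Suc (Suc k)) k)) = (\<lambda>k. k)"
    by (auto split: nat.split)
  moreover have "ren (\<lambda>k. k) \<phi> = \<phi>"
  proof (induction \<phi>)
    case (Conj F)
    then have "ren (\<lambda>k. k) ` rcset F = (\<lambda>x. x) ` rcset F" by (intro image_cong) auto
    then show ?case by (simp add: rcset_inject[symmetric] cimage.rep_eq)
  next
    case (Disj F)
    then have "ren (\<lambda>k. k) ` rcset F = (\<lambda>x. x) ` rcset F" by (intro image_cong) auto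
    then show ?case by (simp add: rcset_inject[symmetric] cimage.rep_eq)
  next
    case (All \<phi>)
    have "case_nat 0 Suc = (\<lambda>k. k)" by (auto split: nat.split)
    then show ?case using All by simp
  next
    case (Ex \<phi>)
    have "case_nat 0 Suc = (\<lambda>k. k)" by (auto split: nat.split)
    then show ?case using Ex by simp
  qed simp_all
  ultimately show ?thesis unfolding ren_ren by simp
qed

lemma ren_closed: "fml L 0 \<theta> \<Longrightarrow> ren \<rho> \<theta> = \<theta>"
  by (rule ren_cong_id) auto

text \<open>Derivations under universal quantifiers: the bound variable is reused as the instance, so that no
  renaming survives. The closed side formula \<open>\<theta>\<close> is not affected by the change of context.\<close>

lemma prov_All_mono:
  assumes "prov L T (Suc m) {\<xi>, \<theta>} {\<psi>}" "fml L 0 \<theta>" "fml L (Suc m) \<xi>"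
  shows "prov L T m {All \<xi>, \<theta>} {All \<psi>}"
proof -
  have \<theta>: "ren \<rho> \<theta> = \<theta>" "fml L k \<theta>" for \<rho> k using ren_closed[OF assms(2)] fml_mono[OF assms(2)] by auto
  let ?\<xi> = "ren (case_nat 0 (\<lambda>k. Suc (Suc k))) \<xi>"
  have "fml L (Suc (Suc m)) ?\<xi>" by (rule fml_ren[OF assms(3)]) (auto split: nat.split)
  then have "fml L (Suc m) (All ?\<xi>)" by (rule fml.intros)
  moreover have "prov L T (Suc m) (insert (inst 0 ?\<xi>) {\<theta>}) {\<psi>}"
    unfolding inst_ren_Suc by (rule assms(1))
  ultimately have "prov L T (Suc m) (insert (All ?\<xi>) {\<theta>}) {\<psi>}"
    by (rule prov.AllL[OF zero_less_Suc])
  moreover have "ren Suc ` {All \<xi>, \<theta>} = insert (All ?\<xi>) {\<theta>}" by (simp add: \<theta>)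
  ultimately have *: "prov L T (Suc m) (ren Suc ` {All \<xi>, \<theta>}) (insert \<psi> (ren Suc ` {}))" by simp
  have "cedent L m {All \<xi>, \<theta>}" using \<theta>(2) assms(3) by (auto simp: cedent_def intro: fml.intros)
  from prov.AllR[OF this cedent_empty *] show ?thesis by simp
qed

lemma prov_Alls_mono:
  "prov L T (n + m) {\<xi>, \<theta>} {\<psi>} \<Longrightarrow> fml L 0 \<theta> \<Longrightarrow> fml L (n + m) \<xi> \<Longrightarrow> prov L T m {Alls n \<xi>, \<theta>} {Alls n \<psi>}"
proof (induction n arbitrary: m)
  case (Suc n)
  then have "prov L T (Suc m) {Alls n \<xi>, \<theta>} {Alls n \<psi>}" "fml L (Suc m) (Alls n \<xi>)"
    using fml_Alls[of L n "Suc m" \<xi>] by auto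
  then show ?case using prov_All_mono[OF _ Suc.prems(2)] by simp
qed simp

lemma prov_Alls_intro:
  "prov L T (n + m) {} {\<psi>, \<theta>} \<Longrightarrow> fml L 0 \<theta> \<Longrightarrow> prov L T m {} {Alls n \<psi>, \<theta>}"
proof (induction n arbitrary: m)
  case (Suc n)
  have \<theta>: "ren \<rho> \<theta> = \<theta>" "fml L k \<theta>" for \<rho> k using ren_closed[OF Suc.prems(2)] fml_mono[OF Suc.prems(2)] by auto
  have "prov L T (Suc m) {} {Alls n \<psi>, \<theta>}" using Suc.IH[of "Suc m"] Suc.prems by simp
  then have "prov L T (Suc m) (ren Suc ` {}) (insert (Alls n \<psi>) (ren Suc ` {\<theta>}))" by (simp add: \<theta>)
  from prov.AllR[OF cedent_empty _ this] show ?case using \<theta>(2) by (simp add: cedent_def)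
qed simp

text \<open>The proof is by a cut on \<open>\<theta>\<close>. If \<open>\<theta>\<close> is in the succedent, the implication is derivable because its premise
  \<open>\<xi>'\<close> implies \<open>\<theta>\<close>. If \<open>\<theta>\<close> is in the antecedent, it yields the implication from \<open>\<xi>\<close> to \<open>\<psi>\<close>, from which the
  one from \<open>\<xi>'\<close> to \<open>\<psi>'\<close> follows.\<close>

lemma proves_relativized:
  assumes \<theta>: "\<theta> = Conj F" "fml L 0 \<theta>" and mem: "Alls n (Imp \<xi> \<psi>) \<in> rcset F"
    and fml: "fml L n \<xi>" "fml L n \<psi>" "fml L n \<xi>'" "fml L n \<psi>'"
    and \<xi>': "\<And>\<Gamma> \<Delta>. cedent L n \<Gamma> \<Longrightarrow> cedent L n \<Delta> \<Longrightarrow> prov L T n (insert \<xi>' \<Gamma>) (insert \<xi> \<Delta>)"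
      "\<And>\<Gamma> \<Delta>. cedent L n \<Gamma> \<Longrightarrow> cedent L n \<Delta> \<Longrightarrow> prov L T n (insert \<xi>' \<Gamma>) (insert \<theta> \<Delta>)"
    and \<psi>': "\<And>\<Gamma> \<Delta>. cedent L n \<Gamma> \<Longrightarrow> cedent L n \<Delta> \<Longrightarrow> prov L T n (insert \<psi> (insert \<theta> \<Gamma>)) (insert \<psi>' \<Delta>)"
  shows "proves L T (Alls n (Imp \<xi>' \<psi>'))"
proof -
  have \<theta>n: "fml L k \<theta>" for k using fml_mono[OF \<theta>(2)] by simp
  let ?goal = "Alls n (Imp \<xi>' \<psi>')"
  have fgoal: "fml L 0 ?goal" by (rule fml_Alls) (simp only: add_0_right fml_Imp fml)
  have c: "cedent L n {\<theta>}" "cedent L n {\<psi>'}" "cedent L n {\<xi>', \<theta>}" "cedent L n {\<theta>, \<psi>'}"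
    using fml \<theta>n by (auto simp: cedent_def)
  have "prov L T n (insert \<xi>' {}) (insert \<theta> {\<psi>'})" by (rule \<xi>'(2)[OF cedent_empty c(2)])
  then have "prov L T n (insert \<xi>' {}) (insert \<psi>' {\<theta>})" by (simp add: insert_commute)
  then have "prov L T n {} {Imp \<xi>' \<psi>', \<theta>}" by (rule prov_ImpR) (use fml in simp_all)
  then have 1: "prov L T 0 {} {?goal, \<theta>}" using prov_Alls_intro[of L T n 0] \<theta>(2) by simp
  have "prov L T n (insert (Imp \<xi> \<psi>) {\<xi>', \<theta>}) {\<psi>'}"
  proof (rule prov_ImpL)
    show "prov L T n {\<xi>', \<theta>} {\<xi>, \<psi>'}" using \<xi>'(1)[OF c(1,2)] .
    have "prov L T n (insert \<psi> (insert \<theta> {\<xi>'})) (insert \<psi>' {})"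
      using fml by (intro \<psi>') (auto simp: cedent_def)
    then show "prov L T n {\<psi>, \<xi>', \<theta>} {\<psi>'}" by (simp add: insert_commute)
  qed (use c fml in auto)
  then have "prov L T n (insert \<xi>' {Imp \<xi> \<psi>, \<theta>}) (insert \<psi>' {})" by (simp add: insert_commute)
  then have "prov L T n {Imp \<xi> \<psi>, \<theta>} {Imp \<xi>' \<psi>'}" by (rule prov_ImpR) (use fml in simp_all)
  then have "prov L T (n + 0) {Imp \<xi> \<psi>, \<theta>} {Imp \<xi>' \<psi>'}" by (simp only: add_0_right)
  from prov_Alls_mono[OF this \<theta>(2)]
  have "prov L T 0 (insert (Alls n (Imp \<xi> \<psi>)) {\<theta>}) {?goal}"
    by (simp only: add_0_right fml_Imp fml)
  then have "prov L T 0 (insert (Conj F) {\<theta>}) {?goal}"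
    by (rule prov.ConjL[OF mem, rotated]) (use \<theta> in simp)
  then have 2: "prov L T 0 (insert \<theta> {}) {?goal}" unfolding \<theta>(1) by simp
  from 1 have "prov L T 0 {} (insert \<theta> {?goal})" by (simp add: insert_commute)
  from prov.Cut[OF this 2] show ?thesis by (simp add: proves_def)
qed

text \<open>The sentences whose provability makes \<open>A\<close> an imaginary sort.\<close>

definition axioms_of :: "'r sort_data \<Rightarrow> 'r fm set" where
  "axioms_of A =
    (\<Union>i \<in> idx A. \<Union>j \<in> idx A. {let n = vars A i + vars A j; x = [0..<vars A i]; y = [vars A i..<n] in
      Alls n (Imp (app (eps A i j) (x @ y)) (And (app (alpha A i) x) (app (alpha A j) y)))}) \<union>
    (\<Union>i \<in> idx A. {let n = vars A i; x = [0..<n] in Alls n (Imp (app (alpha A i) x) (app (eps A i i) (x @ x)))}) \<union>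
    (\<Union>i \<in> idx A. \<Union>j \<in> idx A. {let n = vars A i + vars A j; x = [0..<vars A i]; y = [vars A i..<n] in
      Alls n (Imp (app (eps A i j) (x @ y)) (app (eps A j i) (y @ x)))}) \<union>
    (\<Union>i \<in> idx A. \<Union>j \<in> idx A. \<Union>k \<in> idx A. {let m = vars A i + vars A j; n = m + vars A k;
        x = [0..<vars A i]; y = [vars A i..<m]; z = [m..<n] in
      Alls n (Imp (And (app (eps A i j) (x @ y)) (app (eps A j k) (y @ z))) (app (eps A i k) (x @ z)))})"

definition equivalence_axiom :: "'r sort_data \<Rightarrow> 'r fm" where
  "equivalence_axiom A = Conj (acset (axioms_of A))"

definition relativize :: "'r sort_data \<Rightarrow> 'r sort_data" where
  "relativize A = A\<lparr>alpha := (\<lambda>i. And (alpha A i) (equivalence_axiom A)),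
     eps := (\<lambda>i j. And (eps A i j) (equivalence_axiom A))\<rparr>"

lemma rcset_axioms: "rcset (acset (axioms_of A)) = axioms_of A"
  by (intro acset_inverse) (simp add: axioms_of_def)

lemma app_And: "fml L 0 \<theta> \<Longrightarrow> app (And \<phi> \<theta>) vs = And (app \<phi> vs) \<theta>"
  by (simp add: ren_closed)

lemma fml_app:
  "fml L n \<phi> \<Longrightarrow> length vs = n \<Longrightarrow> set vs \<subseteq> {..<m} \<Longrightarrow> fml L m (app \<phi> vs)"
  by (rule fml_ren) (auto dest!: nth_mem)

lemma fml_equivalence_axiom:
  assumes \<alpha>: "\<And>i. i \<in> idx A \<Longrightarrow> fml L (vars A i) (alpha A i)"
    and \<epsilon>: "\<And>i j. i \<in> idx A \<Longrightarrow> j \<in> idx A \<Longrightarrow> fml L (vars A i + vars A j) (eps A i j)"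
  shows "fml L 0 (equivalence_axiom A)"
  unfolding equivalence_axiom_def
proof (rule fml.intros, unfold rcset_axioms, intro ballI)
  have fa: "fml L n (app (alpha A i) vs)" if "i \<in> idx A" "length vs = vars A i" "set vs \<subseteq> {..<n}" for i vs n
    using fml_app[OF \<alpha>] that by blast
  have fe: "fml L n (app (eps A i j) vs)"
    if "i \<in> idx A" "j \<in> idx A" "length vs = vars A i + vars A j" "set vs \<subseteq> {..<n}" for i j vs n
    using fml_app[OF \<epsilon>] that by blast
  have Alls: "fml L n \<phi> \<Longrightarrow> fml L 0 (Alls n \<phi>)" for n \<phi> using fml_Alls[of L n 0 \<phi>] by simp
  have "\<xi> \<in> axioms_of A \<Longrightarrow> fml L 0 \<xi>" for \<xi>
    unfolding axioms_of_def Let_def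
    by (elim UnE UN_E singletonE; simp only:; intro Alls fml_Imp fml_And; (rule fa fe; auto))
  then show "fml L 0 \<xi>" if "\<xi> \<in> axioms_of A" for \<xi> using that .
qed

lemma imaginary_sort_relativize:
  assumes \<alpha>: "\<And>i. i \<in> idx A \<Longrightarrow> fml L (vars A i) (alpha A i)"
    and \<epsilon>: "\<And>i j. i \<in> idx A \<Longrightarrow> j \<in> idx A \<Longrightarrow> fml L (vars A i + vars A j) (eps A i j)"
  shows "imaginary_sort L T (relativize A)"
proof -
  let ?\<theta> = "equivalence_axiom A"
  have \<theta>0: "fml L 0 ?\<theta>" by (rule fml_equivalence_axiom[OF assms])
  have \<theta>: "fml L k ?\<theta>" for k using fml_mono[OF \<theta>0] by simp
  have \<theta>_Conj: "?\<theta> = Conj (acset (axioms_of A))" by (simp add: equivalence_axiom_def)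
  have AndL1: "prov L T n (insert (And \<phi> ?\<theta>) \<Gamma>) (insert \<phi> \<Delta>)" 
    and AndL2: "prov L T n (insert (And \<phi> ?\<theta>) \<Gamma>) (insert ?\<theta> \<Delta>)" 
    and AndR: "prov L T n (insert \<phi> (insert ?\<theta> \<Gamma>)) (insert (And \<phi> ?\<theta>) \<Delta>)" 
    if c: "fml L n \<phi>" "cedent L n \<Gamma>" "cedent L n \<Delta>" for n \<phi> \<Gamma> \<Delta>
  proof -
    note ced = cedent_insert[OF c(1) cedent_insert[OF \<theta>[of n] c(2)]]
    show "prov L T n (insert (And \<phi> ?\<theta>) \<Gamma>) (insert \<phi> \<Delta>)"
      by (rule prov_AndL[OF prov_id[of \<phi>] c(1) \<theta>]) (use ced c cedent_insert in simp_all)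
    show "prov L T n (insert (And \<phi> ?\<theta>) \<Gamma>) (insert ?\<theta> \<Delta>)"
      by (rule prov_AndL[OF prov_id[of ?\<theta>] c(1) \<theta>]) (use ced \<theta>[of n] c cedent_insert in simp_all)
    show "prov L T n (insert \<phi> (insert ?\<theta> \<Gamma>)) (insert (And \<phi> ?\<theta>) \<Delta>)"
      by (rule prov_AndR[OF prov_id[of \<phi>] prov_id[of ?\<theta>]]) (use ced \<theta>[of n] c cedent_insert in simp_all)
  qed
  have rel: "proves L T (Alls n (Imp (And \<xi> ?\<theta>) (And \<psi> ?\<theta>)))"
    if "Alls n (Imp \<xi> \<psi>) \<in> axioms_of A" "fml L n \<xi>" "fml L n \<psi>" for n \<xi> \<psi>
  proof (rule proves_relativized[OF \<theta>_Conj \<theta>0])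
    show "Alls n (Imp \<xi> \<psi>) \<in> rcset (acset (axioms_of A))" using that(1) by (simp only: rcset_axioms)
  qed (intro that fml_And \<theta> AndL1 AndL2 AndR; assumption)+
  have rel_fun: "proves L T (Alls n (Imp (And \<xi> ?\<theta>) (And (And \<psi>1 ?\<theta>) (And \<psi>2 ?\<theta>))))"
    if mem: "Alls n (Imp \<xi> (And \<psi>1 \<psi>2)) \<in> axioms_of A" and f: "fml L n \<xi>" "fml L n \<psi>1" "fml L n \<psi>2" for n \<xi> \<psi>1 \<psi>2
  proof (rule proves_relativized[OF \<theta>_Conj \<theta>0])
    show "Alls n (Imp \<xi> (And \<psi>1 \<psi>2)) \<in> rcset (acset (axioms_of A))" using mem by (simp only: rcset_axioms)
    fix \<Gamma> \<Delta> assume c: "cedent L n \<Gamma>" "cedent L n \<Delta>"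
    let ?\<Gamma> = "insert \<psi>1 (insert \<psi>2 (insert ?\<theta> \<Gamma>))"
    have c': "cedent L n ?\<Gamma>" by (intro cedent_insert f \<theta> c)
    have *: "prov L T n ?\<Gamma> (insert (And \<psi> ?\<theta>) \<Delta>)" if "\<psi> \<in> {\<psi>1, \<psi>2}" for \<psi>
      by (rule prov_AndR[OF prov_id[of \<psi>] prov_id[of ?\<theta>] c' c(2)])
        (use that c' c f \<theta>[of n] in \<open>auto intro: cedent_insert\<close>)
    have "prov L T n ?\<Gamma> (insert (And (And \<psi>1 ?\<theta>) (And \<psi>2 ?\<theta>)) \<Delta>)"
      by (rule prov_AndR[OF * * c' c(2)]) (intro insertI1 insertI2 fml_And f \<theta>)+
    then show "prov L T n (insert (And \<psi>1 \<psi>2) (insert ?\<theta> \<Gamma>)) (insert (And (And \<psi>1 ?\<theta>) (And \<psi>2 ?\<theta>)) \<Delta>)"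
      by (rule prov_AndL) (rule f)+
  qed (intro f fml_And \<theta> AndL1 AndL2; assumption)+
  have rel_trans: "proves L T (Alls n (Imp (And (And \<xi>1 ?\<theta>) (And \<xi>2 ?\<theta>)) (And \<psi> ?\<theta>)))"
    if mem: "Alls n (Imp (And \<xi>1 \<xi>2) \<psi>) \<in> axioms_of A" and f: "fml L n \<xi>1" "fml L n \<xi>2" "fml L n \<psi>" for n \<xi>1 \<xi>2 \<psi>
  proof (rule proves_relativized[OF \<theta>_Conj \<theta>0])
    show "Alls n (Imp (And \<xi>1 \<xi>2) \<psi>) \<in> rcset (acset (axioms_of A))" using mem by (simp only: rcset_axioms)
    fix \<Gamma> \<Delta> assume c: "cedent L n \<Gamma>" "cedent L n \<Delta>"
    have fA: "fml L n (And \<xi>1 ?\<theta>)" "fml L n (And \<xi>2 ?\<theta>)" by (intro fml_And f \<theta>)+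
    show "prov L T n (insert (And (And \<xi>1 ?\<theta>) (And \<xi>2 ?\<theta>)) \<Gamma>) (insert (And \<xi>1 \<xi>2) \<Delta>)"
    proof (rule prov_AndL[OF prov_AndR fA])
      show "prov L T n (insert (And \<xi>1 ?\<theta>) (insert (And \<xi>2 ?\<theta>) \<Gamma>)) (insert \<xi>1 \<Delta>)"
        by (intro AndL1 cedent_insert fA f c)
      have "prov L T n (insert (And \<xi>2 ?\<theta>) (insert (And \<xi>1 ?\<theta>) \<Gamma>)) (insert \<xi>2 \<Delta>)"
        by (intro AndL1 cedent_insert fA f c)
      then show "prov L T n (insert (And \<xi>1 ?\<theta>) (insert (And \<xi>2 ?\<theta>) \<Gamma>)) (insert \<xi>2 \<Delta>)"
        by (subst insert_commute)
    qed (intro cedent_insert fA f c)+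
    show "prov L T n (insert (And (And \<xi>1 ?\<theta>) (And \<xi>2 ?\<theta>)) \<Gamma>) (insert ?\<theta> \<Delta>)"
      by (rule prov_AndL[OF AndL2 fA]) (intro cedent_insert fA f c)+
  qed (intro f fml_And \<theta> AndR; assumption)+
  have simps: "idx (relativize A) = idx A" "vars (relativize A) = vars A"
    "\<And>i. alpha (relativize A) i = And (alpha A i) ?\<theta>" "\<And>i j. eps (relativize A) i j = And (eps A i j) ?\<theta>"
    by (simp_all add: relativize_def)
  have fa: "fml L n (app (alpha A i) vs)" if "i \<in> idx A" "length vs = vars A i" "set vs \<subseteq> {..<n}" for i vs n
    using fml_app[OF \<alpha>] that by blast
  have fe: "fml L n (app (eps A i j) vs)" if "i \<in> idx A" "j \<in> idx A" "length vs = vars A i + vars A j" "set vs \<subseteq> {..<n}" for i j vs n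
    using fml_app[OF \<epsilon>] that by blast
  show ?thesis
    unfolding imaginary_sort_def Let_def simps app_And[OF \<theta>0]
  proof (intro conjI ballI, goal_cases)
    case (1 i) then show ?case by (intro fml_And \<alpha> \<theta>)
  next
    case (2 i j) then show ?case by (intro fml_And \<epsilon> \<theta>)
  next
    case (3 i j) then show ?case
      by (intro rel_fun, unfold axioms_of_def Let_def, blast) (rule fa fe; auto)+
  next
    case (4 i) then show ?case
      by (intro rel, unfold axioms_of_def Let_def, blast) (rule fa fe; auto)+
  next
    case (5 i j) then show ?case
      by (intro rel, unfold axioms_of_def Let_def, blast) (rule fa fe; auto)+
  next
    case (6 i j k) show ?case
      by (intro rel_trans, unfold axioms_of_def Let_def, rule UnI2, rule UN_I[OF 6(1)],
          rule UN_I[OF 6(2)], rule UN_I[OF 6(3)], rule singletonI) (rule fa fe; auto simp: 6)+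
  qed
qed

section \<open>Names of points of a fiberwise countable space\<close>

lemma enum_of_transport:
  assumes g: "bij_betw g U U" and k: "k \<in> enum_of U (map g d)" and d: "set d \<subseteq> U"
  shows "restrict (\<lambda>i. inv_into U g (k i)) U \<in> enum_of U d"
proof -
  let ?k = "restrict (\<lambda>i. inv_into U g (k i)) U"
  have kU: "bij_betw k U U" using enum_ofD(1)[OF k] by (simp add: Sym_def)
  have len: "{..<length d} \<subseteq> U" using enum_ofD(3)[OF k] by simp
  have "bij_betw (inv_into U g \<circ> k) U U" by (rule bij_betw_trans[OF kU bij_betw_inv_into[OF g]])
  then have "bij_betw ?k U U" by (rule bij_betw_cong[THEN iffD1, rotated]) simp
  then have "?k \<in> Sym U" by (simp add: Sym_def)
  moreover have "initial_part ?k (length d) = d"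
  proof -
    have "initial_part ?k (length d) = map (inv_into U g) (initial_part k (length d))"
      using len unfolding initial_part_def rev_map[symmetric] by (auto simp: rev_map)
    also have "\<dots> = map (inv_into U g) (map g d)" using enum_ofD(2)[OF k] by simp
    also have "\<dots> = d"
      using g d unfolding map_map by (intro map_idI) (auto simp: bij_betw_def)
    finally show ?thesis .
  qed
  ultimately show ?thesis using len by (simp add: enum_of_def)
qed

lemma condition_map: "bij_betw g U V \<Longrightarrow> condition U a \<Longrightarrow> condition V (map g a)"
  by (auto simp: condition_def distinct_map bij_betw_def intro: inj_on_subset)

text \<open>A permutation \<open>g\<close> of \<open>U\<close> acts on enumerations by composition and on conditions entrywise; dense sets are
  transported along \<open>map g\<close>.\<close>

lemma comeager_transport:
  assumes g: "bij_betw g U U" and a: "condition U a" and A: "comeager U a A"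
    and B: "\<And>k. k \<in> enum_of U (map g a) \<Longrightarrow> restrict (\<lambda>i. inv_into U g (k i)) U \<in> A \<Longrightarrow> k \<in> B"
  shows "comeager U (map g a) B"
proof -
  obtain D where D: "\<And>i b. condition U (b @ a) \<Longrightarrow> \<exists>c. condition U (c @ b @ a) \<and> c @ b @ a \<in> D i"
     "\<And>k. k \<in> enum_of U a \<Longrightarrow> (\<forall>i::nat. \<exists>b. k \<in> enum_of U (b @ a) \<and> b @ a \<in> D i) \<Longrightarrow> k \<in> A"
    using A unfolding comeager_def by blast
  let ?h = "inv_into U g"
  have h: "bij_betw ?h U U" by (rule bij_betw_inv_into[OF g])
  have hg: "map ?h (map g d) = d" if "set d \<subseteq> U" for d
    using g that unfolding map_map by (intro map_idI) (auto simp: bij_betw_def)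
  have gh: "map g (map ?h d) = d" if "set d \<subseteq> U" for d
    using that bij_betw_inv_into_right[OF g] unfolding map_map by (intro map_idI) auto
  have aU: "set a \<subseteq> U" using a by (simp add: condition_def)
  define E where "E i = map g ` {d \<in> D i. condition U d}" for i
  have "\<exists>c. condition U (c @ b @ map g a) \<and> c @ b @ map g a \<in> E i" if b: "condition U (b @ map g a)" for i b
  proof -
    have bU: "set b \<subseteq> U" using b by (simp add: condition_def)
    have "condition U (map ?h b @ a)" using condition_map[OF h b] hg[OF aU] by simp
    from D(1)[OF this, of i] obtain c where c: "condition U (c @ map ?h b @ a)" "c @ map ?h b @ a \<in> D i" by blast
    have "map g (c @ map ?h b @ a) = map g c @ b @ map g a" using gh[OF bU] by simp
    then show ?thesis using c condition_map[OF g c(1)] unfolding E_def by (metis (mono_tags, lifting) imageI mem_Collect_eq)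
  qed
  moreover have "k \<in> B" if k: "k \<in> enum_of U (map g a)"
    and meets: "\<forall>i. \<exists>b. k \<in> enum_of U (b @ map g a) \<and> b @ map g a \<in> E i" for k
  proof (rule B[OF k], rule D(2))
    let ?k = "restrict (\<lambda>i. ?h (k i)) U"
    show "?k \<in> enum_of U a" by (rule enum_of_transport[OF g k aU])
    show "\<forall>i. \<exists>b. ?k \<in> enum_of U (b @ a) \<and> b @ a \<in> D i"
    proof
      fix i
      obtain b where b: "k \<in> enum_of U (b @ map g a)" "b @ map g a \<in> E i" using meets by blast
      then obtain d where d: "b @ map g a = map g d" "d \<in> D i" "condition U d" by (auto simp: E_def)
      have dU: "set d \<subseteq> U" using d(3) by (simp add: condition_def)
      have "d = map ?h (b @ map g a)" using hg[OF dU] d(1) by simp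
      then have dd: "d = map ?h b @ a" using hg[OF aU] by simp
      have "?k \<in> enum_of U d" using enum_of_transport[OF g _ dU] b(1) d(1) by simp
      then show "\<exists>b. ?k \<in> enum_of U (b @ a) \<and> b @ a \<in> D i" using d(2) dd by blast
    qed
  qed
  ultimately show ?thesis unfolding comeager_def by (intro exI[of _ E]) blast
qed

lemma initial_bij_eq:
  assumes "initial U" "initial V" "bij_betw g U V"
  shows "U = V"
  using assms bij_betw_finite[OF assms(3)] bij_betw_same_card[OF assms(3)] by (auto simp: initial_def)

lemma space_IsosB [simp]: "space (IsosB L T) = Isos L T"
  unfolding IsosB_def by (rule space_measure_of) auto

locale mod_gspace =
  fixes L :: "'r lang" and T :: "'r fm set" and X :: "('x, ('r, nat) struct, 'r miso) gspace"
  assumes countable_L: "countable (syms L)" and T: "is_theory L T"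
    and gspace: "fc_borel_gspace (ModG L T) X"
begin

abbreviation "S \<equiv> space (pts X)"

lemma standard: "standard_borel (pts X)"
  and proj_meas: "proj X \<in> pts X \<rightarrow>\<^sub>M ModB L T"
  and fibres: "M \<in> Mod L T \<Longrightarrow> countable {x \<in> S. proj X x = M}"
  and act_meas: "(\<lambda>(g, x). act X g x) \<in> restrict_space (IsosB L T \<Otimes>\<^sub>M pts X) (action_dom (ModG L T) X) \<rightarrow>\<^sub>M pts X"
  using gspace by (auto simp: fc_borel_gspace_def ModG_def)

lemma proj_Mod: "x \<in> S \<Longrightarrow> proj X x \<in> Mod L T"
  using measurable_space[OF proj_meas] by simp

lemma initial_proj: "x \<in> S \<Longrightarrow> initial (univ (proj X x))"
  by (rule Mod_initial[OF proj_Mod])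

lemma mem_action_dom: "(g, x) \<in> action_dom (ModG L T) X \<longleftrightarrow> g \<in> Isos L T \<and> x \<in> S \<and> fst g = proj X x"
  by (simp add: action_dom_def ModG_def case_prod_unfold)

lemma act_space: "(M, g, N) \<in> Isos L T \<Longrightarrow> x \<in> S \<Longrightarrow> proj X x = M \<Longrightarrow> act X (M, g, N) x \<in> S"
  using measurable_space[OF act_meas, of "((M, g, N), x)"]
  by (simp add: space_restrict_space space_pair_measure mem_action_dom)

lemma proj_act:
  assumes "(M, g, N) \<in> Isos L T" "x \<in> S" "proj X x = M"
  shows "proj X (act X (M, g, N) x) = N"
proof -
  have "\<forall>(g, x) \<in> action_dom (ModG L T) X. proj X (act X g x) = tgt (ModG L T) g"
    using gspace by (simp add: fc_borel_gspace_def)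
  then have "proj X (act X (M, g, N) x) = tgt (ModG L T) (M, g, N)"
    using assms mem_action_dom[of "(M, g, N)" x] by fastforce
  then show ?thesis by (simp add: ModG_def)
qed

lemma act_ident: "x \<in> S \<Longrightarrow> proj X x = M \<Longrightarrow> act X (M, restrict id (univ M), M) x = x"
  using gspace by (auto simp: fc_borel_gspace_def ModG_def)

lemma act_comp:
  assumes "(M, g, N) \<in> Isos L T" "(N, h, P) \<in> Isos L T" "x \<in> S" "proj X x = M"
  shows "act X (N, h, P) (act X (M, g, N) x) = act X (M, compose (univ M) h g, P) x"
proof -
  have "\<forall>(g, x) \<in> action_dom (ModG L T) X. \<forall>h \<in> space (mors (ModG L T)). src (ModG L T) h = tgt (ModG L T) g \<longrightarrow>
       act X (comps (ModG L T) h g) x = act X h (act X g x)"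
    using gspace by (simp add: fc_borel_gspace_def)
  moreover have "((M, g, N), x) \<in> action_dom (ModG L T) X" using assms by (simp add: mem_action_dom)
  moreover have "(N, h, P) \<in> space (mors (ModG L T))" "src (ModG L T) (N, h, P) = tgt (ModG L T) (M, g, N)"
    using assms by (simp_all add: ModG_def)
  ultimately have "act X (comps (ModG L T) (N, h, P) (M, g, N)) x = act X (N, h, P) (act X (M, g, N) x)"
    by fast
  then show ?thesis by (simp add: ModG_def)
qed

lemma act_inverse:
  assumes g: "(M, g, N) \<in> Isos L T" and x: "x \<in> S" "proj X x = M"
  shows "act X (N, restrict (inv_into (univ M) g) (univ N), M) (act X (M, g, N) x) = x"
proof -
  have bij: "bij_betw g (univ M) (univ N)" using g by (simp add: Isos_def is_iso_def)
  have "compose (univ M) (restrict (inv_into (univ M) g) (univ N)) g = restrict id (univ M)"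
    using bij by (auto simp: compose_def fun_eq_iff bij_betw_def)
  then show ?thesis using act_comp[OF g Isos_inv[OF g] x] act_ident[OF x] by simp
qed

lemma act_inj:
  assumes "(M, g, N) \<in> Isos L T" "x \<in> S" "proj X x = M" "x' \<in> S" "proj X x' = M"
    "act X (M, g, N) x = act X (M, g, N) x'"
  shows "x = x'"
  using act_inverse[OF assms(1)] assms(2-) by metis

text \<open>The inverse of the enumeration \<open>k\<close>, as a morphism from the model below \<open>x\<close> to its pullback along \<open>k\<close>.\<close>

definition mor :: "'x \<Rightarrow> (nat \<Rightarrow> nat) \<Rightarrow> 'r miso" where
  "mor x k = (proj X x, restrict (inv_into (univ (proj X x)) k) (univ (proj X x)), pull L (proj X x) k)"

lemma mor_Isos: "x \<in> S \<Longrightarrow> k \<in> Sym (univ (proj X x)) \<Longrightarrow> mor x k \<in> Isos L T"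
  using Isos_inv[OF pull_Isos[OF T proj_Mod, of x k]] by (simp add: mor_def)

definition sections :: "nat \<Rightarrow> ('x \<Rightarrow> nat list \<Rightarrow> bool) \<Rightarrow> bool" where
  "sections n P \<longleftrightarrow> (\<forall>a. length a = n \<longrightarrow> {x \<in> S. condition (univ (proj X x)) a \<and> P x a} \<in> sets (pts X))"

lemma sets_condition: "{x \<in> S. condition (univ (proj X x)) a} \<in> sets (pts X)"
proof (cases "distinct a")
  case True
  have "proj X -` {M \<in> Mod L T. set a \<subseteq> univ M} \<inter> S \<in> sets (pts X)"
    by (rule measurable_sets[OF proj_meas sets_Mod_subset])
  moreover have "proj X -` {M \<in> Mod L T. set a \<subseteq> univ M} \<inter> S = {x \<in> S. condition (univ (proj X x)) a}"
    using True proj_Mod by (auto simp: condition_def)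
  ultimately show ?thesis by simp
next
  case False
  then have "{x \<in> S. condition (univ (proj X x)) a} = {}" by (simp add: condition_def)
  then show ?thesis by (simp only: sets.empty_sets)
qed

sublocale pt: definable_family S "\<lambda>x. univ (proj X x)" sections
proof
  fix n P Q
  show "initial (univ (proj X x))" if "x \<in> S" for x by (rule initial_proj[OF that])
  show "sections n Q" if P: "sections n P"
    and eq: "\<And>x a. x \<in> S \<Longrightarrow> condition (univ (proj X x)) a \<Longrightarrow> length a = n \<Longrightarrow> P x a \<longleftrightarrow> Q x a"
    unfolding sections_def
  proof (intro allI impI)
    fix a :: "nat list" assume a: "length a = n"
    have "{x \<in> S. condition (univ (proj X x)) a \<and> Q x a} = {x \<in> S. condition (univ (proj X x)) a \<and> P x a}"
      using eq a by blast
    then show "{x \<in> S. condition (univ (proj X x)) a \<and> Q x a} \<in> sets (pts X)" using P a by (simp add: sections_def)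
  qed
  show "sections n (\<lambda>x a. \<not> P x a)" if P: "sections n P"
    unfolding sections_def
  proof (intro allI impI)
    fix a :: "nat list" assume a: "length a = n"
    have "{x \<in> S. condition (univ (proj X x)) a \<and> \<not> P x a} =
      {x \<in> S. condition (univ (proj X x)) a} - {x \<in> S. condition (univ (proj X x)) a \<and> P x a}" by blast
    moreover have "{x \<in> S. condition (univ (proj X x)) a \<and> P x a} \<in> sets (pts X)"
      using P a unfolding sections_def by blast
    ultimately show "{x \<in> S. condition (univ (proj X x)) a \<and> \<not> P x a} \<in> sets (pts X)"
      using sets.Diff[OF sets_condition] by (simp only:)
  qed
  show "sections n (\<lambda>x a. \<forall>i. R i x a)" if R: "\<And>i::nat. sections n (R i)" for R
    unfolding sections_def
  proof (intro allI impI)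
    fix a :: "nat list" assume a: "length a = n"
    have "{x \<in> S. condition (univ (proj X x)) a \<and> (\<forall>i. R i x a)} = (\<Inter>i. {x \<in> S. condition (univ (proj X x)) a \<and> R i x a})"
      by blast
    then show "{x \<in> S. condition (univ (proj X x)) a \<and> (\<forall>i. R i x a)} \<in> sets (pts X)"
      using R a by (auto simp: sections_def intro!: sets.countable_INT')
  qed
  show "sections n (\<lambda>x a. \<forall>c \<in> univ (proj X x) - set a. P x (c # a))" if P: "sections (Suc n) P"
    unfolding sections_def
  proof (intro allI impI)
    fix a :: "nat list" assume a: "length a = n"
    have "{x \<in> S. condition (univ (proj X x)) a \<and> (\<forall>c \<in> univ (proj X x) - set a. P x (c # a))} =
      {x \<in> S. condition (univ (proj X x)) a} \<inter> (\<Inter>c. (S - {x \<in> S. condition (univ (proj X x)) (c # a)})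
         \<union> {x \<in> S. condition (univ (proj X x)) (c # a) \<and> P x (c # a)})"
      by (auto simp: condition_def)
    also have "\<dots> \<in> sets (pts X)"
      by (intro sets.Int sets_condition sets.countable_INT' image_subsetI sets.Un sets.Diff sets.top)
        (use P a in \<open>simp_all add: sections_def\<close>)
    finally show "{x \<in> S. condition (univ (proj X x)) a \<and> (\<forall>c \<in> univ (proj X x) - set a. P x (c # a))} \<in> sets (pts X)" .
  qed
  show "sections n (\<lambda>_ _. True)" using sets_condition by (simp add: sections_def)
qed

lemma sections_const: 
  assumes "V \<in> sets (pts X)"
  shows "sections n (\<lambda>x a. x \<in> V)"
  unfolding sections_def
proof (intro allI impI)
  fix a :: "nat list"
  have "{x \<in> S. condition (univ (proj X x)) a \<and> x \<in> V} = {x \<in> S. condition (univ (proj X x)) a} \<inter> V" by blast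
  then show "{x \<in> S. condition (univ (proj X x)) a \<and> x \<in> V} \<in> sets (pts X)" using sets_condition assms by simp
qed

lemma sections_free: "sections n (\<lambda>x a. P a)"
  unfolding sections_def
proof (intro allI impI)
  fix a :: "nat list"
  show "{x \<in> S. condition (univ (proj X x)) a \<and> P a} \<in> sets (pts X)" using sets_condition by (cases "P a") simp_all
qed

lemma sets_good_const: "V \<in> sets (pts X) \<Longrightarrow> {(x, k). x \<in> V} \<inter> pt.W \<in> sets pt.goodM"
  by (intro pt.good_W pt.good_const sections_const)

lemma fst_goodM: "fst \<in> pt.goodM \<rightarrow>\<^sub>M pts X"
proof (rule measurableI)
  fix V assume V: "V \<in> sets (pts X)"
  have "fst -` V \<inter> space pt.goodM = {(x, k). x \<in> V} \<inter> pt.W" by auto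
  then show "fst -` V \<inter> space pt.goodM \<in> sets pt.goodM" using sets_good_const[OF V] by simp
qed (auto simp: pt.W_def)

lemma mor_measurable: "(\<lambda>(x, k). mor x k) \<in> pt.goodM \<rightarrow>\<^sub>M IsosB L T"
  unfolding IsosB_def
proof (rule measurable_measure_of)
  show "(\<lambda>(x, k). mor x k) \<in> space pt.goodM \<rightarrow> Isos L T" using mor_Isos by (auto simp: pt.W_def)
  fix B assume "B \<in> {{(M, g, N) \<in> Isos L T. M \<in> B} | B. B \<in> sets (ModB L T)} \<union>
     {{(M, g, N) \<in> Isos L T. a \<in> univ M \<and> b \<in> univ M \<and> g a = b} | a b. True}"
  then consider C where "B = {(M, g, N) \<in> Isos L T. M \<in> C}" "C \<in> sets (ModB L T)"
    | a b where "B = {(M, g, N) \<in> Isos L T. a \<in> univ M \<and> b \<in> univ M \<and> g a = b}" by blast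
  then show "(\<lambda>(x, k). mor x k) -` B \<inter> space pt.goodM \<in> sets pt.goodM"
  proof cases
    case (1 C)
    have "(\<lambda>(x, k). mor x k) -` B \<inter> space pt.goodM = {(x, k). x \<in> proj X -` C \<inter> S} \<inter> pt.W"
      using mor_Isos unfolding 1 by (auto simp: pt.W_def mor_def)
    then show ?thesis using sets_good_const[OF measurable_sets[OF proj_meas 1(2)]] by simp
  next
    case (2 a b)
    let ?G = "{(x, k). k b = a}"
    have "pt.good {(x, k). {..<Suc b} \<subseteq> univ (proj X x) \<and> (x, k) \<in> ?G}"
    proof (rule pt.good_prefix)
      show "sections n (\<lambda>x l. rev l ! b = a)" for n by (rule sections_free)
      show "(x, k) \<in> ?G \<longleftrightarrow> rev (initial_part k n) ! b = a" if "Suc b \<le> n" for x :: 'x and k n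
        using that initial_part_nth[of b n k] by simp
    qed
    from pt.good_W[OF this]
    have "{(x, k). {..<Suc b} \<subseteq> univ (proj X x) \<and> (x, k) \<in> ?G} \<inter> pt.W \<in> sets pt.goodM" .
    also have "{(x, k). {..<Suc b} \<subseteq> univ (proj X x) \<and> (x, k) \<in> ?G} \<inter> pt.W =
      (\<lambda>(x, k). mor x k) -` B \<inter> space pt.goodM"
    proof (rule set_eqI)
      fix y :: "'x \<times> (nat \<Rightarrow> nat)"
      obtain x k where y: "y = (x, k)" by (cases y)
      show "y \<in> {(x, k). {..<Suc b} \<subseteq> univ (proj X x) \<and> (x, k) \<in> ?G} \<inter> pt.W \<longleftrightarrow>
        y \<in> (\<lambda>(x, k). mor x k) -` B \<inter> space pt.goodM"
      proof (cases "(x, k) \<in> pt.W")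
        case True
        then have x: "x \<in> S" "k \<in> Sym (univ (proj X x))" by (auto simp: pt.W_def)
        let ?U = "univ (proj X x)"
        have bij: "bij_betw k ?U ?U" using x(2) by (simp add: Sym_def)
        have "{..<Suc b} \<subseteq> ?U \<longleftrightarrow> b \<in> ?U"
          using initial_down[OF initial_proj[OF x(1)], of b] by (auto simp: less_Suc_eq_le)
        moreover have "b \<in> ?U \<and> k b = a \<longleftrightarrow> a \<in> ?U \<and> b \<in> ?U \<and> inv_into ?U k a = b"
          using bij by (auto simp: bij_betw_def f_inv_into_f)
        ultimately show ?thesis using mor_Isos[OF x] True unfolding y 2 by (auto simp: mor_def)
      qed (simp add: y)
    qed
    finally show ?thesis .
  qed
qed auto

text \<open>Composition of the measurable action with \<open>mor\<close>. It makes all sets of pairs \<open>(x, k)\<close> good that are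
  defined by membership of the translated point in a Borel set.\<close>

lemma translate_measurable: "(\<lambda>(x, k). act X (mor x k) x) \<in> pt.goodM \<rightarrow>\<^sub>M pts X"
proof -
  have "(\<lambda>p. (case p of (x, k) \<Rightarrow> mor x k, fst p)) \<in> pt.goodM \<rightarrow>\<^sub>M restrict_space (IsosB L T \<Otimes>\<^sub>M pts X) (action_dom (ModG L T) X)"
  proof (rule measurable_restrict_space2)
    show "(\<lambda>p. (case p of (x, k) \<Rightarrow> mor x k, fst p)) \<in> space pt.goodM \<rightarrow> action_dom (ModG L T) X"
      using mor_Isos by (auto simp: pt.W_def mem_action_dom) (simp add: mor_def)
    show "(\<lambda>p. (case p of (x, k) \<Rightarrow> mor x k, fst p)) \<in> pt.goodM \<rightarrow>\<^sub>M IsosB L T \<Otimes>\<^sub>M pts X"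
      by (rule measurable_Pair[OF mor_measurable fst_goodM])
  qed
  from measurable_compose[OF this act_meas] show ?thesis by (simp add: case_prod_unfold)
qed

text \<open>The Vaught transform of \<open>V\<close>. For \<open>V\<close> in the cover of \<open>X\<close>, its elements are the points with name \<open>a\<close>.\<close>

definition star :: "'x set \<Rightarrow> nat list \<Rightarrow> 'x set" where
  "star V a = {x \<in> S. condition (univ (proj X x)) a \<and> comeager (univ (proj X x)) a {k. k \<in> Sym (univ (proj X x)) \<and> act X (mor x k) x \<in> V}}"

lemma good_translate:
  assumes "V \<in> sets (pts X)"
  shows "pt.good ({(x, k). k \<in> Sym (univ (proj X x)) \<and> act X (mor x k) x \<in> V})"
proof -
  have "(\<lambda>(x, k). act X (mor x k) x) -` V \<inter> space pt.goodM \<in> sets pt.goodM"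
    by (rule measurable_sets[OF translate_measurable assms])
  then have "pt.good ((\<lambda>(x, k). act X (mor x k) x) -` V \<inter> pt.W)" by (simp add: pt.sets_goodM)
  then show ?thesis by (rule pt.good_cong) (auto simp: pt.W_def)
qed

lemma sets_star: "V \<in> sets (pts X) \<Longrightarrow> star V a \<in> sets (pts X)"
  using good_translate[of V] unfolding pt.good_def sections_def star_def by simp

lemma star_inj:
  assumes V: "inj_on (proj X) V" and x: "x \<in> star V a" "x' \<in> star V a" "proj X x = proj X x'"
  shows "x = x'"
proof -
  let ?U = "univ (proj X x)"
  have S: "x \<in> S" "x' \<in> S" and a: "condition ?U a"
    and c: "comeager ?U a {k. k \<in> Sym ?U \<and> act X (mor x k) x \<in> V}" "comeager ?U a {k. k \<in> Sym ?U \<and> act X (mor x' k) x' \<in> V}"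
    using x unfolding star_def by auto
  from comeager_nonempty[OF initial_proj[OF S(1)] a comeager_Int[OF c]]
  obtain k where k: "k \<in> Sym ?U" "act X (mor x k) x \<in> V" "act X (mor x' k) x' \<in> V" by blast
  have eq: "mor x' k = mor x k" using x(3) by (simp add: mor_def)
  have I: "(proj X x, restrict (inv_into ?U k) ?U, pull L (proj X x) k) \<in> Isos L T"
    using mor_Isos[OF S(1) k(1)] by (simp add: mor_def)
  have "proj X (act X (mor x k) x) = proj X (act X (mor x k) x')"
    using proj_act[OF I S(1)] proj_act[OF I S(2)] x(3) by (simp add: mor_def)
  then have "act X (mor x k) x = act X (mor x k) x'" using V k(2,3) eq by (auto dest: inj_onD)
  then show ?thesis using act_inj[OF I S(1) refl S(2)] x(3) by (simp add: mor_def)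
qed

text \<open>Otherwise no condition forces the translated point into any \<open>V j\<close>. By the Baire property, comeagerly many
  enumerations then move \<open>x\<close> outside of \<open>V j\<close>, for each \<open>j\<close> and hence for all \<open>j\<close> at once; but the
  sets \<open>V j\<close> cover \<open>X\<close>.\<close>

lemma star_cover:
  assumes V: "\<And>j::nat. V j \<in> sets (pts X)" "S = (\<Union>j. V j)" and x: "x \<in> S"
  shows "\<exists>j a. x \<in> star (V j) a"
proof (rule ccontr)
  assume none: "\<not> ?thesis"
  let ?U = "univ (proj X x)"
  let ?A = "\<lambda>j. {k. k \<in> Sym ?U \<and> act X (mor x k) x \<in> V j}"
  have c: "condition ?U []" by (simp add: condition_def)
  have "comeager ?U [] (- ?A j)" for j
  proof -
    have "baire_property ?U (?A j)" using good_translate[OF V(1)[of j]] x unfolding pt.good_def by auto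
    moreover have "\<not> comeager ?U b (?A j)" if "condition ?U b" for b
      using none that x unfolding star_def by blast
    ultimately show ?thesis using comeager_Compl_iff[OF initial_proj[OF x] c] by simp
  qed
  then have "comeager ?U [] (\<Inter>j. - ?A j)" by (rule comeager_INT)
  from comeager_nonempty[OF initial_proj[OF x] c this]
  obtain k where k: "k \<in> enum_of ?U []" "\<And>j. k \<notin> ?A j" by blast
  have "act X (mor x k) x \<in> S"
    using act_space[OF _ x refl] mor_Isos[OF x enum_ofD(1)[OF k(1)]] by (simp add: mor_def)
  then show False using k(2) enum_ofD(1)[OF k(1)] V(2) by blast
qed

text \<open>If \<open>k\<close> enumerates \<open>N\<close>, then \<open>g\<inverse> \<circ> k\<close> enumerates \<open>M\<close>, the pulled back structures are equal, and \<open>k\<close> moves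
  the image of \<open>x\<close> under \<open>g\<close> to the same point as \<open>g\<inverse> \<circ> k\<close> moves \<open>x\<close>.\<close>

lemma star_act:
  assumes g: "(M, g, N) \<in> Isos L T" and x: "x \<in> star V a" "proj X x = M"
  shows "act X (M, g, N) x \<in> star V (map g a)"
proof -
  have S: "x \<in> S" and a: "condition (univ M) a" 
    and c: "comeager (univ M) a {k. k \<in> Sym (univ M) \<and> act X (mor x k) x \<in> V}"
    using x by (auto simp: star_def)
  have iso: "is_iso L M g N" and bij: "bij_betw g (univ M) (univ N)" and MN: "M \<in> Mod L T" "N \<in> Mod L T"
    using g by (auto simp: Isos_def is_iso_def)
  have UN: "univ N = univ M" using initial_bij_eq[OF Mod_initial Mod_initial bij] MN by simp
  let ?U = "univ M"
  let ?y = "act X (M, g, N) x"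
  have y: "?y \<in> S" "proj X ?y = N" using act_space[OF g S x(2)] proj_act[OF g S x(2)] by auto
  have gU: "bij_betw g ?U ?U" using bij UN by simp
  have "comeager ?U (map g a) {k. k \<in> Sym ?U \<and> act X (mor ?y k) ?y \<in> V}"
  proof (rule comeager_transport[OF gU a c], rule CollectI, rule conjI)
    fix k assume k: "k \<in> enum_of ?U (map g a)"
    let ?k = "restrict (\<lambda>i. inv_into ?U g (k i)) ?U"
    assume "?k \<in> {k. k \<in> Sym ?U \<and> act X (mor x k) x \<in> V}"
    then have k': "?k \<in> Sym ?U" "act X (mor x ?k) x \<in> V" by auto
    show kS: "k \<in> Sym ?U" by (rule enum_ofD(1)[OF k])
    have kU: "bij_betw k ?U ?U" and kU': "bij_betw ?k ?U ?U" using kS k'(1) by (simp_all add: Sym_def)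
    have gk: "g (?k i) = k i" if "i \<in> ?U" for i
      using that bij_betw_inv_into_right[OF gU, of "k i"] bij_betwE[OF kU] by simp
    have pull: "pull L N k = pull L M ?k"
    proof -
      have "map k as \<in> intp N R \<longleftrightarrow> map ?k as \<in> intp M R" if "R \<in> syms L" "length as = arity L R" "set as \<subseteq> ?U" for R as
      proof -
        have "set (map ?k as) \<subseteq> ?U" using that(3) bij_betwE[OF kU'] by auto
        then have "map ?k as \<in> intp M R \<longleftrightarrow> map g (map ?k as) \<in> intp N R"
          using iso that(1,2) unfolding is_iso_def by (metis length_map)
        moreover have "map g (map ?k as) = map k as" unfolding map_map using that(3) gk by (intro map_cong) auto
        ultimately show ?thesis by (simp only:)
      qed
      then show ?thesis unfolding pull_def UN by (auto simp: fun_eq_iff)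
    qed
    have "compose ?U (restrict (inv_into ?U k) ?U) g = restrict (inv_into ?U ?k) ?U"
    proof (rule ext)
      fix i
      show "compose ?U (restrict (inv_into ?U k) ?U) g i = restrict (inv_into ?U ?k) ?U i"
      proof (cases "i \<in> ?U")
        case True
        let ?j = "inv_into ?U ?k i"
        have j: "?j \<in> ?U" "?k ?j = i"
          using bij_betwE[OF bij_betw_inv_into[OF kU']] True bij_betw_inv_into_right[OF kU' True] by auto
        then have "k ?j = g i" using gk[OF j(1)] by simp
        then have "inv_into ?U k (g i) = ?j"
          using bij_betw_inv_into_left[OF kU j(1)] by simp
        then show ?thesis using True bij_betwE[OF gU] by (simp add: compose_def)
      qed (simp add: compose_def)
    qed
    then have "act X (mor ?y k) ?y = act X (mor x ?k) x"
      using act_comp[OF g _ S x(2), of "restrict (inv_into ?U k) ?U" "pull L N k"] mor_Isos[OF y(1), of k] kS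
      unfolding mor_def y(2) x(2) UN pull by simp
    then show "act X (mor ?y k) ?y \<in> V" using k'(2) by simp
  qed
  then show ?thesis using y condition_map[OF bij a] by (simp add: star_def UN)
qed

end

section \<open>The sort of names\<close>

lemma sat_app: "fml L (length vs) \<phi> \<Longrightarrow> sat M as (app \<phi> vs) \<longleftrightarrow> sat M (map (\<lambda>v. as ! v) vs) \<phi>"
  by (rule sat_ren) (assumption, simp only: nth_map)

context mod_gspace
begin

lemma exists_cover: "\<exists>V. (\<forall>j::nat. V j \<in> sets (pts X) \<and> inj_on (proj X) (V j)) \<and> S = (\<Union>j. V j)"
  and sets_proj_image: "U \<in> sets (pts X) \<Longrightarrow> inj_on (proj X) U \<Longrightarrow> proj X ` U \<in> sets (ModB L T)"
proof -
  obtain G where G: "countable G" "G \<subseteq> sets (ModB L T)"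
    "\<forall>M\<in>Mod L T. \<forall>N\<in>Mod L T. (\<forall>A\<in>G. M \<in> A \<longleftrightarrow> N \<in> A) \<longrightarrow> M = N"
    using ModB_countably_separated[OF countable_L, of T] by blast
  then have sep: "\<And>M N. M \<in> space (ModB L T) \<Longrightarrow> N \<in> space (ModB L T) \<Longrightarrow> (\<And>A. A \<in> G \<Longrightarrow> M \<in> A \<longleftrightarrow> N \<in> A) \<Longrightarrow> M = N"
    by simp
  show "\<exists>V. (\<forall>j::nat. V j \<in> sets (pts X) \<and> inj_on (proj X) (V j)) \<and> S = (\<Union>j. V j)"
    by (rule countable_to_one_cover[OF standard proj_meas G(1,2) sep]) (simp_all add: fibres)
  show "proj X ` U \<in> sets (ModB L T)" if "U \<in> sets (pts X)" "inj_on (proj X) U"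
    by (rule inj_image_sets[OF standard proj_meas G(1,2) sep that]) simp_all
qed

definition cover :: "nat \<Rightarrow> 'x set" where
  "cover = (SOME V. (\<forall>j::nat. V j \<in> sets (pts X) \<and> inj_on (proj X) (V j)) \<and> S = (\<Union>j. V j))"

lemma sets_cover: "cover j \<in> sets (pts X)" and inj_cover: "inj_on (proj X) (cover j)" and Un_cover: "S = (\<Union>j. cover j)"
  using someI_ex[OF exists_cover] unfolding cover_def[symmetric] by blast+

text \<open>An index encodes a member of the cover and the length of the tuples that are names with respect to it.\<close>

definition name_length :: "nat \<Rightarrow> nat" where
  "name_length i = snd (prod_decode i)"

definition named :: "nat \<Rightarrow> nat list \<Rightarrow> 'x set" where
  "named i a = (if length a = name_length i then star (cover (fst (prod_decode i))) a else {})"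

lemma sets_named: "named i a \<in> sets (pts X)"
  by (simp add: named_def sets_star sets_cover)

lemma named_inj: "x \<in> named i a \<Longrightarrow> x' \<in> named i a \<Longrightarrow> proj X x = proj X x' \<Longrightarrow> x = x'"
  using star_inj[OF inj_cover] by (auto simp: named_def split: if_splits)

lemma named_cover: "x \<in> S \<Longrightarrow> \<exists>i a. x \<in> named i a"
proof -
  assume "x \<in> S"
  then obtain j a where "x \<in> star (cover j) a" using star_cover[OF sets_cover Un_cover] by blast
  then have "x \<in> named (prod_encode (j, length a)) a" by (simp add: named_def name_length_def)
  then show ?thesis by blast
qed

lemma named_act: "(M, g, N) \<in> Isos L T \<Longrightarrow> x \<in> named i a \<Longrightarrow> proj X x = M \<Longrightarrow> act X (M, g, N) x \<in> named i (map g a)"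
  using star_act[of M g N x _ a] by (auto simp: named_def split: if_splits)

lemma named_D: "x \<in> named i a \<Longrightarrow> length a = name_length i" "x \<in> named i a \<Longrightarrow> set a \<subseteq> univ (proj X x)" "x \<in> named i a \<Longrightarrow> x \<in> S"
  by (auto simp: named_def star_def condition_def split: if_splits)

definition is_name :: "nat \<Rightarrow> ('r, nat) struct \<Rightarrow> nat list \<Rightarrow> bool" where
  "is_name i M a \<longleftrightarrow> (\<exists>x. proj X x = M \<and> x \<in> named i a)"

definition same_point :: "nat \<Rightarrow> nat \<Rightarrow> ('r, nat) struct \<Rightarrow> nat list \<Rightarrow> nat list \<Rightarrow> bool" where
  "same_point i j M a b \<longleftrightarrow> (\<exists>x. proj X x = M \<and> x \<in> named i a \<and> x \<in> named j b)"

lemma is_name_definable: "\<exists>\<phi>. fml L (name_length i) \<phi> \<and>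
  (\<forall>M \<in> Mod L T. \<forall>a. length a = name_length i \<longrightarrow> set a \<subseteq> univ M \<longrightarrow> (sat M a \<phi> \<longleftrightarrow> is_name i M a))"
proof (rule Lopez_Escobar[OF T])
  fix a :: "nat list" assume "length a = name_length i"
  have "{M \<in> Mod L T. set a \<subseteq> univ M \<and> is_name i M a} = proj X ` named i a"
    using named_D[of _ i a] proj_Mod unfolding is_name_def by blast
  also have "\<dots> \<in> sets (ModB L T)"
    by (rule sets_proj_image[OF sets_named]) (rule inj_onI, rule named_inj)
  finally show "{M \<in> Mod L T. set a \<subseteq> univ M \<and> is_name i M a} \<in> sets (ModB L T)" .
next
  fix M g N and a :: "nat list" assume g: "(M, g, N) \<in> Isos L T" and "is_name i M a"
  then obtain x where x: "proj X x = M" "x \<in> named i a" by (auto simp: is_name_def)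
  then show "is_name i N (map g a)"
    unfolding is_name_def using named_act[OF g x(2,1)] proj_act[OF g named_D(3)[OF x(2)] x(1)] by blast
qed

lemma same_point_definable: "\<exists>\<phi>. fml L (name_length i + name_length j) \<phi> \<and>
  (\<forall>M \<in> Mod L T. \<forall>c. length c = name_length i + name_length j \<longrightarrow> set c \<subseteq> univ M \<longrightarrow>
    (sat M c \<phi> \<longleftrightarrow> same_point i j M (take (name_length i) c) (drop (name_length i) c)))"
proof (rule Lopez_Escobar[OF T])
  fix c :: "nat list"
  let ?V = "named i (take (name_length i) c) \<inter> named j (drop (name_length i) c)"
  have sub: "set c \<subseteq> univ (proj X x)" if "x \<in> ?V" for x
    using that named_D(2)[of x i "take (name_length i) c"] named_D(2)[of x j "drop (name_length i) c"]
    by (metis IntD1 IntD2 Un_least append_take_drop_id set_append)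
  have "{M \<in> Mod L T. set c \<subseteq> univ M \<and> same_point i j M (take (name_length i) c) (drop (name_length i) c)} = proj X ` ?V"
    using sub named_D(3) proj_Mod unfolding same_point_def by blast
  also have "\<dots> \<in> sets (ModB L T)"
    by (rule sets_proj_image[OF sets.Int[OF sets_named sets_named]]) (rule inj_onI, rule named_inj, auto)
  finally show "{M \<in> Mod L T. set c \<subseteq> univ M \<and> same_point i j M (take (name_length i) c) (drop (name_length i) c)} \<in> sets (ModB L T)" .
next
  fix M g N and c :: "nat list" assume g: "(M, g, N) \<in> Isos L T" and "same_point i j M (take (name_length i) c) (drop (name_length i) c)"
  then obtain x where x: "proj X x = M" "x \<in> named i (take (name_length i) c)" "x \<in> named j (drop (name_length i) c)" by (auto simp: same_point_def)
  then show "same_point i j N (take (name_length i) (map g c)) (drop (name_length i) (map g c))"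
    unfolding same_point_def take_map drop_map
    using named_act[OF g x(2,1)] named_act[OF g x(3,1)] proj_act[OF g named_D(3)[OF x(2)] x(1)] by blast
qed

definition name_fm :: "nat \<Rightarrow> 'r fm" where
  "name_fm i = (SOME \<phi>. fml L (name_length i) \<phi> \<and>
    (\<forall>M \<in> Mod L T. \<forall>a. length a = name_length i \<longrightarrow> set a \<subseteq> univ M \<longrightarrow> (sat M a \<phi> \<longleftrightarrow> is_name i M a)))"

definition same_point_fm :: "nat \<Rightarrow> nat \<Rightarrow> 'r fm" where
  "same_point_fm i j = (SOME \<phi>. fml L (name_length i + name_length j) \<phi> \<and>
    (\<forall>M \<in> Mod L T. \<forall>c. length c = name_length i + name_length j \<longrightarrow> set c \<subseteq> univ M \<longrightarrow>
      (sat M c \<phi> \<longleftrightarrow> same_point i j M (take (name_length i) c) (drop (name_length i) c))))"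

lemma fml_name_fm: "fml L (name_length i) (name_fm i)"
  and sat_name_fm: "M \<in> Mod L T \<Longrightarrow> length a = name_length i \<Longrightarrow> set a \<subseteq> univ M \<Longrightarrow> sat M a (name_fm i) \<longleftrightarrow> is_name i M a"
  using someI_ex[OF is_name_definable[of i]] unfolding name_fm_def[symmetric] by blast+

lemma fml_same_point_fm: "fml L (name_length i + name_length j) (same_point_fm i j)"
  and sat_same_point_fm': "M \<in> Mod L T \<Longrightarrow> length c = name_length i + name_length j \<Longrightarrow> set c \<subseteq> univ M \<Longrightarrow> 
    sat M c (same_point_fm i j) \<longleftrightarrow> same_point i j M (take (name_length i) c) (drop (name_length i) c)"
  using someI_ex[OF same_point_definable[of i j]] unfolding same_point_fm_def[symmetric] by blast+

lemma sat_same_point_fm: "M \<in> Mod L T \<Longrightarrow> length a = name_length i \<Longrightarrow> length b = name_length j \<Longrightarrow> set a \<subseteq> univ M \<Longrightarrow> set b \<subseteq> univ M \<Longrightarrow> 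
    sat M (a @ b) (same_point_fm i j) \<longleftrightarrow> same_point i j M a b"
  using sat_same_point_fm'[of M "a @ b" i j] by simp

definition raw_sort :: "'r sort_data" where
  "raw_sort = \<lparr>idx = UNIV, vars = name_length, alpha = name_fm, eps = same_point_fm\<rparr>"

definition point_sort :: "'r sort_data" where
  "point_sort = relativize raw_sort"

lemma imaginary_point_sort: "imaginary_sort L T point_sort"
  unfolding point_sort_def by (rule imaginary_sort_relativize) (simp_all add: raw_sort_def fml_name_fm fml_same_point_fm)

lemma same_point_equivalence:
  "same_point i j M a b \<Longrightarrow> is_name i M a \<and> is_name j M b"
  "is_name i M a \<Longrightarrow> same_point i i M a a"
  "same_point i j M a b \<Longrightarrow> same_point j i M b a"
  "same_point i j M a b \<Longrightarrow> same_point j k M b c \<Longrightarrow> same_point i k M a c"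
proof -
  assume "same_point i j M a b" "same_point j k M b c"
  then obtain x x' where x: "proj X x = M" "x \<in> named i a" "x \<in> named j b" 
    "proj X x' = M" "x' \<in> named j b" "x' \<in> named k c" by (auto simp: same_point_def)
  then have "x = x'" using named_inj by blast
  then show "same_point i k M a c" using x by (auto simp: same_point_def)
qed (auto simp: same_point_def is_name_def)

text \<open>Transitivity is the axiom with content: two points with a common name over the same model are equal.\<close>

lemma sat_equivalence_axiom:
  assumes M: "M \<in> Mod L T"
  shows "sat M as (equivalence_axiom raw_sort)"
proof -
  have sub: "set (map (\<lambda>k. cs ! k) vs) \<subseteq> univ M" if "\<And>k. k < n \<Longrightarrow> cs ! k \<in> univ M" "set vs \<subseteq> {..<n}" for cs vs n
    using that by auto
  have al: "sat M cs (app (name_fm i) vs) \<longleftrightarrow> is_name i M (map (\<lambda>k. cs ! k) vs)"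
    if "\<And>k. k < n \<Longrightarrow> cs ! k \<in> univ M" "set vs \<subseteq> {..<n}" "length vs = name_length i" for i cs vs n
    unfolding sat_app[OF fml_name_fm[of i, folded that(3)]]
    by (rule sat_name_fm[OF M _ sub[OF that(1,2)]]) (simp_all add: that(3))
  have ep: "sat M cs (app (same_point_fm i j) (vs @ ws)) \<longleftrightarrow> same_point i j M (map (\<lambda>k. cs ! k) vs) (map (\<lambda>k. cs ! k) ws)"
    if "\<And>k. k < n \<Longrightarrow> cs ! k \<in> univ M" "set vs \<subseteq> {..<n}" "set ws \<subseteq> {..<n}" "length vs = name_length i" "length ws = name_length j" for i j cs vs ws n
  proof -
    have "fml L (length (vs @ ws)) (same_point_fm i j)" using fml_same_point_fm that(4,5) by simp
    moreover have "sat M (map (\<lambda>k. cs ! k) vs @ map (\<lambda>k. cs ! k) ws) (same_point_fm i j) \<longleftrightarrow>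
        same_point i j M (map (\<lambda>k. cs ! k) vs) (map (\<lambda>k. cs ! k) ws)"
      by (rule sat_same_point_fm[OF M _ _ sub[OF that(1,2)] sub[OF that(1,3)]]) (simp_all add: that(4,5))
    ultimately show ?thesis using sat_app[of L "vs @ ws" "same_point_fm i j" M cs] by (simp only: map_append)
  qed
  have nth: "(bs @ as) ! k \<in> univ M" if "length bs = n" "set bs \<subseteq> univ M" "k < n" for bs k n
    using that by (auto simp: nth_append)
  have "\<xi> \<in> axioms_of raw_sort \<Longrightarrow> sat M as \<xi>" for \<xi>
    unfolding axioms_of_def raw_sort_def sort_data.simps Let_def
  proof ((elim UnE UN_E singletonE; simp only: sat_Alls sat_Imp sat_And; intro allI impI), goal_cases)
    case (1 i j bs)
    let ?v = "map (\<lambda>k. (bs @ as) ! k)" and ?x = "[0..<name_length i]" and ?y = "[name_length i..<name_length i + name_length j]"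
    note n = nth[OF 1(4,5)]
    have "sat M (bs @ as) (app (same_point_fm i j) (?x @ ?y)) \<longleftrightarrow> same_point i j M (?v ?x) (?v ?y)" by (rule ep[OF n]) auto
    moreover have "sat M (bs @ as) (app (name_fm i) ?x) \<longleftrightarrow> is_name i M (?v ?x)" by (rule al[OF n]) auto
    moreover have "sat M (bs @ as) (app (name_fm j) ?y) \<longleftrightarrow> is_name j M (?v ?y)" by (rule al[OF n]) auto
    ultimately show ?case using 1(6) same_point_equivalence(1) by blast
  next
    case (2 i bs)
    let ?v = "map (\<lambda>k. (bs @ as) ! k)" and ?x = "[0..<name_length i]"
    note n = nth[OF 2(3,4)]
    have "sat M (bs @ as) (app (name_fm i) ?x) \<longleftrightarrow> is_name i M (?v ?x)" by (rule al[OF n]) auto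
    moreover have "sat M (bs @ as) (app (same_point_fm i i) (?x @ ?x)) \<longleftrightarrow> same_point i i M (?v ?x) (?v ?x)" by (rule ep[OF n]) auto
    ultimately show ?case using 2(5) same_point_equivalence(2) by blast
  next
    case (3 i j bs)
    let ?v = "map (\<lambda>k. (bs @ as) ! k)" and ?x = "[0..<name_length i]" and ?y = "[name_length i..<name_length i + name_length j]"
    note n = nth[OF 3(4,5)]
    have "sat M (bs @ as) (app (same_point_fm i j) (?x @ ?y)) \<longleftrightarrow> same_point i j M (?v ?x) (?v ?y)" by (rule ep[OF n]) auto
    moreover have "sat M (bs @ as) (app (same_point_fm j i) (?y @ ?x)) \<longleftrightarrow> same_point j i M (?v ?y) (?v ?x)" by (rule ep[OF n]) auto
    ultimately show ?case using 3(6) same_point_equivalence(3) by blast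
  next
    case (4 i j k bs)
    let ?v = "map (\<lambda>k. (bs @ as) ! k)" and ?x = "[0..<name_length i]" and ?y = "[name_length i..<name_length i + name_length j]"
      and ?z = "[name_length i + name_length j..<name_length i + name_length j + name_length k]"
    note n = nth[OF 4(5,6)]
    have "sat M (bs @ as) (app (same_point_fm i j) (?x @ ?y)) \<longleftrightarrow> same_point i j M (?v ?x) (?v ?y)" by (rule ep[OF n]) auto
    moreover have "sat M (bs @ as) (app (same_point_fm j k) (?y @ ?z)) \<longleftrightarrow> same_point j k M (?v ?y) (?v ?z)" by (rule ep[OF n]) auto
    moreover have "sat M (bs @ as) (app (same_point_fm i k) (?x @ ?z)) \<longleftrightarrow> same_point i k M (?v ?x) (?v ?z)" by (rule ep[OF n]) auto
    ultimately show ?case using 4(7) same_point_equivalence(4) by blast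
  qed
  then show ?thesis by (simp add: equivalence_axiom_def rcset_axioms)
qed

lemma point_sort_simps: "idx point_sort = UNIV" "vars point_sort = name_length"
  "alpha point_sort i = And (name_fm i) (equivalence_axiom raw_sort)" "eps point_sort i j = And (same_point_fm i j) (equivalence_axiom raw_sort)"
  by (simp_all add: point_sort_def relativize_def raw_sort_def)

lemma alphas_point_sort: "M \<in> Mod L T \<Longrightarrow> alphas point_sort M = {(i, a). is_name i M a}"
proof -
  assume M: "M \<in> Mod L T"
  have "length a = name_length i \<and> set a \<subseteq> univ M" if "is_name i M a" for i a
    using that named_D unfolding is_name_def by blast
  then show ?thesis
    unfolding alphas_def point_sort_simps sat_And using sat_equivalence_axiom[OF M] sat_name_fm[OF M] by auto
qed

lemma epss_point_sort: "M \<in> Mod L T \<Longrightarrow> epss point_sort M = {((i, a), (j, b)). same_point i j M a b}"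
proof -
  assume M: "M \<in> Mod L T"
  have "length a = name_length i \<and> set a \<subseteq> univ M \<and> length b = name_length j \<and> set b \<subseteq> univ M" if "same_point i j M a b" for i j a b
    using that named_D unfolding same_point_def by blast
  then have iff: "length a = name_length i \<and> set a \<subseteq> univ M \<and> length b = name_length j \<and> set b \<subseteq> univ M \<and>
      sat M (a @ b) (eps point_sort i j) \<longleftrightarrow> same_point i j M a b" for i j a b
    unfolding point_sort_simps sat_And using sat_equivalence_axiom[OF M] sat_same_point_fm[OF M] by blast
  show ?thesis
    unfolding epss_def using iff by (auto simp: point_sort_simps(1,2) simp del: sat_Conj)
qed

definition names :: "'x \<Rightarrow> (nat \<times> nat list) set" where
  "names x = {(i, a). x \<in> named i a}"

text \<open>Equivalent names denote the same point, because each of the two denotes only one.\<close>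

lemma names_eq_class: "x \<in> named i a \<Longrightarrow> epss point_sort (proj X x) `` {(i, a)} = names x"
proof -
  assume x: "x \<in> named i a"
  have "same_point i j (proj X x) a b \<longleftrightarrow> x \<in> named j b" for j b
    using x named_inj by (auto simp: same_point_def)
  then show ?thesis using epss_point_sort[OF proj_Mod[OF named_D(3)[OF x]]] by (auto simp: names_def)
qed

lemma interp_point_sort: "M \<in> Mod L T \<Longrightarrow> interp_sort point_sort M = {names x | x. x \<in> S \<and> proj X x = M}"
proof -
  assume M: "M \<in> Mod L T"
  have "interp_sort point_sort M = {epss point_sort M `` {(i, a)} | i a x. proj X x = M \<and> x \<in> named i a}"
    unfolding interp_sort_def quotient_def alphas_point_sort[OF M] is_name_def by blast
  also have "\<dots> = {names x | x. x \<in> S \<and> proj X x = M}"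
  proof (intro equalityI subsetI)
    fix c assume "c \<in> {epss point_sort M `` {(i, a)} | i a x. proj X x = M \<and> x \<in> named i a}"
    then obtain i a x where "c = epss point_sort M `` {(i, a)}" "proj X x = M" "x \<in> named i a" by blast
    then show "c \<in> {names x | x. x \<in> S \<and> proj X x = M}" using names_eq_class[of x i a] named_D(3) by blast
  next
    fix c assume "c \<in> {names x | x. x \<in> S \<and> proj X x = M}"
    then obtain x where x: "c = names x" "x \<in> S" "proj X x = M" by blast
    then obtain i a where "x \<in> named i a" using named_cover by blast
    then show "c \<in> {epss point_sort M `` {(i, a)} | i a x. proj X x = M \<and> x \<in> named i a}"
      using names_eq_class[of x i a] x by blast
  qed
  finally show ?thesis .
qed

definition to_sort :: "'x \<Rightarrow> ('r, nat) struct \<times> (nat \<times> nat list) set" where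
  "to_sort x = (proj X x, names x)"

lemma names_inj: "x \<in> S \<Longrightarrow> x' \<in> S \<Longrightarrow> proj X x = proj X x' \<Longrightarrow> names x = names x' \<Longrightarrow> x = x'"
proof -
  assume x: "x \<in> S" "x' \<in> S" "proj X x = proj X x'" "names x = names x'"
  obtain i a where ia: "x \<in> named i a" using named_cover[OF x(1)] by blast
  then have "(i, a) \<in> names x'" using x(4) by (auto simp: names_def)
  then show "x = x'" using named_inj[OF ia _ x(3)] by (simp add: names_def)
qed

lemma names_act:
  assumes g: "(M, g, N) \<in> Isos L T" and x: "x \<in> S" "proj X x = M"
  shows "names (act X (M, g, N) x) = (\<lambda>(i, a). (i, map g a)) ` names x"
proof (intro equalityI subsetI)
  fix y assume "y \<in> (\<lambda>(i, a). (i, map g a)) ` names x"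
  then show "y \<in> names (act X (M, g, N) x)" using named_act[OF g _ x(2)] by (auto simp: names_def)
next
  fix y assume "y \<in> names (act X (M, g, N) x)"
  then obtain i b where y: "y = (i, b)" "act X (M, g, N) x \<in> named i b" by (auto simp: names_def)
  let ?h = "restrict (inv_into (univ M) g) (univ N)"
  have p: "proj X (act X (M, g, N) x) = N" by (rule proj_act[OF g x])
  have "x \<in> named i (map ?h b)"
    using named_act[OF Isos_inv[OF g] y(2) p] act_inverse[OF g x] by simp
  moreover have "map g (map ?h b) = b"
  proof -
    have "bij_betw g (univ M) (univ N)" using g by (simp add: Isos_def is_iso_def)
    moreover have "set b \<subseteq> univ N" using named_D(2)[OF y(2)] p by simp
    ultimately show ?thesis unfolding map_map by (intro map_idI) (auto simp: bij_betw_inv_into_right)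
  qed
  ultimately show "y \<in> (\<lambda>(i, a). (i, map g a)) ` names x"
    unfolding y(1) names_def by (intro image_eqI[of _ _ "(i, map ?h b)"]) simp_all
qed

lemma space_sortB: "space (sortB L T point_sort) = (SIGMA M : Mod L T. interp_sort point_sort M)"
  unfolding sortB_def Let_def by (rule space_measure_of) auto

lemma to_sort_space: "x \<in> S \<Longrightarrow> to_sort x \<in> space (sortB L T point_sort)"
  using proj_Mod unfolding space_sortB to_sort_def by (auto simp: interp_point_sort)

text \<open>Where the name \<open>(i, a)\<close> is valid, choosing it as representative is a measurable map. Hence membership of
  \<open>to_sort x\<close> in a measurable set can be tested on each of the countably many sets \<open>named i a\<close>.\<close>

lemma name_measurable:
  "(\<lambda>x. (proj X x, (i, a))) \<in> restrict_space (pts X) (named i a) \<rightarrow>\<^sub>M alphasB L T point_sort"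
  unfolding alphasB_def Let_def
proof (rule measurable_measure_of)
  let ?\<Omega> = "SIGMA M : Mod L T. alphas point_sort M"
  let ?R = "restrict_space (pts X) (named i a)"
  have \<Omega>: "(proj X x, (i, a)) \<in> ?\<Omega>" if "x \<in> named i a" for x
    using that proj_Mod[OF named_D(3)[OF that]] alphas_point_sort by (auto simp: is_name_def)
  have R: "space ?R = named i a" using sets.sets_into_space[OF sets_named] by (auto simp: space_restrict_space)
  show "(\<lambda>x. (proj X x, (i, a))) \<in> space ?R \<rightarrow> ?\<Omega>" unfolding R using \<Omega> by blast
  fix B assume "B \<in> {S. S \<subseteq> ?\<Omega> \<and> (\<forall>i as. {M. (M, (i, as)) \<in> S} \<in>
      sets (restrict_space (ModB L T) {M. (M, (i, as)) \<in> ?\<Omega>}))}"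
  then have "{M. (M, (i, a)) \<in> B} \<in> sets (restrict_space (ModB L T) {M. (M, (i, a)) \<in> ?\<Omega>})" by blast
  then obtain C where C: "C \<in> sets (ModB L T)" "{M. (M, (i, a)) \<in> B} = {M. (M, (i, a)) \<in> ?\<Omega>} \<inter> C"
    unfolding sets_restrict_space by blast
  have "(\<lambda>x. (proj X x, (i, a))) -` B \<inter> space ?R = named i a \<inter> (proj X -` C \<inter> S)"
    unfolding R using C(2) \<Omega> named_D(3) by blast
  moreover have "proj X -` C \<inter> S \<in> sets (pts X)" by (rule measurable_sets[OF proj_meas C(1)])
  ultimately show "(\<lambda>x. (proj X x, (i, a))) -` B \<inter> space ?R \<in> sets ?R"
    unfolding sets_restrict_space by blast
qed auto

lemma to_sort_measurable: "to_sort \<in> pts X \<rightarrow>\<^sub>M sortB L T point_sort"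
  unfolding sortB_def Let_def
proof (rule measurable_measure_of)
  show "to_sort \<in> S \<rightarrow> (SIGMA M : Mod L T. interp_sort point_sort M)" using to_sort_space unfolding space_sortB by blast
  fix B assume "B \<in> {B. B \<subseteq> (SIGMA M : Mod L T. interp_sort point_sort M) \<and>
      {(M, u) \<in> space (alphasB L T point_sort). (M, epss point_sort M `` {u}) \<in> B} \<in> sets (alphasB L T point_sort)}"
  then have B: "{(M, u) \<in> space (alphasB L T point_sort). (M, epss point_sort M `` {u}) \<in> B} \<in> sets (alphasB L T point_sort)" (is "?B \<in> _") by blast
  have "{x \<in> named i a. to_sort x \<in> B} \<in> sets (pts X)" for i a
  proof -
    let ?R = "restrict_space (pts X) (named i a)"
    have R: "space ?R = named i a" using sets.sets_into_space[OF sets_named] by (auto simp: space_restrict_space)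
    have "(\<lambda>x. (proj X x, (i, a))) -` ?B \<inter> space ?R \<in> sets ?R" by (rule measurable_sets[OF name_measurable B])
    moreover have "(\<lambda>x. (proj X x, (i, a))) -` ?B \<inter> space ?R = {x \<in> named i a. to_sort x \<in> B}"
    proof (rule set_eqI)
      fix x
      have "(proj X x, (i, a)) \<in> ?B \<longleftrightarrow> to_sort x \<in> B" if x: "x \<in> named i a"
      proof -
        have "(proj X x, (i, a)) \<in> space (alphasB L T point_sort)"
          using measurable_space[OF name_measurable, of x i a] x R by simp
        then show ?thesis using names_eq_class[OF x] by (simp add: to_sort_def)
      qed
      then show "x \<in> (\<lambda>x. (proj X x, (i, a))) -` ?B \<inter> space ?R \<longleftrightarrow> x \<in> {x \<in> named i a. to_sort x \<in> B}"
        unfolding R by blast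
    qed
    ultimately show ?thesis using sets_restrict_space_iff[of "named i a" "pts X"] sets_named[of i a]
      sets.sets_into_space[OF sets_named[of i a]] by (simp add: Int_absorb2)
  qed
  then have "(\<Union>i. \<Union>a. {x \<in> named i a. to_sort x \<in> B}) \<in> sets (pts X)"
    by (intro sets.countable_UN' image_subsetI) simp_all
  also have "(\<Union>i. \<Union>a. {x \<in> named i a. to_sort x \<in> B}) = to_sort -` B \<inter> S"
  proof (intro equalityI subsetI)
    fix x assume "x \<in> to_sort -` B \<inter> S"
    then obtain i a where "x \<in> named i a" "to_sort x \<in> B" using named_cover by blast
    then show "x \<in> (\<Union>i. \<Union>a. {x \<in> named i a. to_sort x \<in> B})" by blast
  qed (use named_D(3) in blast)
  finally show "to_sort -` B \<inter> S \<in> sets (pts X)" .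
qed auto

lemma to_sort_iso: "gspace_iso (ModG L T) X (sort_gspace L T point_sort) to_sort"
  unfolding gspace_iso_def
proof (intro conjI)
  show "to_sort \<in> pts X \<rightarrow>\<^sub>M pts (sort_gspace L T point_sort)"
    using to_sort_measurable by (simp add: sort_gspace_def)
  have "inj_on to_sort S" using names_inj by (auto simp: inj_on_def to_sort_def)
  moreover have "to_sort ` S = space (sortB L T point_sort)"
  proof (intro equalityI subsetI)
    fix y assume "y \<in> space (sortB L T point_sort)"
    then obtain M c where y: "y = (M, c)" "M \<in> Mod L T" "c \<in> interp_sort point_sort M" unfolding space_sortB by blast
    then obtain x where "c = names x" "x \<in> S" "proj X x = M" unfolding interp_point_sort[OF y(2)] by blast
    then show "y \<in> to_sort ` S" using y(1) by (auto simp: to_sort_def)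
  qed (use to_sort_space in blast)
  ultimately show "bij_betw to_sort S (space (pts (sort_gspace L T point_sort)))"
    by (simp add: bij_betw_def sort_gspace_def)
  show "\<forall>x\<in>S. proj (sort_gspace L T point_sort) (to_sort x) = proj X x" by (simp add: sort_gspace_def to_sort_def)
  show "\<forall>(g, x)\<in>action_dom (ModG L T) X. to_sort (act X g x) = act (sort_gspace L T point_sort) g (to_sort x)"
  proof (intro ballI, clarify)
    fix M g N x assume "((M, g, N), x) \<in> action_dom (ModG L T) X"
    then have g: "(M, g, N) \<in> Isos L T" "x \<in> S" "proj X x = M"
      unfolding mem_action_dom fst_conv by blast+
    show "to_sort (act X (M, g, N) x) = act (sort_gspace L T point_sort) (M, g, N) (to_sort x)"
      using proj_act[OF g] names_act[OF g] by (simp add: to_sort_def sort_gspace_def)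
  qed
qed

end

theorem theorem1p2:
  fixes L :: "'r lang"
    and T :: "'r fm set"
    and X :: "('x, ('r, nat) struct, 'r miso) gspace"
  assumes "countable (syms L)"
    and "is_theory L T"
    and "countable T"
    and "fc_borel_gspace (ModG L T) X"
  shows "\<exists>A f. imaginary_sort L T A \<and> gspace_iso (ModG L T) X (sort_gspace L T A) f"
proof -
  interpret mod_gspace L T X by unfold_locales (use assms in auto)
  show ?thesis using imaginary_point_sort to_sort_iso by blast
qed

end
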